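(* Let $K$ be a (pathwise connected) poset with fundamental group $\Pi=\pi_1^a(K)$, $a\in K$, let $(\mathcal A,\jmath)_K$ be a net of $*$-algebras, and let $A$ be the associated $*$-algebra with $\Pi$-action (the fibre over $a$ of the enveloping net bundle of $(\mathcal A,\jmath)_K$). Then there is an equivalence between the category $\mathrm{ncg}(\mathcal A,\jmath)_K$ of (even) nets of spectral triples over $(\mathcal A,\jmath)_K$ and the category $\mathrm{ncg}_\Pi(A)$ of (even) $\Pi$-equivariant spectral triples over $(A,\Pi)$.
   Context: **Posets.** $K$ is a non-empty poset. A 1-simplex is $b=(|b|;\partial_0b,\partial_1b)$ with $\partial_0b,\partial_1b\le|b|$ in $K$, viewed as a segment from $\partial_1 b$ to $\partial_0 b$. A path $p:a\to o$ is a finite sequence $p=b_n*\cdots*b_1$ of 1-simplices with $\partial_1b_1=a$, $\partial_0b_n=o$, $\partial_1b_{i+1}=\partial_0b_i$. $K$ is assumed pathwise connected. Homotopy $\sim$ is the equivalence relation on paths with the same endpoints generated, compatibly with composition, by $b_2*b_1\sim b$ whenever $\partial_1b_1=\partial_1b$, $\partial_0b_1=\partial_1b_2$, $\partial_0b_2=\partial_0b$ and there is $c\in K$ with $|b|,|b_1|,|b_2|\le c$. $\Pi:=\pi_1^a(K)$ is the group of homotopy classes of loops $a\to a$. For $o\le\tilde o$ write $(\tilde oo)$ for the 1-simplex $(\tilde o;\tilde o,o)$, a path $o\to\tilde o$. **Nets.** A net of $*$-algebras $(\mathcal A,\jmath)_K$ is a family of $*$-algebras $\mathcal A_o$, $o\in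 K$, with $*$-monomorphisms $\jmath_{o'o}:\mathcal A_o\to\mathcal A_{o'}$, $o\le o'$, satisfying $\jmath_{o''o}=\jmath_{o''o'}\circ\jmath_{o'o}$. It is equipped with a grading $\beta=\{\beta_o\}$, an automorphism of the net with $\beta^2=\mathrm{id}$ (possibly trivial). A Hilbert net bundle $(\mathcal H,U)_K$ is a family of Hilbert spaces $\mathcal H_o$ and unitaries $U_{o'o}:\mathcal H_o\to\mathcal H_{o'}$, $o\le o'$, with $U_{o''o}=U_{o''o'}U_{o'o}$. A grading on it is a family of unitaries $\Gamma_o$ on $\mathcal H_o$ with $\Gamma_o^2=1_o$, $\Gamma_{o'}U_{o'o}=U_{o'o}\Gamma_o$. A graded representation $\pi$ on $(\mathcal H,U;\Gamma)_K$ is a family of $*$-morphisms $\pi_o:\mathcal A_o\to B(\mathcal H_o)$ with $\mathrm{ad}\,U_{o'o}\circ\pi_o=\pi_{o'}\circ\jmath_{o'o}$ for $o\le o'$ and $\pi_o\circ\beta_o=\mathrm{ad}\,\Gamma_o\circ\pi_o$. **The $*$-algebra $A$.** $A$ is the $*$-algebra generated by pairs $(p,t)$, $p:o\to a$, $o\in K$, $t\in\mathcal A_o$, with relations $$(p,t)+\lambda(p,t')=(p,t+\lambda t'),\quad (p,t)(p,t')=(p,tt'),\quad (p,t)^*=(p,t^* ),$$ $$(p*(\tilde oo),t)=(p,\jmath_{\tilde oo}(t))\ \text{ for }o\le\tilde o,\ p:\tilde o\to a,\ t\in\mathcal A_o,\qquad (p,t)=(p',t)\ \text{ if }p\sim p'.$$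 $\Pi$ acts by $*$-automorphisms $g(p,t):=(g*p,t)$ for $g:a\to a$; the grading is $(p,t)\mapsto(p,\beta_o(t))$. **Superderivations.** For a selfadjoint operator $D$ and a grading unitary $\Gamma$ on $H$, $\mathrm{Dom}(\delta)$ is the set of $t\in B(H)$ for which there is $b\in B(H)$ with $\mathrm{ad}\,\Gamma(t)\,D\subset Dt-b$ (inclusion of unbounded operators), and $\delta(t):=Dt-\mathrm{ad}\,\Gamma(t)D$. **Nets of spectral triples.** An even net of spectral triples $(\mathcal H,U,\Gamma,D,\pi)$ over $(\mathcal A,\jmath)_K$ is a graded Hilbert net bundle $(\mathcal H,U;\Gamma)_K$ with a graded representation $\pi$, and a family $D=\{D_o:\mathrm{Dom}(D_o)\to\mathcal H_o\}$ of odd (with respect to $\Gamma_o$), unbounded selfadjoint operators such that $\mathrm{ad}\,U_{o'o}(D_o)=D_{o'}$ for $o\le o'$ (including equality of domains, $U_{o'o}\mathrm{Dom}(D_o)=\mathrm{Dom}(D_{o'})$), $\mathrm{Tr}(e^{-\beta D_o^2})<\infty$ for all $\beta>0$ ($\theta$-summability), and $\pi_o(\mathcal A_o)\subseteq\mathrm{Dom}(\delta_o)$ for all $o$, with $\delta_o$ the superderivation defined by $D_o,\Gamma_o$. An arrow $(\mathcal H,U,\Gamma,D,\pi)\to(\mathcal H',U',\Gamma',D',\pi')$ in $\mathrm{ncg}(\mathcal A,\jmath)_K$ is a family of unitaries $V_o:\mathcal H_o\to\mathcal H'_o$ with $V_{o'}U_{o'o}=U'_{o'o}V_o$ for $o\le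 o'$, $V_o\Gamma_o=\Gamma'_oV_o$, $\mathrm{ad}\,V_o\circ\pi_o=\pi'_o$, $\mathrm{ad}\,V_o(D_o)=D'_o$. **Equivariant spectral triples.** An object $(H,\Gamma,D,\pi,u)$ of $\mathrm{ncg}_\Pi(A)$ is a graded Hilbert space $(H;\Gamma)$ with a unitary representation $u:\Pi\to U(H)$ such that $u_g\Gamma=\Gamma u_g$; a graded representation $\pi:A\to B(H)$ with $\pi(gt)=u_g\pi(t)u_g^*$ for $g\in\Pi$, $t\in A$; and an odd, unbounded, selfadjoint, $\Pi$-invariant ($u_gD=Du_g$) operator $D:\mathrm{Dom}(D)\to H$ with $\mathrm{Tr}(e^{-\beta D^2})<\infty$ for all $\beta>0$ and $\pi(A)\subseteq\mathrm{Dom}(\delta)$, with $\delta$ defined by $D,\Gamma$. An arrow to $(H',\Gamma',D',\pi',u')$ is a unitary $V:H\to H'$ with $Vu_g=u'_gV$ for all $g\in\Pi$, $V\Gamma=\Gamma'V$, $\mathrm{ad}\,V\circ\pi=\pi'$, $\mathrm{ad}\,V(D)=D'$. *)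

theory Defs
  imports "HOL-Analysis.Analysis" "HOL-Algebra.Group"
begin

section \<open>Categories and equivalences\<close>

text \<open>Arrows need not determine their source and target, so identities, composites and the
  arrow part of a functor are indexed by objects: \<^emph>\<open>Comp C X Y Z g f\<close> is the composite
  of \<^emph>\<open>f : X \<rightarrow> Y\<close> and \<^emph>\<open>g : Y \<rightarrow> Z\<close>.\<close>

record ('o, 'm) cat_data =
  Obj :: "'o set"
  Hom :: "'o \<Rightarrow> 'o \<Rightarrow> 'm set"
  Idt :: "'o \<Rightarrow> 'm"
  Comp :: "'o \<Rightarrow> 'o \<Rightarrow> 'o \<Rightarrow> 'm \<Rightarrow> 'm \<Rightarrow> 'm"

locale category =
  fixes C :: "('o, 'm) cat_data"
  assumes Idt_in: "X \<in> Obj C \<Longrightarrow> Idt C X \<in> Hom C X X"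
    and Comp_in: "\<lbrakk>X \<in> Obj C; Y \<in> Obj C; Z \<in> Obj C; f \<in> Hom C X Y; g \<in> Hom C Y Z\<rbrakk>
      \<Longrightarrow> Comp C X Y Z g f \<in> Hom C X Z"
    and Idt_left: "\<lbrakk>X \<in> Obj C; Y \<in> Obj C; f \<in> Hom C X Y\<rbrakk> \<Longrightarrow> Comp C X Y Y (Idt C Y) f = f"
    and Idt_right: "\<lbrakk>X \<in> Obj C; Y \<in> Obj C; f \<in> Hom C X Y\<rbrakk> \<Longrightarrow> Comp C X X Y f (Idt C X) = f"
    and Comp_assoc: "\<lbrakk>W \<in> Obj C; X \<in> Obj C; Y \<in> Obj C; Z \<in> Obj C;
        f \<in> Hom C W X; g \<in> Hom C X Y; h \<in> Hom C Y Z\<rbrakk>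
      \<Longrightarrow> Comp C W Y Z h (Comp C W X Y g f) = Comp C W X Z (Comp C X Y Z h g) f"

definition is_functor ::
  "('o, 'm) cat_data \<Rightarrow> ('p, 'n) cat_data \<Rightarrow> ('o \<Rightarrow> 'p) \<Rightarrow> ('o \<Rightarrow> 'o \<Rightarrow> 'm \<Rightarrow> 'n) \<Rightarrow> bool" where
  "is_functor C D F\<^sub>0 F\<^sub>1 \<longleftrightarrow>
    (\<forall>X\<in>Obj C. F\<^sub>0 X \<in> Obj D) \<and>
    (\<forall>X\<in>Obj C. \<forall>Y\<in>Obj C. \<forall>f\<in>Hom C X Y. F\<^sub>1 X Y f \<in> Hom D (F\<^sub>0 X) (F\<^sub>0 Y)) \<and>
    (\<forall>X\<in>Obj C. F\<^sub>1 X X (Idt C X) = Idt D (F\<^sub>0 X)) \<and>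
    (\<forall>X\<in>Obj C. \<forall>Y\<in>Obj C. \<forall>Z\<in>Obj C. \<forall>f\<in>Hom C X Y. \<forall>g\<in>Hom C Y Z.
      F\<^sub>1 X Z (Comp C X Y Z g f) = Comp D (F\<^sub>0 X) (F\<^sub>0 Y) (F\<^sub>0 Z) (F\<^sub>1 Y Z g) (F\<^sub>1 X Y f))"

definition isomorphism :: "('o, 'm) cat_data \<Rightarrow> 'o \<Rightarrow> 'o \<Rightarrow> 'm \<Rightarrow> bool" where
  "isomorphism C X Y f \<longleftrightarrow> f \<in> Hom C X Y \<and>
    (\<exists>g\<in>Hom C Y X. Comp C X Y X g f = Idt C X \<and> Comp C Y X Y f g = Idt C Y)"

definition natural_isomorphism ::
  "('o, 'm) cat_data \<Rightarrow> ('p, 'n) cat_data \<Rightarrow> ('o \<Rightarrow> 'p) \<Rightarrow> ('o \<Rightarrow> 'o \<Rightarrow> 'm \<Rightarrow> 'n)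
    \<Rightarrow> ('o \<Rightarrow> 'p) \<Rightarrow> ('o \<Rightarrow> 'o \<Rightarrow> 'm \<Rightarrow> 'n) \<Rightarrow> ('o \<Rightarrow> 'n) \<Rightarrow> bool" where
  "natural_isomorphism C D F\<^sub>0 F\<^sub>1 G\<^sub>0 G\<^sub>1 \<eta> \<longleftrightarrow>
    (\<forall>X\<in>Obj C. isomorphism D (F\<^sub>0 X) (G\<^sub>0 X) (\<eta> X)) \<and>
    (\<forall>X\<in>Obj C. \<forall>Y\<in>Obj C. \<forall>f\<in>Hom C X Y.
      Comp D (F\<^sub>0 X) (F\<^sub>0 Y) (G\<^sub>0 Y) (\<eta> Y) (F\<^sub>1 X Y f)
        = Comp D (F\<^sub>0 X) (G\<^sub>0 X) (G\<^sub>0 Y) (G\<^sub>1 X Y f) (\<eta> X))"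

definition equivalent_categories :: "('o, 'm) cat_data \<Rightarrow> ('p, 'n) cat_data \<Rightarrow> bool" where
  "equivalent_categories C D \<longleftrightarrow> category C \<and> category D \<and>
    (\<exists>F\<^sub>0 F\<^sub>1 G\<^sub>0 G\<^sub>1 \<eta> \<epsilon>. is_functor C D F\<^sub>0 F\<^sub>1 \<and> is_functor D C G\<^sub>0 G\<^sub>1 \<and>
      natural_isomorphism C C (\<lambda>X. X) (\<lambda>X Y f. f)
        (\<lambda>X. G\<^sub>0 (F\<^sub>0 X)) (\<lambda>X Y f. G\<^sub>1 (F\<^sub>0 X) (F\<^sub>0 Y) (F\<^sub>1 X Y f)) \<eta> \<and>
      natural_isomorphism D D
        (\<lambda>X. F\<^sub>0 (G\<^sub>0 X)) (\<lambda>X Y f. F\<^sub>1 (G\<^sub>0 X) (G\<^sub>0 Y) (G\<^sub>1 X Y f)) (\<lambda>X. X) (\<lambda>X Y f. f) \<epsilon>)"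


section \<open>Complex vector spaces, star-algebras and Hilbert spaces on carriers\<close>

text \<open>A net involves a whole family of algebras and Hilbert spaces, so these are structures on
  carrier sets rather than instances of type classes.\<close>

record 'v cvec = "'v partial_object" +
  vzero :: 'v
  vadd :: "'v \<Rightarrow> 'v \<Rightarrow> 'v"
  vscale :: "complex \<Rightarrow> 'v \<Rightarrow> 'v"

locale complex_vector_space =
  fixes V :: "('v, 'm) cvec_scheme"
  assumes zero_closed: "vzero V \<in> carrier V"
    and add_closed: "\<lbrakk>x \<in> carrier V; y \<in> carrier V\<rbrakk> \<Longrightarrow> vadd V x y \<in> carrier V"
    and scale_closed: "x \<in> carrier V \<Longrightarrow> vscale V c x \<in> carrier V"
    and add_assoc: "\<lbrakk>x \<in> carrier V; y \<in> carrier V; z \<in> carrier V\<rbrakk>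
      \<Longrightarrow> vadd V (vadd V x y) z = vadd V x (vadd V y z)"
    and add_commute: "\<lbrakk>x \<in> carrier V; y \<in> carrier V\<rbrakk> \<Longrightarrow> vadd V x y = vadd V y x"
    and add_zero: "x \<in> carrier V \<Longrightarrow> vadd V x (vzero V) = x"
    and add_neg: "x \<in> carrier V \<Longrightarrow> vadd V x (vscale V (- 1) x) = vzero V"
    and scale_add_right: "\<lbrakk>x \<in> carrier V; y \<in> carrier V\<rbrakk>
      \<Longrightarrow> vscale V c (vadd V x y) = vadd V (vscale V c x) (vscale V c y)"
    and scale_add_left: "x \<in> carrier V
      \<Longrightarrow> vscale V (c + d) x = vadd V (vscale V c x) (vscale V d x)"
    and scale_scale: "x \<in> carrier V \<Longrightarrow> vscale V c (vscale V d x) = vscale V (c * d) x"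
    and scale_one: "x \<in> carrier V \<Longrightarrow> vscale V 1 x = x"

definition vdiff :: "('v, 'm) cvec_scheme \<Rightarrow> 'v \<Rightarrow> 'v \<Rightarrow> 'v" where
  "vdiff V x y = vadd V x (vscale V (- 1) y)"

record 'a star_alg = "'a cvec" +
  amult :: "'a \<Rightarrow> 'a \<Rightarrow> 'a"
  astar :: "'a \<Rightarrow> 'a"

text \<open>No unit is required, and morphisms are not asked to preserve units.\<close>

locale star_algebra = complex_vector_space A for A :: "('a, 'm) star_alg_scheme" +
  assumes mult_closed: "\<lbrakk>x \<in> carrier A; y \<in> carrier A\<rbrakk> \<Longrightarrow> amult A x y \<in> carrier A"
    and star_closed: "x \<in> carrier A \<Longrightarrow> astar A x \<in> carrier A"
    and mult_assoc: "\<lbrakk>x \<in> carrier A; y \<in> carrier A; z \<in> carrier A\<rbrakk>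
      \<Longrightarrow> amult A (amult A x y) z = amult A x (amult A y z)"
    and mult_add_left: "\<lbrakk>x \<in> carrier A; y \<in> carrier A; z \<in> carrier A\<rbrakk>
      \<Longrightarrow> amult A (vadd A x y) z = vadd A (amult A x z) (amult A y z)"
    and mult_add_right: "\<lbrakk>x \<in> carrier A; y \<in> carrier A; z \<in> carrier A\<rbrakk>
      \<Longrightarrow> amult A x (vadd A y z) = vadd A (amult A x y) (amult A x z)"
    and mult_scale_left: "\<lbrakk>x \<in> carrier A; y \<in> carrier A\<rbrakk>
      \<Longrightarrow> amult A (vscale A c x) y = vscale A c (amult A x y)"
    and mult_scale_right: "\<lbrakk>x \<in> carrier A; y \<in> carrier A\<rbrakk>
      \<Longrightarrow> amult A x (vscale A c y) = vscale A c (amult A x y)"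
    and star_star: "x \<in> carrier A \<Longrightarrow> astar A (astar A x) = x"
    and star_add: "\<lbrakk>x \<in> carrier A; y \<in> carrier A\<rbrakk>
      \<Longrightarrow> astar A (vadd A x y) = vadd A (astar A x) (astar A y)"
    and star_scale: "x \<in> carrier A \<Longrightarrow> astar A (vscale A c x) = vscale A (cnj c) (astar A x)"
    and star_mult: "\<lbrakk>x \<in> carrier A; y \<in> carrier A\<rbrakk>
      \<Longrightarrow> astar A (amult A x y) = amult A (astar A y) (astar A x)"

definition star_hom :: "('a, 'm) star_alg_scheme \<Rightarrow> ('b, 'n) star_alg_scheme \<Rightarrow> ('a \<Rightarrow> 'b) set" where
  "star_hom A B = {f \<in> carrier A \<rightarrow> carrier B.
    (\<forall>x\<in>carrier A. \<forall>y\<in>carrier A. f (vadd A x y) = vadd B (f x) (f y)) \<and>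
    (\<forall>c. \<forall>x\<in>carrier A. f (vscale A c x) = vscale B c (f x)) \<and>
    (\<forall>x\<in>carrier A. \<forall>y\<in>carrier A. f (amult A x y) = amult B (f x) (f y)) \<and>
    (\<forall>x\<in>carrier A. f (astar A x) = astar B (f x))}"

record 'h hilb = "'h cvec" +
  hinner :: "'h \<Rightarrow> 'h \<Rightarrow> complex"

definition hnorm :: "('h, 'm) hilb_scheme \<Rightarrow> 'h \<Rightarrow> real" where
  "hnorm H x = sqrt (Re (hinner H x x))"

text \<open>The inner product is linear in its second argument.\<close>

locale hilbert_space = complex_vector_space H for H :: "('h, 'm) hilb_scheme" +
  assumes inner_add: "\<lbrakk>x \<in> carrier H; y \<in> carrier H; z \<in> carrier H\<rbrakk>
      \<Longrightarrow> hinner H x (vadd H y z) = hinner H x y + hinner H x z"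
    and inner_scale: "\<lbrakk>x \<in> carrier H; y \<in> carrier H\<rbrakk>
      \<Longrightarrow> hinner H x (vscale H c y) = c * hinner H x y"
    and inner_cnj: "\<lbrakk>x \<in> carrier H; y \<in> carrier H\<rbrakk> \<Longrightarrow> hinner H y x = cnj (hinner H x y)"
    and inner_nonneg: "x \<in> carrier H \<Longrightarrow> 0 \<le> Re (hinner H x x)"
    and inner_definite: "\<lbrakk>x \<in> carrier H; hinner H x x = 0\<rbrakk> \<Longrightarrow> x = vzero H"
    and complete: "\<lbrakk>\<And>n::nat. s n \<in> carrier H;
        \<And>e. 0 < e \<Longrightarrow> \<exists>N. \<forall>m\<ge>N. \<forall>n\<ge>N. hnorm H (vdiff H (s m) (s n)) < e\<rbrakk>
      \<Longrightarrow> \<exists>x\<in>carrier H. (\<lambda>n. hnorm H (vdiff H (s n) x)) \<longlonglongrightarrow> 0"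


section \<open>Bounded operators\<close>

text \<open>Everywhere defined operators are extensional functions on the carrier, so that equality of
  functions is equality of operators and \<^const>\<open>compose\<close> is the product.\<close>

definition op_one :: "('h, 'm) hilb_scheme \<Rightarrow> 'h \<Rightarrow> 'h" where
  "op_one H = (\<lambda>x\<in>carrier H. x)"

definition bounded_ops :: "('h, 'm) hilb_scheme \<Rightarrow> ('h \<Rightarrow> 'h) set" where
  "bounded_ops H = {T \<in> carrier H \<rightarrow>\<^sub>E carrier H.
    (\<forall>x\<in>carrier H. \<forall>y\<in>carrier H. T (vadd H x y) = vadd H (T x) (T y)) \<and>
    (\<forall>c. \<forall>x\<in>carrier H. T (vscale H c x) = vscale H c (T x)) \<and>
    (\<exists>M. \<forall>x\<in>carrier H. hnorm H (T x) \<le> M * hnorm H x)}"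

definition unitaries :: "('h, 'm) hilb_scheme \<Rightarrow> ('h, 'n) hilb_scheme \<Rightarrow> ('h \<Rightarrow> 'h) set" where
  "unitaries H H' = {V \<in> carrier H \<rightarrow>\<^sub>E carrier H'.
    (\<forall>x\<in>carrier H. \<forall>y\<in>carrier H. V (vadd H x y) = vadd H' (V x) (V y)) \<and>
    (\<forall>c. \<forall>x\<in>carrier H. V (vscale H c x) = vscale H' c (V x)) \<and>
    (\<forall>x\<in>carrier H. \<forall>y\<in>carrier H. hinner H' (V x) (V y) = hinner H x y) \<and>
    V ` carrier H = carrier H'}"

definition unitary_group :: "('h, 'm) hilb_scheme \<Rightarrow> ('h \<Rightarrow> 'h) monoid" where
  "unitary_group H = \<lparr>carrier = unitaries H H, mult = compose (carrier H), one = op_one H\<rparr>"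

text \<open>\<^emph>\<open>ad V (T) = V T V*\<close> for a unitary \<^emph>\<open>V\<close> defined on \<^emph>\<open>H\<close>; here \<^emph>\<open>V*\<close> is the
  inverse of \<^emph>\<open>V\<close>.\<close>

definition ad :: "('h, 'm) hilb_scheme \<Rightarrow> ('h \<Rightarrow> 'h) \<Rightarrow> ('h \<Rightarrow> 'h) \<Rightarrow> 'h \<Rightarrow> 'h" where
  "ad H V T = (\<lambda>y\<in>V ` carrier H. V (T (inv_into (carrier H) V y)))"

definition grading_unitary :: "('h, 'm) hilb_scheme \<Rightarrow> ('h \<Rightarrow> 'h) \<Rightarrow> bool" where
  "grading_unitary H \<Gamma> \<longleftrightarrow> \<Gamma> \<in> unitaries H H \<and> compose (carrier H) \<Gamma> \<Gamma> = op_one H"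

text \<open>The \<^emph>\<open>*\<close>-morphisms from \<^emph>\<open>A\<close> to \<^emph>\<open>B(H)\<close>.\<close>

definition star_representation ::
  "('a, 'm) star_alg_scheme \<Rightarrow> ('h, 'n) hilb_scheme \<Rightarrow> ('a \<Rightarrow> 'h \<Rightarrow> 'h) \<Rightarrow> bool" where
  "star_representation A H \<pi> \<longleftrightarrow>
    (\<forall>t\<in>carrier A. \<pi> t \<in> bounded_ops H) \<and>
    (\<forall>s\<in>carrier A. \<forall>t\<in>carrier A. \<forall>x\<in>carrier H. \<pi> (vadd A s t) x = vadd H (\<pi> s x) (\<pi> t x)) \<and>
    (\<forall>c. \<forall>t\<in>carrier A. \<forall>x\<in>carrier H. \<pi> (vscale A c t) x = vscale H c (\<pi> t x)) \<and>
    (\<forall>s\<in>carrier A. \<forall>t\<in>carrier A. \<pi> (amult A s t) = compose (carrier H) (\<pi> s) (\<pi> t)) \<and>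
    (\<forall>t\<in>carrier A. \<forall>x\<in>carrier H. \<forall>y\<in>carrier H.
      hinner H (\<pi> (astar A t) x) y = hinner H x (\<pi> t y))"

definition graded_representation ::
  "('a, 'm) star_alg_scheme \<Rightarrow> ('a \<Rightarrow> 'a) \<Rightarrow> ('h, 'n) hilb_scheme \<Rightarrow> ('h \<Rightarrow> 'h)
    \<Rightarrow> ('a \<Rightarrow> 'h \<Rightarrow> 'h) \<Rightarrow> bool" where
  "graded_representation A \<beta> H \<Gamma> \<pi> \<longleftrightarrow> star_representation A H \<pi> \<and>
    (\<forall>t\<in>carrier A. \<pi> (\<beta> t) = ad H \<Gamma> (\<pi> t))"


section \<open>Unbounded operators\<close>

text \<open>An unbounded operator is a partial function; \<^const>\<open>dom\<close> is its domain and
  \<^const>\<open>map_le\<close> is inclusion of operators.\<close>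

definition linear_operator :: "('h, 'm) hilb_scheme \<Rightarrow> ('h \<rightharpoonup> 'h) \<Rightarrow> bool" where
  "linear_operator H D \<longleftrightarrow> dom D \<subseteq> carrier H \<and> ran D \<subseteq> carrier H \<and> vzero H \<in> dom D \<and>
    (\<forall>x\<in>dom D. \<forall>y\<in>dom D. D (vadd H x y) = Some (vadd H (the (D x)) (the (D y)))) \<and>
    (\<forall>c. \<forall>x\<in>dom D. D (vscale H c x) = Some (vscale H c (the (D x))))"

definition dense_in :: "('h, 'm) hilb_scheme \<Rightarrow> 'h set \<Rightarrow> bool" where
  "dense_in H S \<longleftrightarrow> (\<forall>x\<in>carrier H. \<forall>e>0. \<exists>y\<in>S. hnorm H (vdiff H x y) < e)"

definition adjoint_op :: "('h, 'm) hilb_scheme \<Rightarrow> ('h \<rightharpoonup> 'h) \<Rightarrow> ('h \<rightharpoonup> 'h)" where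
  "adjoint_op H D = (\<lambda>y.
    if y \<in> carrier H \<and> (\<exists>z\<in>carrier H. \<forall>x\<in>dom D. hinner H z x = hinner H y (the (D x)))
    then Some (THE z. z \<in> carrier H \<and> (\<forall>x\<in>dom D. hinner H z x = hinner H y (the (D x))))
    else None)"

definition selfadjoint :: "('h, 'm) hilb_scheme \<Rightarrow> ('h \<rightharpoonup> 'h) \<Rightarrow> bool" where
  "selfadjoint H D \<longleftrightarrow> linear_operator H D \<and> dense_in H (dom D) \<and> adjoint_op H D = D"

text \<open>For everywhere defined \<^emph>\<open>T\<close>, \<^emph>\<open>b\<close>: the operators \<^emph>\<open>T D\<close> (with the domain of \<^emph>\<open>D\<close>),
  \<^emph>\<open>D T\<close> (with domain the preimage of the domain of \<^emph>\<open>D\<close> under \<^emph>\<open>T\<close>), \<^emph>\<open>- D\<close> and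
  \<^emph>\<open>S - b\<close>.\<close>

definition op_left :: "('h \<Rightarrow> 'h) \<Rightarrow> ('h \<rightharpoonup> 'h) \<Rightarrow> ('h \<rightharpoonup> 'h)" where
  "op_left T D = (\<lambda>x. map_option T (D x))"

definition op_right :: "('h, 'm) hilb_scheme \<Rightarrow> ('h \<rightharpoonup> 'h) \<Rightarrow> ('h \<Rightarrow> 'h) \<Rightarrow> ('h \<rightharpoonup> 'h)" where
  "op_right H D T = (\<lambda>x. if x \<in> carrier H then D (T x) else None)"

definition op_neg :: "('h, 'm) hilb_scheme \<Rightarrow> ('h \<rightharpoonup> 'h) \<Rightarrow> ('h \<rightharpoonup> 'h)" where
  "op_neg H D = (\<lambda>x. map_option (vscale H (- 1)) (D x))"

definition op_minus :: "('h, 'm) hilb_scheme \<Rightarrow> ('h \<rightharpoonup> 'h) \<Rightarrow> ('h \<Rightarrow> 'h) \<Rightarrow> ('h \<rightharpoonup> 'h)" where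
  "op_minus H S b = (\<lambda>x. map_option (\<lambda>y. vdiff H y (b x)) (S x))"

text \<open>\<^emph>\<open>ad V (D) = V D V*\<close>, with domain the image under \<^emph>\<open>V\<close> of the domain of \<^emph>\<open>D\<close>.\<close>

definition ad_unbounded :: "('h, 'm) hilb_scheme \<Rightarrow> ('h \<Rightarrow> 'h) \<Rightarrow> ('h \<rightharpoonup> 'h) \<Rightarrow> ('h \<rightharpoonup> 'h)" where
  "ad_unbounded H V D = (\<lambda>y. if y \<in> V ` carrier H
     then map_option V (D (inv_into (carrier H) V y)) else None)"

definition odd_operator :: "('h, 'm) hilb_scheme \<Rightarrow> ('h \<Rightarrow> 'h) \<Rightarrow> ('h \<rightharpoonup> 'h) \<Rightarrow> bool" where
  "odd_operator H \<Gamma> D \<longleftrightarrow> op_left \<Gamma> D = op_neg H (op_right H D \<Gamma>)"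

definition superderivation_domain ::
  "('h, 'm) hilb_scheme \<Rightarrow> ('h \<Rightarrow> 'h) \<Rightarrow> ('h \<rightharpoonup> 'h) \<Rightarrow> ('h \<Rightarrow> 'h) set" where
  "superderivation_domain H \<Gamma> D = {t \<in> bounded_ops H. \<exists>b\<in>bounded_ops H.
     op_left (ad H \<Gamma> t) D \<subseteq>\<^sub>m op_minus H (op_right H D t) b}"


section \<open>Functional calculus, trace and theta-summability\<close>

definition orthogonal_projection :: "('h, 'm) hilb_scheme \<Rightarrow> ('h \<Rightarrow> 'h) \<Rightarrow> bool" where
  "orthogonal_projection H P \<longleftrightarrow> P \<in> bounded_ops H \<and> compose (carrier H) P P = P \<and>
    (\<forall>x\<in>carrier H. \<forall>y\<in>carrier H. hinner H (P x) y = hinner H x (P y))"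

definition projection_valued_measure ::
  "('h, 'm) hilb_scheme \<Rightarrow> (real set \<Rightarrow> 'h \<Rightarrow> 'h) \<Rightarrow> bool" where
  "projection_valued_measure H E \<longleftrightarrow>
    (\<forall>B\<in>sets borel. orthogonal_projection H (E B)) \<and> E UNIV = op_one H \<and>
    (\<forall>X :: nat \<Rightarrow> real set. range X \<subseteq> sets borel \<longrightarrow> disjoint_family X \<longrightarrow>
      (\<forall>x\<in>carrier H. (\<lambda>i. hinner H x (E (X i) x)) sums hinner H x (E (\<Union>i. X i) x)))"

definition scalar_measure ::
  "('h, 'm) hilb_scheme \<Rightarrow> (real set \<Rightarrow> 'h \<Rightarrow> 'h) \<Rightarrow> 'h \<Rightarrow> real measure" where
  "scalar_measure H E x =
    measure_of UNIV (sets borel) (\<lambda>B. ennreal (Re (hinner H x (E B x))))"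

text \<open>\<^emph>\<open>D\<close> is the integral of the identity function against \<^emph>\<open>E\<close>. The quadratic form on the
  dense domain of \<^emph>\<open>D\<close> determines \<^emph>\<open>D\<close> by polarization.\<close>

definition spectral_measure_of ::
  "('h, 'm) hilb_scheme \<Rightarrow> ('h \<rightharpoonup> 'h) \<Rightarrow> (real set \<Rightarrow> 'h \<Rightarrow> 'h) \<Rightarrow> bool" where
  "spectral_measure_of H D E \<longleftrightarrow> projection_valued_measure H E \<and>
    dom D = {x \<in> carrier H. (\<integral>\<^sup>+ s. ennreal (s\<^sup>2) \<partial>scalar_measure H E x) < \<infinity>} \<and>
    (\<forall>x\<in>dom D. hinner H x (the (D x)) = of_real (\<integral> s. s \<partial>scalar_measure H E x))"

text \<open>The bounded operator \<^emph>\<open>f(D)\<close>, for selfadjoint \<^emph>\<open>D\<close> and bounded Borel \<^emph>\<open>f\<close>; existence and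
  uniqueness are the spectral theorem.\<close>

definition functional_calculus ::
  "('h, 'm) hilb_scheme \<Rightarrow> ('h \<rightharpoonup> 'h) \<Rightarrow> (real \<Rightarrow> real) \<Rightarrow> 'h \<Rightarrow> 'h" where
  "functional_calculus H D f = (THE T. T \<in> bounded_ops H \<and>
    (\<exists>E. spectral_measure_of H D E \<and>
      (\<forall>x\<in>carrier H. hinner H x (T x) = of_real (\<integral> s. f s \<partial>scalar_measure H E x))))"

definition orthonormal_basis :: "('h, 'm) hilb_scheme \<Rightarrow> 'h set \<Rightarrow> bool" where
  "orthonormal_basis H B \<longleftrightarrow> B \<subseteq> carrier H \<and>
    (\<forall>e\<in>B. \<forall>f\<in>B. hinner H e f = (if e = f then 1 else 0)) \<and>
    (\<forall>x\<in>carrier H. (\<forall>e\<in>B. hinner H e x = 0) \<longrightarrow> x = vzero H)"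

text \<open>The trace of a positive bounded operator, which is independent of the basis.\<close>

definition trace_pos :: "('h, 'm) hilb_scheme \<Rightarrow> ('h \<Rightarrow> 'h) \<Rightarrow> ennreal" where
  "trace_pos H T = (\<Sum>\<^sub>\<infinity>e\<in>(SOME B. orthonormal_basis H B). ennreal (Re (hinner H e (T e))))"

definition theta_summable :: "('h, 'm) hilb_scheme \<Rightarrow> ('h \<rightharpoonup> 'h) \<Rightarrow> bool" where
  "theta_summable H D \<longleftrightarrow>
    (\<forall>\<beta>>0. trace_pos H (functional_calculus H D (\<lambda>s. exp (- \<beta> * s\<^sup>2))) < \<infinity>)"


section \<open>Paths in a poset and the fundamental group\<close>

text \<open>The poset is the type \<^emph>\<open>'k\<close> with its order. \<^emph>\<open>Simplex x o o'\<close> is the triple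
  \<^emph>\<open>(x; o, o')\<close>, a segment from \<^emph>\<open>o'\<close> to \<^emph>\<open>o\<close>.\<close>

datatype 'k po_simplex = Simplex (support: 'k) (face0: 'k) (face1: 'k)

definition is_po_simplex :: "('k::order) po_simplex \<Rightarrow> bool" where
  "is_po_simplex b \<longleftrightarrow> face0 b \<le> support b \<and> face1 b \<le> support b"

text \<open>A path \<^emph>\<open>b_n * \<dots> * b_1\<close> is the list \<^emph>\<open>[b_n, \<dots>, b_1]\<close>, so that the
  composition \<^emph>\<open>p * q\<close> (first \<^emph>\<open>q\<close>, then \<^emph>\<open>p\<close>) is \<^emph>\<open>p @ q\<close>.\<close>

type_synonym 'k po_path = "'k po_simplex list"

definition path_source :: "'k po_path \<Rightarrow> 'k" where
  "path_source p = face1 (last p)"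

definition path_target :: "'k po_path \<Rightarrow> 'k" where
  "path_target p = face0 (hd p)"

definition is_path :: "('k::order) po_path \<Rightarrow> bool" where
  "is_path p \<longleftrightarrow> p \<noteq> [] \<and> (\<forall>b\<in>set p. is_po_simplex b) \<and>
    (\<forall>i. Suc i < length p \<longrightarrow> face1 (p ! i) = face0 (p ! Suc i))"

definition paths :: "'k::order \<Rightarrow> 'k \<Rightarrow> 'k po_path set" where
  "paths a c = {p. is_path p \<and> path_source p = a \<and> path_target p = c}"

definition pathwise_connected :: "('k::order) itself \<Rightarrow> bool" where
  "pathwise_connected K \<longleftrightarrow> (\<forall>(a::'k) c. paths a c \<noteq> {})"

inductive homotopic :: "('k::order) po_path \<Rightarrow> 'k po_path \<Rightarrow> bool" where
  refl: "is_path p \<Longrightarrow> homotopic p p"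
| sym: "homotopic p q \<Longrightarrow> homotopic q p"
| trans: "homotopic p q \<Longrightarrow> homotopic q r \<Longrightarrow> homotopic p r"
| elementary: "\<lbrakk>is_po_simplex b; is_po_simplex b\<^sub>1; is_po_simplex b\<^sub>2;
    face1 b\<^sub>1 = face1 b; face0 b\<^sub>1 = face1 b\<^sub>2; face0 b\<^sub>2 = face0 b;
    support b \<le> c; support b\<^sub>1 \<le> c; support b\<^sub>2 \<le> c\<rbrakk> \<Longrightarrow> homotopic [b\<^sub>2, b\<^sub>1] [b]"
| composition: "\<lbrakk>homotopic p p'; homotopic q q'; path_source p = path_target q\<rbrakk>
    \<Longrightarrow> homotopic (p @ q) (p' @ q')"

definition homotopy_class :: "('k::order) po_path \<Rightarrow> 'k po_path set" where
  "homotopy_class p = {q. homotopic p q}"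

definition fundamental_group :: "'k::order \<Rightarrow> 'k po_path set monoid" where
  "fundamental_group a = \<lparr>carrier = homotopy_class ` paths a a,
    mult = (\<lambda>g h. \<Union>p\<in>g. \<Union>q\<in>h. homotopy_class (p @ q)),
    one = homotopy_class [Simplex a a a]\<rparr>"

definition arrow_path :: "'k \<Rightarrow> 'k \<Rightarrow> 'k po_path" where
  "arrow_path o' o1 = [Simplex o' o' o1]"


section \<open>Nets of star-algebras and the algebra of the enveloping net bundle\<close>

text \<open>In \<^emph>\<open>incl N o' o\<close> and in the unitaries of a Hilbert net bundle the larger index comes
  first; only the values at \<^emph>\<open>o \<le> o'\<close> matter.\<close>

record ('k, 'a) alg_net =
  alg :: "'k \<Rightarrow> 'a star_alg"
  incl :: "'k \<Rightarrow> 'k \<Rightarrow> 'a \<Rightarrow> 'a"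
  agrad :: "'k \<Rightarrow> 'a \<Rightarrow> 'a"

definition star_algebra_net :: "('k::order, 'a) alg_net \<Rightarrow> bool" where
  "star_algebra_net N \<longleftrightarrow>
    (\<forall>x. star_algebra (alg N x)) \<and>
    (\<forall>x y. x \<le> y \<longrightarrow> incl N y x \<in> star_hom (alg N x) (alg N y) \<and>
      inj_on (incl N y x) (carrier (alg N x))) \<and>
    (\<forall>x y z. x \<le> y \<longrightarrow> y \<le> z \<longrightarrow>
      (\<forall>t\<in>carrier (alg N x). incl N z x t = incl N z y (incl N y x t)))"

definition net_grading :: "('k::order, 'a) alg_net \<Rightarrow> bool" where
  "net_grading N \<longleftrightarrow>
    (\<forall>x. agrad N x \<in> star_hom (alg N x) (alg N x) \<and>
      bij_betw (agrad N x) (carrier (alg N x)) (carrier (alg N x)) \<and>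
      (\<forall>t\<in>carrier (alg N x). agrad N x (agrad N x t) = t)) \<and>
    (\<forall>x y. x \<le> y \<longrightarrow>
      (\<forall>t\<in>carrier (alg N x). agrad N y (incl N y x t) = incl N y x (agrad N x t)))"

text \<open>The star-algebra presented by the generators \<^emph>\<open>(p, t)\<close>: formal star-algebra expressions
  modulo the congruence generated by the star-algebra axioms and the defining relations.\<close>

datatype ('k, 'a) env_term =
    Gen "'k po_path" 'a
  | Zero
  | Add "('k, 'a) env_term" "('k, 'a) env_term"
  | Scale complex "('k, 'a) env_term"
  | Mult "('k, 'a) env_term" "('k, 'a) env_term"
  | Star "('k, 'a) env_term"

primrec env_wf :: "('k::order, 'a) alg_net \<Rightarrow> 'k \<Rightarrow> ('k, 'a) env_term \<Rightarrow> bool" where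
  "env_wf N a (Gen p t) \<longleftrightarrow> p \<in> paths (path_source p) a \<and> t \<in> carrier (alg N (path_source p))"
| "env_wf N a Zero \<longleftrightarrow> True"
| "env_wf N a (Add x y) \<longleftrightarrow> env_wf N a x \<and> env_wf N a y"
| "env_wf N a (Scale c x) \<longleftrightarrow> env_wf N a x"
| "env_wf N a (Mult x y) \<longleftrightarrow> env_wf N a x \<and> env_wf N a y"
| "env_wf N a (Star x) \<longleftrightarrow> env_wf N a x"

inductive env_eq :: "('k::order, 'a) alg_net \<Rightarrow> 'k \<Rightarrow> ('k, 'a) env_term \<Rightarrow> ('k, 'a) env_term \<Rightarrow> bool"
  for N :: "('k::order, 'a) alg_net" and a :: 'k where
  refl: "env_wf N a x \<Longrightarrow> env_eq N a x x"
| sym: "env_eq N a x y \<Longrightarrow> env_eq N a y x"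
| trans: "env_eq N a x y \<Longrightarrow> env_eq N a y z \<Longrightarrow> env_eq N a x z"
| cong_Add: "env_eq N a x x' \<Longrightarrow> env_eq N a y y' \<Longrightarrow> env_eq N a (Add x y) (Add x' y')"
| cong_Scale: "env_eq N a x x' \<Longrightarrow> env_eq N a (Scale c x) (Scale c x')"
| cong_Mult: "env_eq N a x x' \<Longrightarrow> env_eq N a y y' \<Longrightarrow> env_eq N a (Mult x y) (Mult x' y')"
| cong_Star: "env_eq N a x x' \<Longrightarrow> env_eq N a (Star x) (Star x')"
| add_assoc: "\<lbrakk>env_wf N a x; env_wf N a y; env_wf N a z\<rbrakk>
    \<Longrightarrow> env_eq N a (Add (Add x y) z) (Add x (Add y z))"
| add_commute: "\<lbrakk>env_wf N a x; env_wf N a y\<rbrakk> \<Longrightarrow> env_eq N a (Add x y) (Add y x)"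
| add_zero: "env_wf N a x \<Longrightarrow> env_eq N a (Add x Zero) x"
| add_neg: "env_wf N a x \<Longrightarrow> env_eq N a (Add x (Scale (- 1) x)) Zero"
| scale_add_right: "\<lbrakk>env_wf N a x; env_wf N a y\<rbrakk>
    \<Longrightarrow> env_eq N a (Scale c (Add x y)) (Add (Scale c x) (Scale c y))"
| scale_add_left: "env_wf N a x \<Longrightarrow> env_eq N a (Scale (c + d) x) (Add (Scale c x) (Scale d x))"
| scale_scale: "env_wf N a x \<Longrightarrow> env_eq N a (Scale c (Scale d x)) (Scale (c * d) x)"
| scale_one: "env_wf N a x \<Longrightarrow> env_eq N a (Scale 1 x) x"
| mult_assoc: "\<lbrakk>env_wf N a x; env_wf N a y; env_wf N a z\<rbrakk>
    \<Longrightarrow> env_eq N a (Mult (Mult x y) z) (Mult x (Mult y z))"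
| mult_add_left: "\<lbrakk>env_wf N a x; env_wf N a y; env_wf N a z\<rbrakk>
    \<Longrightarrow> env_eq N a (Mult (Add x y) z) (Add (Mult x z) (Mult y z))"
| mult_add_right: "\<lbrakk>env_wf N a x; env_wf N a y; env_wf N a z\<rbrakk>
    \<Longrightarrow> env_eq N a (Mult x (Add y z)) (Add (Mult x y) (Mult x z))"
| mult_scale_left: "\<lbrakk>env_wf N a x; env_wf N a y\<rbrakk>
    \<Longrightarrow> env_eq N a (Mult (Scale c x) y) (Scale c (Mult x y))"
| mult_scale_right: "\<lbrakk>env_wf N a x; env_wf N a y\<rbrakk>
    \<Longrightarrow> env_eq N a (Mult x (Scale c y)) (Scale c (Mult x y))"
| star_star: "env_wf N a x \<Longrightarrow> env_eq N a (Star (Star x)) x"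
| star_add: "\<lbrakk>env_wf N a x; env_wf N a y\<rbrakk> \<Longrightarrow> env_eq N a (Star (Add x y)) (Add (Star x) (Star y))"
| star_scale: "env_wf N a x \<Longrightarrow> env_eq N a (Star (Scale c x)) (Scale (cnj c) (Star x))"
| star_mult: "\<lbrakk>env_wf N a x; env_wf N a y\<rbrakk>
    \<Longrightarrow> env_eq N a (Star (Mult x y)) (Mult (Star y) (Star x))"
| gen_linear: "\<lbrakk>p \<in> paths w a; t \<in> carrier (alg N w); t' \<in> carrier (alg N w)\<rbrakk>
    \<Longrightarrow> env_eq N a (Add (Gen p t) (Scale c (Gen p t')))
      (Gen p (vadd (alg N w) t (vscale (alg N w) c t')))"
| gen_mult: "\<lbrakk>p \<in> paths w a; t \<in> carrier (alg N w); t' \<in> carrier (alg N w)\<rbrakk>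
    \<Longrightarrow> env_eq N a (Mult (Gen p t) (Gen p t')) (Gen p (amult (alg N w) t t'))"
| gen_star: "\<lbrakk>p \<in> paths w a; t \<in> carrier (alg N w)\<rbrakk>
    \<Longrightarrow> env_eq N a (Star (Gen p t)) (Gen p (astar (alg N w) t))"
| gen_incl: "\<lbrakk>w \<le> w'; p \<in> paths w' a; t \<in> carrier (alg N w)\<rbrakk>
    \<Longrightarrow> env_eq N a (Gen (p @ arrow_path w' w) t) (Gen p (incl N w' w t))"
| gen_homotopic: "\<lbrakk>p \<in> paths w a; p' \<in> paths w a; homotopic p p'; t \<in> carrier (alg N w)\<rbrakk>
    \<Longrightarrow> env_eq N a (Gen p t) (Gen p' t)"

definition env_class :: "('k::order, 'a) alg_net \<Rightarrow> 'k \<Rightarrow> ('k, 'a) env_term \<Rightarrow> ('k, 'a) env_term set"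
  where "env_class N a x = {y. env_eq N a x y}"

definition env_algebra :: "('k::order, 'a) alg_net \<Rightarrow> 'k \<Rightarrow> ('k, 'a) env_term set star_alg" where
  "env_algebra N a = \<lparr>carrier = env_class N a ` {x. env_wf N a x},
    vzero = env_class N a Zero,
    vadd = (\<lambda>X Y. \<Union>x\<in>X. \<Union>y\<in>Y. env_class N a (Add x y)),
    vscale = (\<lambda>c X. \<Union>x\<in>X. env_class N a (Scale c x)),
    amult = (\<lambda>X Y. \<Union>x\<in>X. \<Union>y\<in>Y. env_class N a (Mult x y)),
    astar = (\<lambda>X. \<Union>x\<in>X. env_class N a (Star x))\<rparr>"

primrec on_generators ::
  "('k po_path \<Rightarrow> 'a \<Rightarrow> ('k, 'a) env_term) \<Rightarrow> ('k, 'a) env_term \<Rightarrow> ('k, 'a) env_term" where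
  "on_generators f (Gen p t) = f p t"
| "on_generators f Zero = Zero"
| "on_generators f (Add x y) = Add (on_generators f x) (on_generators f y)"
| "on_generators f (Scale c x) = Scale c (on_generators f x)"
| "on_generators f (Mult x y) = Mult (on_generators f x) (on_generators f y)"
| "on_generators f (Star x) = Star (on_generators f x)"

definition env_action ::
  "('k::order, 'a) alg_net \<Rightarrow> 'k \<Rightarrow> 'k po_path set \<Rightarrow> ('k, 'a) env_term set \<Rightarrow> ('k, 'a) env_term set"
  where "env_action N a g X =
    (\<Union>q\<in>g. \<Union>x\<in>X. env_class N a (on_generators (\<lambda>p t. Gen (q @ p) t) x))"

definition env_grading ::
  "('k::order, 'a) alg_net \<Rightarrow> 'k \<Rightarrow> ('k, 'a) env_term set \<Rightarrow> ('k, 'a) env_term set"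
  where "env_grading N a X =
    (\<Union>x\<in>X. env_class N a (on_generators (\<lambda>p t. Gen p (agrad N (path_source p) t)) x))"


section \<open>Nets of spectral triples\<close>

record ('k, 'a, 'h) net_triple =
  nspace :: "'k \<Rightarrow> 'h hilb"
  nU :: "'k \<Rightarrow> 'k \<Rightarrow> 'h \<Rightarrow> 'h"
  n\<Gamma> :: "'k \<Rightarrow> 'h \<Rightarrow> 'h"
  nD :: "'k \<Rightarrow> 'h \<rightharpoonup> 'h"
  n\<pi> :: "'k \<Rightarrow> 'a \<Rightarrow> 'h \<Rightarrow> 'h"

definition hilbert_net_bundle ::
  "('k::order \<Rightarrow> 'h hilb) \<Rightarrow> ('k \<Rightarrow> 'k \<Rightarrow> 'h \<Rightarrow> 'h) \<Rightarrow> bool" where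
  "hilbert_net_bundle H U \<longleftrightarrow>
    (\<forall>x. hilbert_space (H x)) \<and>
    (\<forall>x y. x \<le> y \<longrightarrow> U y x \<in> unitaries (H x) (H y)) \<and>
    (\<forall>x y z. x \<le> y \<longrightarrow> y \<le> z \<longrightarrow> U z x = compose (carrier (H x)) (U z y) (U y x))"

definition bundle_grading ::
  "('k::order \<Rightarrow> 'h hilb) \<Rightarrow> ('k \<Rightarrow> 'k \<Rightarrow> 'h \<Rightarrow> 'h) \<Rightarrow> ('k \<Rightarrow> 'h \<Rightarrow> 'h) \<Rightarrow> bool" where
  "bundle_grading H U \<Gamma> \<longleftrightarrow>
    (\<forall>x. grading_unitary (H x) (\<Gamma> x)) \<and>
    (\<forall>x y. x \<le> y \<longrightarrow>
      compose (carrier (H x)) (\<Gamma> y) (U y x) = compose (carrier (H x)) (U y x) (\<Gamma> x))"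

definition net_representation ::
  "('k::order, 'a) alg_net \<Rightarrow> ('k \<Rightarrow> 'h hilb) \<Rightarrow> ('k \<Rightarrow> 'k \<Rightarrow> 'h \<Rightarrow> 'h) \<Rightarrow> ('k \<Rightarrow> 'h \<Rightarrow> 'h)
    \<Rightarrow> ('k \<Rightarrow> 'a \<Rightarrow> 'h \<Rightarrow> 'h) \<Rightarrow> bool" where
  "net_representation N H U \<Gamma> \<pi> \<longleftrightarrow>
    (\<forall>x. graded_representation (alg N x) (agrad N x) (H x) (\<Gamma> x) (\<pi> x)) \<and>
    (\<forall>x y. x \<le> y \<longrightarrow>
      (\<forall>t\<in>carrier (alg N x). ad (H x) (U y x) (\<pi> x t) = \<pi> y (incl N y x t)))"

definition net_of_spectral_triples ::
  "('k::order, 'a) alg_net \<Rightarrow> ('k, 'a, 'h) net_triple \<Rightarrow> bool" where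
  "net_of_spectral_triples N X \<longleftrightarrow>
    hilbert_net_bundle (nspace X) (nU X) \<and>
    bundle_grading (nspace X) (nU X) (n\<Gamma> X) \<and>
    net_representation N (nspace X) (nU X) (n\<Gamma> X) (n\<pi> X) \<and>
    (\<forall>x. selfadjoint (nspace X x) (nD X x) \<and>
      odd_operator (nspace X x) (n\<Gamma> X x) (nD X x) \<and>
      theta_summable (nspace X x) (nD X x) \<and>
      n\<pi> X x ` carrier (alg N x)
        \<subseteq> superderivation_domain (nspace X x) (n\<Gamma> X x) (nD X x)) \<and>
    (\<forall>x y. x \<le> y \<longrightarrow> ad_unbounded (nspace X x) (nU X y x) (nD X x) = nD X y)"

definition net_triple_arrows ::
  "('k::order, 'a) alg_net \<Rightarrow> ('k, 'a, 'h) net_triple \<Rightarrow> ('k, 'a, 'h) net_triple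
    \<Rightarrow> ('k \<Rightarrow> 'h \<Rightarrow> 'h) set" where
  "net_triple_arrows N X Y = {V.
    (\<forall>x. V x \<in> unitaries (nspace X x) (nspace Y x)) \<and>
    (\<forall>x y. x \<le> y \<longrightarrow> compose (carrier (nspace X x)) (V y) (nU X y x)
      = compose (carrier (nspace X x)) (nU Y y x) (V x)) \<and>
    (\<forall>x. compose (carrier (nspace X x)) (V x) (n\<Gamma> X x)
        = compose (carrier (nspace X x)) (n\<Gamma> Y x) (V x) \<and>
      (\<forall>t\<in>carrier (alg N x). ad (nspace X x) (V x) (n\<pi> X x t) = n\<pi> Y x t) \<and>
      ad_unbounded (nspace X x) (V x) (nD X x) = nD Y x)}"

text \<open>The Hilbert spaces in this category and the next one have their underlying sets in the
  type \<^emph>\<open>'h\<close>, which plays the role of a universe.\<close>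

definition ncg_nets ::
  "('k::order, 'a) alg_net \<Rightarrow> (('k, 'a, 'h) net_triple, 'k \<Rightarrow> 'h \<Rightarrow> 'h) cat_data" where
  "ncg_nets N = \<lparr>Obj = {X. net_of_spectral_triples N X},
    Hom = net_triple_arrows N,
    Idt = (\<lambda>X x. op_one (nspace X x)),
    Comp = (\<lambda>X Y Z W V x. compose (carrier (nspace X x)) (W x) (V x))\<rparr>"


section \<open>Equivariant spectral triples\<close>

record ('g, 'a, 'h) eq_triple =
  espace :: "'h hilb"
  e\<Gamma> :: "'h \<Rightarrow> 'h"
  eD :: "'h \<rightharpoonup> 'h"
  e\<pi> :: "'a \<Rightarrow> 'h \<Rightarrow> 'h"
  eu :: "'g \<Rightarrow> 'h \<Rightarrow> 'h"

definition equivariant_spectral_triple ::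
  "'g monoid \<Rightarrow> 'a star_alg \<Rightarrow> ('a \<Rightarrow> 'a) \<Rightarrow> ('g \<Rightarrow> 'a \<Rightarrow> 'a) \<Rightarrow> ('g, 'a, 'h) eq_triple \<Rightarrow> bool"
  where
  "equivariant_spectral_triple G A \<beta> act X \<longleftrightarrow>
    hilbert_space (espace X) \<and>
    grading_unitary (espace X) (e\<Gamma> X) \<and>
    eu X \<in> hom G (unitary_group (espace X)) \<and>
    (\<forall>g\<in>carrier G. compose (carrier (espace X)) (eu X g) (e\<Gamma> X)
      = compose (carrier (espace X)) (e\<Gamma> X) (eu X g)) \<and>
    graded_representation A \<beta> (espace X) (e\<Gamma> X) (e\<pi> X) \<and>
    (\<forall>g\<in>carrier G. \<forall>t\<in>carrier A. e\<pi> X (act g t) = ad (espace X) (eu X g) (e\<pi> X t)) \<and>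
    selfadjoint (espace X) (eD X) \<and>
    odd_operator (espace X) (e\<Gamma> X) (eD X) \<and>
    (\<forall>g\<in>carrier G. op_left (eu X g) (eD X) = op_right (espace X) (eD X) (eu X g)) \<and>
    theta_summable (espace X) (eD X) \<and>
    e\<pi> X ` carrier A \<subseteq> superderivation_domain (espace X) (e\<Gamma> X) (eD X)"

definition equivariant_arrows ::
  "'g monoid \<Rightarrow> 'a star_alg \<Rightarrow> ('g, 'a, 'h) eq_triple \<Rightarrow> ('g, 'a, 'h) eq_triple \<Rightarrow> ('h \<Rightarrow> 'h) set"
  where
  "equivariant_arrows G A X Y = {V \<in> unitaries (espace X) (espace Y).
    (\<forall>g\<in>carrier G. compose (carrier (espace X)) V (eu X g)
      = compose (carrier (espace X)) (eu Y g) V) \<and>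
    compose (carrier (espace X)) V (e\<Gamma> X) = compose (carrier (espace X)) (e\<Gamma> Y) V \<and>
    (\<forall>t\<in>carrier A. ad (espace X) V (e\<pi> X t) = e\<pi> Y t) \<and>
    ad_unbounded (espace X) V (eD X) = eD Y}"

definition ncg_equivariant ::
  "'g monoid \<Rightarrow> 'a star_alg \<Rightarrow> ('a \<Rightarrow> 'a) \<Rightarrow> ('g \<Rightarrow> 'a \<Rightarrow> 'a)
    \<Rightarrow> (('g, 'a, 'h) eq_triple, 'h \<Rightarrow> 'h) cat_data" where
  "ncg_equivariant G A \<beta> act = \<lparr>Obj = {X. equivariant_spectral_triple G A \<beta> act X},
    Hom = equivariant_arrows G A,
    Idt = (\<lambda>X. op_one (espace X)),
    Comp = (\<lambda>X Y Z W V. compose (carrier (espace X)) W V)\<rparr>"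

end

theory Submission
  imports Defs
begin

text \<open>Parallel transport along paths is invariant under homotopy, so a net of spectral triples
  restricts to a spectral triple on the fibre over \<^emph>\<open>a\<close> with \<^emph>\<open>\<Pi>\<close> acting by holonomy, and
  \<^emph>\<open>(p, t)\<close> acts as \<^emph>\<open>\<pi>(t)\<close> transported along \<^emph>\<open>p\<close>. Conversely, choose a path
  from every \<^emph>\<open>o\<close> to \<^emph>\<open>a\<close>: an equivariant triple gives the net whose fibres are all
  equal to \<^emph>\<open>H\<close>, where \<^emph>\<open>U\<close> is the action of the loop closing up an arrow along the
  chosen paths. Transport along the chosen paths is the unit of the equivalence, and with the
  constant path chosen at \<^emph>\<open>a\<close> the identity of \<^emph>\<open>H\<close> is the counit. The spectrum of
  \<^emph>\<open>D\<close> never enters: both functors only reuse a given operator on its own space, so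
  selfadjointness and \<^emph>\<open>\<theta>\<close>-summability need not be transported along unitaries.\<close>

section \<open>Vectors, unitaries and bounded operators\<close>

text \<open>The algebra A is known only through its presentation, so a representation of it has to
  be built by recursion on formal terms and checked against each relation. Two relations carry the
  geometry. The one that absorbs an arrow of the poset into an inclusion holds because U intertwines
  the representations of the net. The one that identifies homotopic paths holds because transport
  along a simplex, seen from any point above its support, depends only on the end points. The
  condition \<pi>(A) \<subseteq> Dom(\<delta>) must likewise spread from generators to all of A;
  hence Dom(\<delta>) is shown to be closed under sums, multiples and products, while the star of a
  generator is again a generator. In the other direction one homotopy does the work: for p from o to
  a, the chosen path at o followed by the loop made from p is homotopic to p. So every generator is
  the translate, by a loop, of a generator on a chosen path, and \<pi> on A can be recovered from
  the net.\<close>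

context complex_vector_space
begin

lemma add_left_commute:
  "\<lbrakk>x \<in> carrier V; y \<in> carrier V; z \<in> carrier V\<rbrakk> \<Longrightarrow> vadd V x (vadd V y z) = vadd V y (vadd V x z)"
  by (metis add_assoc add_commute)

lemma zero_add: "x \<in> carrier V \<Longrightarrow> vadd V (vzero V) x = x"
  using add_commute add_zero zero_closed by simp

lemma add_left_cancel:
  assumes "x \<in> carrier V" "y \<in> carrier V" "z \<in> carrier V" "vadd V x y = vadd V x z"
  shows "y = z"
proof -
  have "y = vadd V (vscale V (- 1) x) (vadd V x y)" if "y \<in> carrier V" for y
    using that assms(1) by (metis add_assoc add_commute add_neg add_zero scale_closed)
  then show ?thesis using assms by metis
qed

lemma scale_zero_right: "vscale V c (vzero V) = vzero V"
  by (metis add_left_cancel add_zero scale_add_right scale_closed zero_closed)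

lemma vdiff_closed: "\<lbrakk>x \<in> carrier V; y \<in> carrier V\<rbrakk> \<Longrightarrow> vdiff V x y \<in> carrier V"
  by (simp add: vdiff_def add_closed scale_closed)

lemma vdiff_eq_iff:
  assumes "x \<in> carrier V" "y \<in> carrier V" "z \<in> carrier V"
  shows "vdiff V x y = z \<longleftrightarrow> x = vadd V z y"
proof -
  have "vadd V (vdiff V x y) y = x"
    unfolding vdiff_def using assms
    by (metis add_assoc add_commute add_neg add_zero scale_closed)
  moreover have "vdiff V (vadd V z y) y = z"
    unfolding vdiff_def using assms
    by (metis add_assoc add_neg add_zero scale_closed)
  ultimately show ?thesis by auto
qed

end

section \<open>Sesquilinearity and the norm of a Hilbert space\<close>

context hilbert_space
begin

lemma inner_add_left:
  "\<lbrakk>x \<in> carrier H; y \<in> carrier H; z \<in> carrier H\<rbrakk>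
    \<Longrightarrow> hinner H (vadd H x y) z = hinner H x z + hinner H y z"
  by (metis add_closed complex_cnj_add inner_add inner_cnj)

lemma inner_scale_left:
  "\<lbrakk>x \<in> carrier H; y \<in> carrier H\<rbrakk> \<Longrightarrow> hinner H (vscale H c x) y = cnj c * hinner H x y"
  by (metis complex_cnj_mult inner_cnj inner_scale scale_closed)

lemma inner_zero_right: "x \<in> carrier H \<Longrightarrow> hinner H x (vzero H) = 0"
  using inner_add[of x "vzero H" "vzero H"] by (simp add: add_zero zero_closed)

lemma inner_zero_left: "x \<in> carrier H \<Longrightarrow> hinner H (vzero H) x = 0"
  by (metis complex_cnj_zero inner_cnj inner_zero_right zero_closed)

lemma hnorm_nonneg: "x \<in> carrier H \<Longrightarrow> 0 \<le> hnorm H x"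
  by (simp add: hnorm_def inner_nonneg)

lemma hnorm_scale:
  assumes "x \<in> carrier H"
  shows "hnorm H (vscale H c x) = cmod c * hnorm H x"
proof -
  have "hinner H (vscale H c x) (vscale H c x) = of_real ((cmod c)\<^sup>2) * hinner H x x"
    using assms complex_norm_square[of c] by (simp add: inner_scale inner_scale_left scale_closed)
  then have "Re (hinner H (vscale H c x) (vscale H c x)) = (cmod c)\<^sup>2 * Re (hinner H x x)"
    by simp
  then show ?thesis by (simp add: hnorm_def real_sqrt_mult)
qed

text \<open>The constant 2 spares the Cauchy--Schwarz inequality: the parallelogram law suffices.\<close>

lemma hnorm_add_le:
  assumes x: "x \<in> carrier H" and y: "y \<in> carrier H"
  shows "hnorm H (vadd H x y) \<le> 2 * (hnorm H x + hnorm H y)"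
proof -
  let ?m = "vadd H x (vscale H (- 1) y)"
  have sq: "(hnorm H z)\<^sup>2 = Re (hinner H z z)" if "z \<in> carrier H" for z
    using that by (simp add: hnorm_def inner_nonneg)
  have "Re (hinner H (vadd H x y) (vadd H x y)) + Re (hinner H ?m ?m)
      = 2 * Re (hinner H x x) + 2 * Re (hinner H y y)"
    using x y by (simp add: inner_add inner_add_left inner_scale inner_scale_left
        add_closed scale_closed)
  moreover have "0 \<le> Re (hinner H ?m ?m)"
    using x y by (simp add: inner_nonneg add_closed scale_closed)
  ultimately have "(hnorm H (vadd H x y))\<^sup>2 \<le> 2 * (hnorm H x)\<^sup>2 + 2 * (hnorm H y)\<^sup>2"
    using x y by (simp add: sq add_closed)
  also have "\<dots> \<le> (2 * (hnorm H x + hnorm H y))\<^sup>2"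
    using hnorm_nonneg[OF x] hnorm_nonneg[OF y] by (simp add: power2_eq_square algebra_simps)
  finally show ?thesis
    by (rule power2_le_imp_le) (simp add: hnorm_nonneg x y)
qed

end

section \<open>Unitaries, their composites and inverses\<close>

lemma unitariesD:
  assumes "V \<in> unitaries H H'"
  shows "x \<in> carrier H \<Longrightarrow> V x \<in> carrier H'"
    and "\<lbrakk>x \<in> carrier H; y \<in> carrier H\<rbrakk> \<Longrightarrow> V (vadd H x y) = vadd H' (V x) (V y)"
    and "x \<in> carrier H \<Longrightarrow> V (vscale H c x) = vscale H' c (V x)"
    and "\<lbrakk>x \<in> carrier H; y \<in> carrier H\<rbrakk> \<Longrightarrow> hinner H' (V x) (V y) = hinner H x y"
    and "V ` carrier H = carrier H'"
    and "V \<in> extensional (carrier H)"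
  using assms by (auto simp: unitaries_def PiE_def)

text \<open>If V x = V y, the isometry V sends x - y to zero, so x - y has norm zero and vanishes by
  definiteness.\<close>

lemma unitaries_inj_on:
  assumes "hilbert_space H" "hilbert_space H'" and V: "V \<in> unitaries H H'"
  shows "inj_on V (carrier H)"
proof (rule inj_onI)
  interpret H: hilbert_space H by fact
  interpret H': hilbert_space H' by fact
  fix x y assume xy: "x \<in> carrier H" "y \<in> carrier H" "V x = V y"
  have *: "vdiff H x y \<in> carrier H" using xy H.vdiff_closed by simp
  have "V (vdiff H x y) = vzero H'"
    using xy unitariesD[OF V] by (simp add: vdiff_def H.scale_closed H'.add_neg)
  then have "hinner H (vdiff H x y) (vdiff H x y) = 0"
    using unitariesD(4)[OF V * *] H'.inner_zero_left[OF H'.zero_closed] by simp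
  then have "vdiff H x y = vzero H" using H.inner_definite * by simp
  then show "x = y" using H.vdiff_eq_iff[OF xy(1,2) H.zero_closed] H.zero_add xy by simp
qed

lemma op_one_unitary: "op_one H \<in> unitaries H H" if "hilbert_space H"
proof -
  interpret hilbert_space H by fact
  show ?thesis by (auto simp: unitaries_def op_one_def add_closed scale_closed)
qed

lemma unitaries_compose:
  assumes V: "V \<in> unitaries H H'" and W: "W \<in> unitaries H' H''" and "hilbert_space H"
  shows "compose (carrier H) W V \<in> unitaries H H''"
proof -
  interpret hilbert_space H by fact
  have "compose (carrier H) W V ` carrier H = W ` V ` carrier H"
    by (auto simp: compose_def)
  then show ?thesis using unitariesD[OF V] unitariesD[OF W]
    by (auto simp: unitaries_def compose_def add_closed scale_closed)
qed

lemma compose_eq_iff: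
  "compose S g f = compose S g' f' \<longleftrightarrow> (\<forall>x\<in>S. g (f x) = g' (f' x))"
  by (auto simp: compose_def fun_eq_iff)

text \<open>Restricting to the image of V avoids a parameter for the target space. For unitary V the
  image is the whole target, so the inverse is extensional there, as membership in
  \<open>unitaries\<close> demands.\<close>

definition unitary_inverse :: "('h, 'm) hilb_scheme \<Rightarrow> ('h \<Rightarrow> 'h) \<Rightarrow> ('h \<Rightarrow> 'h)" where
  "unitary_inverse H V = (\<lambda>y\<in>V ` carrier H. inv_into (carrier H) V y)"

lemma unitary_inverse_right:
  "V \<in> unitaries H H' \<Longrightarrow> y \<in> carrier H' \<Longrightarrow> V (unitary_inverse H V y) = y"
  using unitariesD(5)[of V H H'] by (simp add: unitary_inverse_def f_inv_into_f)

lemma unitary_inverse_left: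
  assumes "hilbert_space H" "hilbert_space H'" "V \<in> unitaries H H'" "x \<in> carrier H"
  shows "unitary_inverse H V (V x) = x"
  using assms unitaries_inj_on[of H H' V] by (simp add: unitary_inverse_def)

lemma unitary_inverse_unitary:
  assumes "hilbert_space H" "hilbert_space H'" and V: "V \<in> unitaries H H'"
  shows "unitary_inverse H V \<in> unitaries H' H"
proof -
  interpret H: hilbert_space H by fact
  interpret H': hilbert_space H' by fact
  let ?W = "unitary_inverse H V"
  note VD = unitariesD[OF V]
  have WV: "?W (V x) = x" if "x \<in> carrier H" for x
    using assms that by (rule unitary_inverse_left)
  have surj: "\<exists>x\<in>carrier H. y = V x" if "y \<in> carrier H'" for y using VD(5) that by auto
  have add: "?W (vadd H' x y) = vadd H (?W x) (?W y)"
    if xy: "x \<in> carrier H'" "y \<in> carrier H'" for x y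
  proof -
    obtain x' y' where "x' \<in> carrier H" "y' \<in> carrier H" "x = V x'" "y = V y'"
      using surj xy by metis
    then show ?thesis by (simp add: WV VD(2)[symmetric] H.add_closed)
  qed
  have scale: "?W (vscale H' c x) = vscale H c (?W x)" if x: "x \<in> carrier H'" for c x
  proof -
    obtain x' where "x' \<in> carrier H" "x = V x'" using surj x by metis
    then show ?thesis by (simp add: WV VD(3)[symmetric] H.scale_closed)
  qed
  have inner: "hinner H (?W x) (?W y) = hinner H' x y"
    if xy: "x \<in> carrier H'" "y \<in> carrier H'" for x y
  proof -
    obtain x' y' where "x' \<in> carrier H" "y' \<in> carrier H" "x = V x'" "y = V y'"
      using surj xy by metis
    then show ?thesis by (simp add: WV VD(4))
  qed
  have mem: "?W x \<in> carrier H" if "x \<in> carrier H'" for x using surj[OF that] WV by auto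
  have "?W ` carrier H' = carrier H" using mem WV VD(1) by force
  moreover have "?W \<in> extensional (carrier H')"
    using VD(5) by (simp add: unitary_inverse_def)
  ultimately show ?thesis using add scale inner mem by (simp add: unitaries_def PiE_def)
qed

section \<open>Conjugation by a unitary as an intertwining relation\<close>

lemma ad_apply:
  assumes "hilbert_space H" "hilbert_space H'" "V \<in> unitaries H H'" "x \<in> carrier H"
  shows "ad H V T (V x) = V (T x)"
  using assms unitaries_inj_on[of H H' V] by (simp add: ad_def)

lemma ad_extensional: "V \<in> unitaries H H' \<Longrightarrow> ad H V T \<in> extensional (carrier H')"
  using unitariesD(5)[of V H H'] by (simp add: ad_def)

text \<open>Every vector of the target is some V x, and both operators are extensional on the
  target. Equality with \<open>ad H V T\<close> is thus the relation T' V = V T, which can be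
  checked without inverses.\<close>

lemma ad_eq_iff:
  assumes "hilbert_space H" "hilbert_space H'" and V: "V \<in> unitaries H H'"
    and T': "T' \<in> extensional (carrier H')"
  shows "ad H V T = T' \<longleftrightarrow> (\<forall>x\<in>carrier H. T' (V x) = V (T x))"
proof
  assume "ad H V T = T'"
  then show "\<forall>x\<in>carrier H. T' (V x) = V (T x)" using ad_apply[OF assms(1-3)] by auto
next
  assume *: "\<forall>x\<in>carrier H. T' (V x) = V (T x)"
  show "ad H V T = T'"
  proof (rule extensionalityI[OF ad_extensional[OF V] T'])
    fix y assume "y \<in> carrier H'"
    then obtain x where "x \<in> carrier H" "y = V x" using unitariesD(5)[OF V] by auto
    then show "ad H V T y = T' y" using * ad_apply[OF assms(1-3)] by auto
  qed
qed

text \<open>The right-hand side compares options, so it contains the equality V Dom(D) = Dom(D')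
  together with the equality of values.\<close>

lemma ad_unbounded_eq_iff:
  assumes "hilbert_space H" "hilbert_space H'" and V: "V \<in> unitaries H H'"
    and D': "dom D' \<subseteq> carrier H'"
  shows "ad_unbounded H V D = D' \<longleftrightarrow> (\<forall>x\<in>carrier H. D' (V x) = map_option V (D x))"
proof -
  have *: "ad_unbounded H V D (V x) = map_option V (D x)" if "x \<in> carrier H" for x
    using that unitaries_inj_on[OF assms(1-3)] by (simp add: ad_unbounded_def)
  show ?thesis
  proof
    assume "ad_unbounded H V D = D'"
    then show "\<forall>x\<in>carrier H. D' (V x) = map_option V (D x)" using * by auto
  next
    assume r: "\<forall>x\<in>carrier H. D' (V x) = map_option V (D x)"
    show "ad_unbounded H V D = D'"
    proof
      fix y
      show "ad_unbounded H V D y = D' y"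
      proof (cases "y \<in> carrier H'")
        case True
        then obtain x where "x \<in> carrier H" "y = V x" using unitariesD(5)[OF V] by auto
        then show ?thesis using r * by auto
      next
        case False
        then have "D' y = None" using D' by (auto simp: domIff)
        then show ?thesis using False unitariesD(5)[OF V] by (simp add: ad_unbounded_def)
      qed
    qed
  qed
qed

text \<open>Off the carrier both sides are \<open>None\<close>: the right one by its definition, the
  left one by the assumption on the domain.\<close>

lemma op_left_eq_op_right_iff:
  assumes "dom D \<subseteq> carrier H"
  shows "op_left u D = op_right H D u \<longleftrightarrow> (\<forall>x\<in>carrier H. D (u x) = map_option u (D x))"
proof -
  have "D x = None" if "x \<notin> carrier H" for x using that assms by (auto simp: domIff)
  then show ?thesis by (auto simp: op_left_def op_right_def fun_eq_iff)
qed

section \<open>The algebra of bounded operators\<close>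

lemma bounded_opsD:
  assumes "T \<in> bounded_ops H"
  shows "x \<in> carrier H \<Longrightarrow> T x \<in> carrier H"
    and "\<lbrakk>x \<in> carrier H; y \<in> carrier H\<rbrakk> \<Longrightarrow> T (vadd H x y) = vadd H (T x) (T y)"
    and "x \<in> carrier H \<Longrightarrow> T (vscale H c x) = vscale H c (T x)"
    and "T \<in> extensional (carrier H)"
  using assms by (auto simp: bounded_ops_def PiE_def)

context hilbert_space
begin

text \<open>The definition does not ask the bound M to be nonnegative. Passing to its absolute value
  makes it so, which allows bounds to be multiplied in \<open>bounded_ops_compose\<close>.\<close>

lemma bounded_ops_bound:
  assumes "T \<in> bounded_ops H"
  obtains M where "0 \<le> M" "\<And>x. x \<in> carrier H \<Longrightarrow> hnorm H (T x) \<le> M * hnorm H x"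
proof -
  obtain M where M: "\<forall>x\<in>carrier H. hnorm H (T x) \<le> M * hnorm H x"
    using assms by (auto simp: bounded_ops_def)
  have "M * hnorm H x \<le> \<bar>M\<bar> * hnorm H x" if "x \<in> carrier H" for x
    using hnorm_nonneg[OF that] by (simp add: mult_right_mono)
  then show ?thesis using that[of "\<bar>M\<bar>"] M by force
qed

lemma bounded_opsI:
  assumes "T \<in> extensional (carrier H)" "\<And>x. x \<in> carrier H \<Longrightarrow> T x \<in> carrier H"
    and "\<And>x y. \<lbrakk>x \<in> carrier H; y \<in> carrier H\<rbrakk> \<Longrightarrow> T (vadd H x y) = vadd H (T x) (T y)"
    and "\<And>c x. x \<in> carrier H \<Longrightarrow> T (vscale H c x) = vscale H c (T x)"
    and "\<And>x. x \<in> carrier H \<Longrightarrow> hnorm H (T x) \<le> M * hnorm H x"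
  shows "T \<in> bounded_ops H"
  unfolding bounded_ops_def PiE_def using assms by blast

lemma bounded_ops_zero: "(\<lambda>x\<in>carrier H. vzero H) \<in> bounded_ops H"
proof (rule bounded_opsI[where M = 0])
  show "hnorm H ((\<lambda>x\<in>carrier H. vzero H) x) \<le> 0 * hnorm H x" if "x \<in> carrier H" for x
    using that inner_zero_left[OF zero_closed] by (simp add: hnorm_def)
qed (auto simp: add_closed scale_closed zero_closed add_zero scale_zero_right)

lemma bounded_ops_add:
  assumes S: "S \<in> bounded_ops H" and T: "T \<in> bounded_ops H"
  shows "(\<lambda>x\<in>carrier H. vadd H (S x) (T x)) \<in> bounded_ops H"
proof -
  obtain M where M: "0 \<le> M" "\<And>x. x \<in> carrier H \<Longrightarrow> hnorm H (S x) \<le> M * hnorm H x"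
    using bounded_ops_bound[OF S] by blast
  obtain M' where M': "0 \<le> M'" "\<And>x. x \<in> carrier H \<Longrightarrow> hnorm H (T x) \<le> M' * hnorm H x"
    using bounded_ops_bound[OF T] by blast
  \<comment> \<open>The factor 2 is inherited from \<open>hnorm_add_le\<close>.\<close>
  show ?thesis
  proof (rule bounded_opsI[where M = "2 * (M + M')"])
    fix x assume x: "x \<in> carrier H"
    have "hnorm H (vadd H (S x) (T x)) \<le> 2 * (hnorm H (S x) + hnorm H (T x))"
      using x bounded_opsD(1)[OF S] bounded_opsD(1)[OF T] by (intro hnorm_add_le)
    also have "\<dots> \<le> 2 * (M * hnorm H x + M' * hnorm H x)"
      using M(2)[OF x] M'(2)[OF x] by simp
    finally show "hnorm H ((\<lambda>x\<in>carrier H. vadd H (S x) (T x)) x) \<le> 2 * (M + M') * hnorm H x"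
      using x by (simp add: algebra_simps)
  qed (use bounded_opsD[OF S] bounded_opsD[OF T] in
      \<open>auto simp: add_closed scale_closed add_assoc add_left_commute scale_add_right\<close>)
qed

lemma bounded_ops_scale:
  assumes T: "T \<in> bounded_ops H"
  shows "(\<lambda>x\<in>carrier H. vscale H c (T x)) \<in> bounded_ops H"
proof -
  obtain M where M: "0 \<le> M" "\<And>x. x \<in> carrier H \<Longrightarrow> hnorm H (T x) \<le> M * hnorm H x"
    using bounded_ops_bound[OF T] by blast
  show ?thesis
  proof (rule bounded_opsI[where M = "cmod c * M"])
    fix x assume "x \<in> carrier H"
    then show "hnorm H ((\<lambda>x\<in>carrier H. vscale H c (T x)) x) \<le> cmod c * M * hnorm H x"
      using M(2) bounded_opsD(1)[OF T] by (simp add: hnorm_scale mult.assoc mult_left_mono)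
  qed (use bounded_opsD[OF T] in
      \<open>auto simp: add_closed scale_closed scale_add_right scale_scale mult.commute\<close>)
qed

lemma bounded_ops_compose:
  assumes S: "S \<in> bounded_ops H" and T: "T \<in> bounded_ops H"
  shows "compose (carrier H) S T \<in> bounded_ops H"
proof -
  obtain M where M: "0 \<le> M" "\<And>x. x \<in> carrier H \<Longrightarrow> hnorm H (S x) \<le> M * hnorm H x"
    using bounded_ops_bound[OF S] by blast
  obtain M' where M': "0 \<le> M'" "\<And>x. x \<in> carrier H \<Longrightarrow> hnorm H (T x) \<le> M' * hnorm H x"
    using bounded_ops_bound[OF T] by blast
  show ?thesis
  proof (rule bounded_opsI[where M = "M * M'"])
    fix x assume x: "x \<in> carrier H"
    have "hnorm H (S (T x)) \<le> M * hnorm H (T x)" using M x bounded_opsD(1)[OF T] by blast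
    also have "\<dots> \<le> M * (M' * hnorm H x)" using M M' x by (simp add: mult_left_mono)
    finally show "hnorm H (compose (carrier H) S T x) \<le> M * M' * hnorm H x"
      using x by (simp add: compose_def mult.assoc)
  qed (use bounded_opsD[OF S] bounded_opsD[OF T] in
      \<open>auto simp: compose_def add_closed scale_closed\<close>)
qed

end

lemma bounded_ops_ad:
  assumes "hilbert_space H" "hilbert_space H'" and V: "V \<in> unitaries H H'"
    and T: "T \<in> bounded_ops H"
  shows "ad H V T \<in> bounded_ops H'"
proof -
  interpret H: hilbert_space H by fact
  interpret H': hilbert_space H' by fact
  obtain M where M: "\<And>x. x \<in> carrier H \<Longrightarrow> hnorm H (T x) \<le> M * hnorm H x"
    using H.bounded_ops_bound[OF T] by blast
  note VD = unitariesD[OF V] and TD = bounded_opsD[OF T] and adV = ad_apply[OF assms(1-3)]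
  have surj: "\<exists>x\<in>carrier H. y = V x" if "y \<in> carrier H'" for y using VD(5) that by auto
  show ?thesis
  proof (rule H'.bounded_opsI[where M = M])
    show "ad H V T \<in> extensional (carrier H')" using ad_extensional[OF V] .
    show "ad H V T y \<in> carrier H'" if "y \<in> carrier H'" for y
      using surj[OF that] by (auto simp: adV VD TD)
    show "ad H V T (vadd H' y z) = vadd H' (ad H V T y) (ad H V T z)"
      if yz: "y \<in> carrier H'" "z \<in> carrier H'" for y z
    proof -
      obtain y' z' where "y' \<in> carrier H" "z' \<in> carrier H" "y = V y'" "z = V z'"
        using surj yz by metis
      then show ?thesis by (simp add: VD(2)[symmetric] adV H.add_closed TD VD(1))
    qed
    show "ad H V T (vscale H' c y) = vscale H' c (ad H V T y)" if y: "y \<in> carrier H'" for c y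
    proof -
      obtain y' where "y' \<in> carrier H" "y = V y'" using surj y by metis
      then show ?thesis by (simp add: VD(3)[symmetric] adV H.scale_closed TD VD(1))
    qed
    show "hnorm H' (ad H V T y) \<le> M * hnorm H' y" if y: "y \<in> carrier H'" for y
    proof -
      obtain y' where "y' \<in> carrier H" "y = V y'" using surj y by metis
      then show ?thesis using M VD TD by (simp add: adV hnorm_def)
    qed
  qed
qed

section \<open>The domain of the superderivation\<close>

lemma grading_involution:
  "\<lbrakk>grading_unitary H \<Gamma>; y \<in> carrier H\<rbrakk> \<Longrightarrow> \<Gamma> (\<Gamma> y) = y"
  unfolding grading_unitary_def op_one_def by (metis compose_eq restrict_apply')

lemma grading_ad:
  assumes "hilbert_space H" "grading_unitary H \<Gamma>" "y \<in> carrier H"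
  shows "ad H \<Gamma> T y = \<Gamma> (T (\<Gamma> y))"
proof -
  have \<Gamma>: "\<Gamma> \<in> unitaries H H" using assms(2) by (simp add: grading_unitary_def)
  show ?thesis
    using ad_apply[OF assms(1,1) \<Gamma> unitariesD(1)[OF \<Gamma> assms(3)], of T]
      grading_involution[OF assms(2,3)] by simp
qed

text \<open>The common core of both kinds of triples: each fibre of a net and the space of an
  equivariant triple are instances, so everything about Dom(\<delta>) and about compatible unitaries
  is proved here once.\<close>

locale graded_operator = hilbert_space H for H :: "('h, 'm) hilb_scheme" +
  fixes \<Gamma> :: "'h \<Rightarrow> 'h" and D :: "'h \<rightharpoonup> 'h"
  assumes grading: "grading_unitary H \<Gamma>" and linear: "linear_operator H D"
begin

lemma Gamma_unitary: "\<Gamma> \<in> unitaries H H"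
  using grading by (simp add: grading_unitary_def)

lemmas \<Gamma>D = unitariesD[OF Gamma_unitary]

lemma D_Some: "D x = Some y \<Longrightarrow> x \<in> carrier H \<and> y \<in> carrier H"
  using linear unfolding linear_operator_def by (blast intro: ranI domI)

lemma D_add: "\<lbrakk>D x = Some y; D x' = Some y'\<rbrakk> \<Longrightarrow> D (vadd H x x') = Some (vadd H y y')"
  using linear unfolding linear_operator_def by (metis domI option.sel)

lemma D_scale: "D x = Some y \<Longrightarrow> D (vscale H c x) = Some (vscale H c y)"
  using linear unfolding linear_operator_def by (metis domI option.sel)

lemma D_zero: "D (vzero H) = Some (vzero H)"
proof -
  obtain y where y: "D (vzero H) = Some y" using linear by (auto simp: linear_operator_def)
  \<comment> \<open>Writing 0 as 0 + (-1) 0, linearity gives the value y + (-1) y.\<close>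
  then have "D (vadd H (vzero H) (vscale H (- 1) (vzero H))) = Some (vadd H y (vscale H (- 1) y))"
    by (intro D_add D_scale)
  then show ?thesis using y D_Some[OF y] by (simp add: add_neg zero_closed)
qed

text \<open>The inclusion of operators read on vectors: T preserves Dom(D), and D T x = \<Gamma> T
  \<Gamma> D x + b x, since \<Gamma> is its own inverse. The bounded part is moved to the other side
  as a summand, so that closure properties become computations with sums.\<close>

lemma superderivation_domain_iff:
  "T \<in> superderivation_domain H \<Gamma> D \<longleftrightarrow> T \<in> bounded_ops H \<and>
    (\<exists>b\<in>bounded_ops H. \<forall>x y. D x = Some y \<longrightarrow> D (T x) = Some (vadd H (\<Gamma> (T (\<Gamma> y))) (b x)))"
proof (cases "T \<in> bounded_ops H")
  case T: True
  have "op_left (ad H \<Gamma> T) D \<subseteq>\<^sub>m op_minus H (op_right H D T) b \<longleftrightarrow>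
      (\<forall>x y. D x = Some y \<longrightarrow> D (T x) = Some (vadd H (\<Gamma> (T (\<Gamma> y))) (b x)))"
    if b: "b \<in> bounded_ops H" for b
  proof -
    have "(Some (ad H \<Gamma> T y) = op_minus H (op_right H D T) b x)
        = (D (T x) = Some (vadd H (\<Gamma> (T (\<Gamma> y))) (b x)))" if Dx: "D x = Some y" for x y
    proof -
      have x: "x \<in> carrier H" and y: "y \<in> carrier H" using D_Some[OF Dx] by auto
      have m: "\<Gamma> (T (\<Gamma> y)) \<in> carrier H" "b x \<in> carrier H" using x y \<Gamma>D(1) bounded_opsD(1)[OF T] bounded_opsD(1)[OF b] by auto
      show ?thesis
      proof (cases "D (T x)")
        case None
        then show ?thesis using x by (simp add: op_minus_def op_right_def)
      next
        case (Some z)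
        then show ?thesis using x y D_Some[OF Some] m vdiff_eq_iff[of z "b x" "\<Gamma> (T (\<Gamma> y))"]
          by (auto simp: op_minus_def op_right_def grading_ad[OF hilbert_space_axioms grading y])
      qed
    qed
    \<comment> \<open>\<open>map_le\<close> quantifies over the domain of its left-hand side, which
      is Dom(D) because \<open>ad H \<Gamma> T\<close> is applied after D.\<close>
    moreover have "op_left (ad H \<Gamma> T) D \<subseteq>\<^sub>m op_minus H (op_right H D T) b \<longleftrightarrow>
        (\<forall>x y. D x = Some y \<longrightarrow> Some (ad H \<Gamma> T y) = op_minus H (op_right H D T) b x)"
      by (auto simp: map_le_def op_left_def dom_def)
    ultimately show ?thesis by simp
  qed
  then show ?thesis using T by (simp add: superderivation_domain_def)
qed (simp add: superderivation_domain_def)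

lemma superderivation_domain_zero: "(\<lambda>x\<in>carrier H. vzero H) \<in> superderivation_domain H \<Gamma> D"
proof -
  have "\<Gamma> (vzero H) = vzero H"
    by (metis \<Gamma>D(1,2) add_left_cancel add_zero zero_closed)
  then have "D x = Some y \<longrightarrow> D ((\<lambda>x\<in>carrier H. vzero H) x) =
      Some (vadd H (\<Gamma> ((\<lambda>x\<in>carrier H. vzero H) (\<Gamma> y))) ((\<lambda>x\<in>carrier H. vzero H) x))" for x y
    using D_Some[of x y] \<Gamma>D(1) by (auto simp: D_zero add_zero zero_closed)
  then show ?thesis unfolding superderivation_domain_iff using bounded_ops_zero by blast
qed

lemma superderivation_domain_add:
  assumes "S \<in> superderivation_domain H \<Gamma> D" "T \<in> superderivation_domain H \<Gamma> D"
  shows "(\<lambda>x\<in>carrier H. vadd H (S x) (T x)) \<in> superderivation_domain H \<Gamma> D"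
proof -
  obtain b c where S: "S \<in> bounded_ops H" and T: "T \<in> bounded_ops H"
    and b: "b \<in> bounded_ops H" and c: "c \<in> bounded_ops H"
    and Sb: "\<And>x y. D x = Some y \<Longrightarrow> D (S x) = Some (vadd H (\<Gamma> (S (\<Gamma> y))) (b x))"
    and Tc: "\<And>x y. D x = Some y \<Longrightarrow> D (T x) = Some (vadd H (\<Gamma> (T (\<Gamma> y))) (c x))"
    using assms unfolding superderivation_domain_iff by blast
  let ?R = "\<lambda>x\<in>carrier H. vadd H (S x) (T x)" and ?d = "\<lambda>x\<in>carrier H. vadd H (b x) (c x)"
  have "D (?R x) = Some (vadd H (\<Gamma> (?R (\<Gamma> y))) (?d x))" if Dx: "D x = Some y" for x y
  proof -
    have "x \<in> carrier H" "y \<in> carrier H" using D_Some[OF Dx] by auto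
    moreover have "D (vadd H (S x) (T x))
        = Some (vadd H (vadd H (\<Gamma> (S (\<Gamma> y))) (b x)) (vadd H (\<Gamma> (T (\<Gamma> y))) (c x)))"
      using D_add[OF Sb[OF Dx] Tc[OF Dx]] .
    ultimately show ?thesis
      using bounded_opsD(1)[OF S] bounded_opsD(1)[OF T] bounded_opsD(1)[OF b]
        bounded_opsD(1)[OF c] \<Gamma>D(1,2)
      by (simp add: add_assoc add_left_commute add_closed)
  qed
  then show ?thesis unfolding superderivation_domain_iff
    using bounded_ops_add[OF S T] bounded_ops_add[OF b c] by blast
qed

lemma superderivation_domain_scale:
  assumes "T \<in> superderivation_domain H \<Gamma> D"
  shows "(\<lambda>x\<in>carrier H. vscale H k (T x)) \<in> superderivation_domain H \<Gamma> D"
proof -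
  obtain c where T: "T \<in> bounded_ops H" and c: "c \<in> bounded_ops H"
    and Tc: "\<And>x y. D x = Some y \<Longrightarrow> D (T x) = Some (vadd H (\<Gamma> (T (\<Gamma> y))) (c x))"
    using assms unfolding superderivation_domain_iff by blast
  let ?R = "\<lambda>x\<in>carrier H. vscale H k (T x)" and ?d = "\<lambda>x\<in>carrier H. vscale H k (c x)"
  have "D (?R x) = Some (vadd H (\<Gamma> (?R (\<Gamma> y))) (?d x))" if Dx: "D x = Some y" for x y
  proof -
    have "x \<in> carrier H" "y \<in> carrier H" using D_Some[OF Dx] by auto
    moreover have "D (vscale H k (T x)) = Some (vscale H k (vadd H (\<Gamma> (T (\<Gamma> y))) (c x)))"
      using D_scale[OF Tc[OF Dx]] .
    ultimately show ?thesis
      using bounded_opsD(1)[OF T] bounded_opsD(1)[OF c] \<Gamma>D(1,3)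
      by (simp add: scale_add_right)
  qed
  then show ?thesis unfolding superderivation_domain_iff
    using bounded_ops_scale[OF T] bounded_ops_scale[OF c] by blast
qed

text \<open>The bounded part of the product is given by the graded Leibniz rule
  \<^emph>\<open>\<delta>(S T) = \<delta>(S) T + ad \<Gamma> (S) \<delta>(T)\<close>.\<close>

lemma superderivation_domain_compose:
  assumes "S \<in> superderivation_domain H \<Gamma> D" "T \<in> superderivation_domain H \<Gamma> D"
  shows "compose (carrier H) S T \<in> superderivation_domain H \<Gamma> D"
proof -
  obtain b c where S: "S \<in> bounded_ops H" and T: "T \<in> bounded_ops H"
    and b: "b \<in> bounded_ops H" and c: "c \<in> bounded_ops H"
    and Sb: "\<And>x y. D x = Some y \<Longrightarrow> D (S x) = Some (vadd H (\<Gamma> (S (\<Gamma> y))) (b x))"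
    and Tc: "\<And>x y. D x = Some y \<Longrightarrow> D (T x) = Some (vadd H (\<Gamma> (T (\<Gamma> y))) (c x))"
    using assms unfolding superderivation_domain_iff by blast
  let ?R = "compose (carrier H) S T"
  let ?g = "compose (carrier H) (ad H \<Gamma> S) c" and ?h = "compose (carrier H) b T"
  let ?d = "\<lambda>x\<in>carrier H. vadd H (?g x) (?h x)"
  note ad\<Gamma> = grading_ad[OF hilbert_space_axioms grading]
  have adS: "ad H \<Gamma> S \<in> bounded_ops H"
    using bounded_ops_ad[OF hilbert_space_axioms hilbert_space_axioms Gamma_unitary S] .
  have d: "?d \<in> bounded_ops H"
    using bounded_ops_add[OF bounded_ops_compose[OF adS c] bounded_ops_compose[OF b T]] .
  have "D (?R x) = Some (vadd H (\<Gamma> (?R (\<Gamma> y))) (?d x))" if Dx: "D x = Some y" for x y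
  proof -
    have xy: "x \<in> carrier H" "y \<in> carrier H" using D_Some[OF Dx] by auto
    let ?z = "vadd H (\<Gamma> (T (\<Gamma> y))) (c x)"
    have DT: "D (T x) = Some ?z" using Tc[OF Dx] .
    \<comment> \<open>The characterisation of S is applied at the vector T x, which lies in Dom(D)
      with image \<open>?z\<close>. Splitting \<Gamma> \<open>?z\<close> separates the leading term
      \<Gamma> S T \<Gamma> y from ad \<Gamma> (S) c x.\<close>
    have "\<Gamma> ?z = vadd H (T (\<Gamma> y)) (\<Gamma> (c x))"
      using xy bounded_opsD(1)[OF T] bounded_opsD(1)[OF c] \<Gamma>D(1,2) grading_involution[OF grading]
      by simp
    then show ?thesis using Sb[OF DT] xy bounded_opsD(1)[OF T] bounded_opsD(1,2)[OF S]
        bounded_opsD(1)[OF c] bounded_opsD(1)[OF b] \<Gamma>D(1,2)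
      by (simp add: compose_def ad\<Gamma> add_assoc add_closed)
  qed
  then show ?thesis unfolding superderivation_domain_iff
    using bounded_ops_compose[OF S T] d by blast
qed

end

text \<open>V carries the whole relation across, with bounded part ad V (c). Applied to transport
  along p, it places the operator of a generator (p, t), which comes from the fibre over the source
  of p, in Dom(\<delta>) over a.\<close>

lemma superderivation_domain_ad:
  assumes "graded_operator H \<Gamma> D" "graded_operator H' \<Gamma>' D'" and V: "V \<in> unitaries H H'"
    and \<Gamma>: "\<And>x. x \<in> carrier H \<Longrightarrow> V (\<Gamma> x) = \<Gamma>' (V x)"
    and D: "\<And>x. x \<in> carrier H \<Longrightarrow> D' (V x) = map_option V (D x)"
    and T: "T \<in> superderivation_domain H \<Gamma> D"
  shows "ad H V T \<in> superderivation_domain H' \<Gamma>' D'"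
proof -
  interpret H: graded_operator H \<Gamma> D by fact
  interpret H': graded_operator H' \<Gamma>' D' by fact
  note hs = H.hilbert_space_axioms H'.hilbert_space_axioms
  obtain c where Tb: "T \<in> bounded_ops H" and c: "c \<in> bounded_ops H"
    and Tc: "\<And>x y. D x = Some y \<Longrightarrow> D (T x) = Some (vadd H (\<Gamma> (T (\<Gamma> y))) (c x))"
    using T unfolding H.superderivation_domain_iff by blast
  note adV = ad_apply[OF hs V] and VD = unitariesD[OF V]
  have "D' (ad H V T x') = Some (vadd H' (\<Gamma>' (ad H V T (\<Gamma>' y'))) (ad H V c x'))"
    if D'x': "D' x' = Some y'" for x' y'
  proof -
    obtain x where x: "x \<in> carrier H" "x' = V x" using H'.D_Some[OF D'x'] VD(5) by auto
    then obtain y where y: "D x = Some y" "y' = V y" using D'x' D by auto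
    have yc: "y \<in> carrier H" using H.D_Some[OF y(1)] by simp
    show ?thesis
      using x y yc D Tc[OF y(1)] VD(1,2) bounded_opsD(1)[OF Tb] bounded_opsD(1)[OF c] H.\<Gamma>D(1)
      by (simp add: adV \<Gamma>[symmetric])
  qed
  then show ?thesis unfolding H'.superderivation_domain_iff
    using bounded_ops_ad[OF hs V Tb] bounded_ops_ad[OF hs V c] by blast
qed

section \<open>Paths and homotopy\<close>

lemma is_path_Cons:
  "is_path (b # p) \<longleftrightarrow> is_po_simplex b \<and> (p \<noteq> [] \<longrightarrow> face1 b = face0 (hd p) \<and> is_path p)"
proof (cases p)
  case (Cons c q)
  have "(\<forall>i. Suc i < length (b # p) \<longrightarrow> face1 ((b # p) ! i) = face0 ((b # p) ! Suc i))
      \<longleftrightarrow> face1 b = face0 c \<and> (\<forall>i. Suc i < length p \<longrightarrow> face1 (p ! i) = face0 (p ! Suc i))"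
    (is "(\<forall>i. ?L i) \<longleftrightarrow> _")
  proof -
    have "(\<forall>i. ?L i) \<longleftrightarrow> ?L 0 \<and> (\<forall>i. ?L (Suc i))" by (metis not0_implies_Suc)
    then show ?thesis using Cons by simp
  qed
  then show ?thesis unfolding is_path_def using Cons by auto
qed (auto simp: is_path_def)

lemma not_is_path_Nil [simp]: "\<not> is_path []"
  by (simp add: is_path_def)

lemma is_path_append:
  "\<lbrakk>p \<noteq> []; q \<noteq> []\<rbrakk> \<Longrightarrow> is_path (p @ q) \<longleftrightarrow> is_path p \<and> is_path q \<and> path_source p = path_target q"
  by (induction p) (auto simp: is_path_Cons path_source_def path_target_def)

lemma paths_not_Nil: "p \<in> paths x y \<Longrightarrow> p \<noteq> []"
  by (auto simp: paths_def)

lemma paths_source: "p \<in> paths x y \<Longrightarrow> path_source p = x"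
  and paths_target: "p \<in> paths x y \<Longrightarrow> path_target p = y"
  and paths_is_path: "p \<in> paths x y \<Longrightarrow> is_path p"
  by (auto simp: paths_def)

lemma path_ends_append:
  "\<lbrakk>p \<noteq> []; q \<noteq> []\<rbrakk> \<Longrightarrow> path_source (p @ q) = path_source q"
  "\<lbrakk>p \<noteq> []; q \<noteq> []\<rbrakk> \<Longrightarrow> path_target (p @ q) = path_target p"
  by (simp_all add: path_source_def path_target_def)

lemma paths_append: "\<lbrakk>p \<in> paths y z; q \<in> paths x y\<rbrakk> \<Longrightarrow> p @ q \<in> paths x z"
  using paths_not_Nil[of p y z] paths_not_Nil[of q x y]
  by (auto simp: paths_def is_path_append path_ends_append)

lemma paths_singleton: "[b] \<in> paths x y \<longleftrightarrow> is_po_simplex b \<and> face1 b = x \<and> face0 b = y"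
  by (auto simp: paths_def is_path_Cons path_source_def path_target_def)

lemma paths_Cons:
  "p \<noteq> [] \<Longrightarrow> b # p \<in> paths x y \<longleftrightarrow> is_po_simplex b \<and> face0 b = y \<and> p \<in> paths x (face1 b)"
  by (auto simp: paths_def is_path_Cons path_source_def path_target_def)

text \<open>Paths are nonempty, so the base case is a single simplex. The head of the list is the
  simplex traversed last; hence the source stays fixed and the target moves in the inductive
  step.\<close>

lemma paths_induct [consumes 1, case_names singleton Cons]:
  assumes "p \<in> paths x y"
    and "\<And>b. is_po_simplex b \<Longrightarrow> P [b] (face1 b) (face0 b)"
    and "\<And>b p x. \<lbrakk>is_po_simplex b; p \<in> paths x (face1 b); P p x (face1 b)\<rbrakk>
      \<Longrightarrow> P (b # p) x (face0 b)"
  shows "P p x y"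
  using assms(1)
proof (induction p arbitrary: y)
  case Nil
  then show ?case using paths_not_Nil by blast
next
  case (Cons b p)
  show ?case
  proof (cases "p = []")
    case True
    then show ?thesis using Cons.prems assms(2)[of b] by (auto simp: paths_singleton)
  next
    case False
    then show ?thesis using Cons assms(3)[of b p x] by (auto simp: paths_Cons)
  qed
qed

lemma arrow_path_paths: "x \<le> y \<Longrightarrow> arrow_path y x \<in> paths x y"
  by (simp add: arrow_path_def paths_singleton is_po_simplex_def)

abbreviation const_path :: "'k::order \<Rightarrow> 'k po_path" where
  "const_path x \<equiv> [Simplex x x x]"

lemma const_path_paths: "const_path x \<in> paths x x"
  by (simp add: paths_singleton is_po_simplex_def)

definition rev_path :: "'k po_path \<Rightarrow> 'k po_path" where
  "rev_path p = rev (map (\<lambda>b. Simplex (support b) (face1 b) (face0 b)) p)"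

lemma rev_path_const [simp]: "rev_path (const_path x) = const_path x"
  by (simp add: rev_path_def)

lemma rev_path_Cons: "rev_path (b # p) = rev_path p @ [Simplex (support b) (face1 b) (face0 b)]"
  by (simp add: rev_path_def)

lemma rev_path_paths: "p \<in> paths x y \<Longrightarrow> rev_path p \<in> paths y x"
proof (induction rule: paths_induct)
  case (singleton b)
  then show ?case by (simp add: rev_path_def paths_singleton is_po_simplex_def)
next
  case (Cons b p x)
  have "[Simplex (support b) (face1 b) (face0 b)] \<in> paths (face0 b) (face1 b)"
    using Cons.hyps by (simp add: paths_singleton is_po_simplex_def)
  then show ?case using Cons.IH unfolding rev_path_Cons by (rule paths_append[rotated])
qed

section \<open>Homotopy, constant paths and reversal\<close>

lemma homotopic_paths:
  "homotopic p q \<Longrightarrow> is_path p \<and> is_path q \<and> path_source p = path_source q \<and> path_target p = path_target q"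
proof (induction rule: homotopic.induct)
  case (composition p p' q q')
  then have "p \<noteq> []" "q \<noteq> []" "p' \<noteq> []" "q' \<noteq> []" by auto
  then show ?case using composition by (simp add: is_path_append path_ends_append)
qed (auto simp: is_path_Cons path_source_def path_target_def)

lemma homotopic_paths_iff: "homotopic p q \<Longrightarrow> p \<in> paths x y \<longleftrightarrow> q \<in> paths x y"
  using homotopic_paths[of p q] by (simp add: paths_def)

lemma homotopic_append:
  "\<lbrakk>homotopic p p'; homotopic q q'; p \<in> paths y z; q \<in> paths x y\<rbrakk> \<Longrightarrow> homotopic (p @ q) (p' @ q')"
  by (rule homotopic.composition) (auto simp: paths_def)

lemma homotopic_append_left:
  "\<lbrakk>homotopic p p'; p \<in> paths y z; q \<in> paths x y\<rbrakk> \<Longrightarrow> homotopic (p @ q) (p' @ q)"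
  using homotopic_append homotopic.refl paths_is_path by blast

lemma homotopic_append_right:
  "\<lbrakk>homotopic q q'; p \<in> paths y z; q \<in> paths x y\<rbrakk> \<Longrightarrow> homotopic (p @ q) (p @ q')"
  using homotopic_append homotopic.refl paths_is_path by blast

text \<open>Only the simplex at the target is touched: it and the degenerate simplex at its end both
  lie below its support, which serves as the upper bound of an elementary homotopy.\<close>

lemma homotopic_const_left: "p \<in> paths x y \<Longrightarrow> homotopic (const_path y @ p) p"
proof (induction rule: paths_induct)
  case (singleton b)
  then show ?case
    by (simp add: homotopic.elementary[where c = "support b"] is_po_simplex_def)
next
  case (Cons b p x)
  have "homotopic [Simplex (face0 b) (face0 b) (face0 b), b] [b]"
    using Cons.hyps by (simp add: homotopic.elementary[where c = "support b"] is_po_simplex_def)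
  then have "homotopic ([Simplex (face0 b) (face0 b) (face0 b), b] @ p) ([b] @ p)"
    using Cons.hyps
    by (intro homotopic_append_left[where x = x and y = "face1 b" and z = "face0 b"])
      (auto simp: paths_Cons paths_singleton is_po_simplex_def)
  then show ?case by simp
qed

lemma homotopic_const_right: "p \<in> paths x y \<Longrightarrow> homotopic (p @ const_path x) p"
proof (induction rule: paths_induct)
  case (singleton b)
  then show ?case
    by (simp add: homotopic.elementary[where c = "support b"] is_po_simplex_def)
next
  case (Cons b p x)
  have "homotopic ([b] @ (p @ const_path x)) ([b] @ p)"
    using Cons paths_append[OF Cons.hyps(2) const_path_paths]
    by (intro homotopic_append_right[where x = x and y = "face1 b" and z = "face0 b"])
      (auto simp: paths_singleton)
  then show ?case by simp
qed

text \<open>Cancellation proceeds from the middle. The last simplex of p and its reverse are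
  adjacent and contract, below their common support, to a constant path, which is absorbed; then the
  shorter path cancels.\<close>

lemma homotopic_rev_path_left: "p \<in> paths x y \<Longrightarrow> homotopic (rev_path p @ p) (const_path x)"
proof (induction rule: paths_induct)
  case (singleton b)
  then show ?case
    by (simp add: rev_path_def homotopic.elementary[where c = "support b"] is_po_simplex_def)
next
  case (Cons b p x)
  let ?r = "Simplex (support b) (face1 b) (face0 b)"
  have rp: "rev_path p \<in> paths (face1 b) x" using rev_path_paths Cons.hyps by blast
  have rb: "[?r, b] \<in> paths (face1 b) (face1 b)"
    using Cons.hyps by (auto simp: paths_Cons paths_singleton is_po_simplex_def)
  have "homotopic [?r, b] (const_path (face1 b))"
    using Cons.hyps by (simp add: homotopic.elementary[where c = "support b"] is_po_simplex_def)
  then have "homotopic ([?r, b] @ p) (const_path (face1 b) @ p)"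
    using homotopic_append_left rb Cons.hyps(2) by blast
  then have "homotopic ([?r, b] @ p) p"
    using homotopic.trans homotopic_const_left Cons.hyps(2) by blast
  then have "homotopic (rev_path p @ ([?r, b] @ p)) (rev_path p @ p)"
    using homotopic_append_right rp paths_append[OF rb Cons.hyps(2)] by blast
  then show ?case using Cons.IH homotopic.trans by (simp add: rev_path_Cons) blast
qed

lemma homotopic_cancel_left:
  assumes "p \<in> paths y z" "q \<in> paths x y"
  shows "homotopic (rev_path p @ p @ q) q"
proof -
  have "homotopic ((rev_path p @ p) @ q) (const_path y @ q)"
    using homotopic_append_left homotopic_rev_path_left paths_append rev_path_paths assms by metis
  then show ?thesis using homotopic.trans homotopic_const_left[OF assms(2)] by simp blast
qed

text \<open>The top point z bounds all three supports. This is the source of the cocycle identity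
  for U in the induced net.\<close>

lemma homotopic_arrow_arrow:
  assumes "x \<le> y" "y \<le> z"
  shows "homotopic (arrow_path z y @ arrow_path y x) (arrow_path z x)"
  using assms by (simp add: arrow_path_def homotopic.elementary[where c = z] is_po_simplex_def)

text \<open>It expresses b as an arrow up to its support followed by a reversed arrow, so that
  transport along b in the induced net can be recognised from the values of U on arrows.\<close>

lemma homotopic_arrow_simplex:
  assumes "is_po_simplex b"
  shows "homotopic (arrow_path (support b) (face0 b) @ [b]) (arrow_path (support b) (face1 b))"
  using assms
  by (simp add: arrow_path_def homotopic.elementary[where c = "support b"] is_po_simplex_def)

section \<open>Homotopy classes of loops and their product\<close>

lemma homotopy_class_eq_iff:
  "is_path p \<Longrightarrow> homotopy_class p = homotopy_class q \<longleftrightarrow> homotopic p q"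
  unfolding homotopy_class_def
  by (auto intro: homotopic.refl homotopic.sym homotopic.trans)

lemma homotopy_class_eqI: "homotopic p q \<Longrightarrow> homotopy_class p = homotopy_class q"
  using homotopic_paths homotopy_class_eq_iff by blast

lemma mem_homotopy_class: "q \<in> homotopy_class p \<longleftrightarrow> homotopic p q"
  by (simp add: homotopy_class_def)

text \<open>Operations on quotients are encoded as unions over all representatives. Such a union
  collapses to a single class once every representative yields the same one.\<close>

lemma UN_eq_const:
  assumes "x \<in> X" "\<And>y. y \<in> X \<Longrightarrow> f y = c"
  shows "(\<Union>y\<in>X. f y) = c"
  using assms by blast

lemma fundamental_group_mult:
  assumes "p \<in> paths a a" "q \<in> paths a a"
  shows "homotopy_class p \<otimes>\<^bsub>fundamental_group a\<^esub> homotopy_class q = homotopy_class (p @ q)"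
proof -
  have eq: "homotopy_class (p' @ q') = homotopy_class (p @ q)"
    if "p' \<in> homotopy_class p" "q' \<in> homotopy_class q" for p' q'
    using homotopic_append[OF _ _ assms] homotopy_class_eqI that by (metis mem_homotopy_class)
  have mem: "p \<in> homotopy_class p" "q \<in> homotopy_class q"
    using assms[THEN paths_is_path] by (simp_all add: mem_homotopy_class homotopic.refl)
  have "(\<Union>p'\<in>homotopy_class p. \<Union>q'\<in>homotopy_class q. homotopy_class (p' @ q'))
      = homotopy_class (p @ q)"
    using mem eq by (intro UN_eq_const)
  then show ?thesis by (simp add: fundamental_group_def)
qed

lemma fundamental_group_carrier:
  "g \<in> carrier (fundamental_group a) \<longleftrightarrow> (\<exists>p\<in>paths a a. g = homotopy_class p)"
  by (auto simp: fundamental_group_def)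

definition frame :: "'k::order \<Rightarrow> 'k \<Rightarrow> 'k po_path" where
  "frame a x = (if x = a then const_path a else SOME p. p \<in> paths x a)"

lemma frame_self [simp]: "frame a a = const_path a"
  by (simp add: frame_def)

text \<open>A spanning tree: conjugating a path with the frame turns it into a loop at the base point.\<close>

definition frame_loop :: "'k::order \<Rightarrow> 'k po_path \<Rightarrow> 'k po_path" where
  "frame_loop a q = frame a (path_target q) @ q @ rev_path (frame a (path_source q))"

locale connected_poset =
  fixes a :: "'k::order"
  assumes connected: "pathwise_connected TYPE('k)"
begin

lemma frame_paths: "frame a x \<in> paths x a"
proof -
  have "\<exists>p. p \<in> paths x a" using connected by (auto simp: pathwise_connected_def)
  then have "(SOME p. p \<in> paths x a) \<in> paths x a" by (rule someI_ex)
  then show ?thesis using const_path_paths[of a] by (simp add: frame_def)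
qed

lemma frame_loop_paths: "q \<in> paths x y \<Longrightarrow> frame_loop a q \<in> paths a a"
  unfolding frame_loop_def using paths_source paths_target frame_paths
  by (metis paths_append rev_path_paths)

text \<open>At the intermediate point y the frame meets its own reverse and cancels. Up to homotopy,
  \<open>frame_loop\<close> is therefore a functor from paths to loops at the base point.\<close>

lemma frame_loop_append:
  assumes p: "p \<in> paths y z" and q: "q \<in> paths x y"
  shows "homotopic (frame_loop a p @ frame_loop a q) (frame_loop a (p @ q))"
proof -
  let ?f = "frame a" and ?r = "rev_path (frame a x)"
  have "homotopic (rev_path (?f y) @ ?f y @ (q @ ?r)) (q @ ?r)"
    using homotopic_cancel_left paths_append rev_path_paths frame_paths q by metis
  then have "homotopic ((?f z @ p) @ (rev_path (?f y) @ ?f y @ (q @ ?r))) ((?f z @ p) @ (q @ ?r))"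
    using homotopic_append_right paths_append rev_path_paths frame_paths p q by metis
  moreover have "frame_loop a (p @ q) = ?f z @ (p @ q) @ ?r"
    using paths_append[OF p q] by (simp add: frame_loop_def paths_source paths_target)
  ultimately show ?thesis using p q by (simp add: frame_loop_def paths_source paths_target)
qed

lemma frame_loop_homotopic:
  assumes "homotopic p q"
  shows "homotopic (frame_loop a p) (frame_loop a q)"
proof -
  obtain x y where p: "p \<in> paths x y" and q: "q \<in> paths x y"
    using homotopic_paths[OF assms] by (auto simp: paths_def)
  have "homotopic (frame a y @ p @ rev_path (frame a x)) (frame a y @ q @ rev_path (frame a x))"
    using homotopic_append_left[OF assms p] homotopic_append_right paths_append rev_path_paths
      frame_paths p by metis
  then show ?thesis using p q by (simp add: frame_loop_def paths_source paths_target)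
qed

text \<open>The reversed frame at x cancels against the frame at x. This says that the frames form a
  natural transformation, and it gives both the compatibility of \<pi> with U in the induced net and
  that of the unit with U.\<close>

lemma frame_loop_frame:
  assumes q: "q \<in> paths x y"
  shows "homotopic (frame_loop a q @ frame a x) (frame a y @ q)"
proof -
  have "homotopic (q @ (rev_path (frame a x) @ frame a x)) (q @ const_path x)"
    using homotopic_append_right homotopic_rev_path_left paths_append rev_path_paths frame_paths q
    by metis
  then have "homotopic (q @ (rev_path (frame a x) @ frame a x)) q"
    using homotopic.trans homotopic_const_right q by blast
  then have "homotopic (frame a y @ (q @ (rev_path (frame a x) @ frame a x))) (frame a y @ q)"
    using homotopic_append_right paths_append rev_path_paths frame_paths q by metis
  then show ?thesis using q by (simp add: frame_loop_def paths_source paths_target)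
qed

text \<open>The frame at the target is now constant and disappears. Hence (q, t) is the translate of
  the generator (\<open>frame a x\<close>, t) by the class of \<open>frame_loop a q\<close>.\<close>

lemma frame_loop_frame_base:
  assumes q: "q \<in> paths x a"
  shows "homotopic (frame_loop a q @ frame a x) q"
  using frame_loop_frame[OF q] homotopic_const_left[OF q] homotopic.trans by auto

text \<open>Both frames are constant at the base point. On loops the holonomy of the induced net is
  therefore the original action u.\<close>

lemma frame_loop_loop:
  assumes q: "q \<in> paths a a"
  shows "homotopic (frame_loop a q) q"
proof -
  have "homotopic (frame_loop a q @ const_path a) q" using frame_loop_frame_base[OF q] by simp
  moreover have "homotopic (frame_loop a q @ const_path a) (frame_loop a q)"
    using homotopic_const_right frame_loop_paths q by blast
  ultimately show ?thesis using homotopic.sym homotopic.trans by blast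
qed

end

section \<open>The algebra of the enveloping net bundle\<close>

locale algebra_net = connected_poset a for a :: "'k::order" +
  fixes N :: "('k, 'a) alg_net"
  assumes star_algebra_net: "star_algebra_net N" and net_grading: "net_grading N"
begin

lemma alg_star_algebra: "star_algebra (alg N x)"
  using star_algebra_net by (simp add: star_algebra_net_def)

lemma incl_star_hom: "x \<le> y \<Longrightarrow> incl N y x \<in> star_hom (alg N x) (alg N y)"
  using star_algebra_net by (simp add: star_algebra_net_def)

lemma agrad_star_hom: "agrad N x \<in> star_hom (alg N x) (alg N x)"
  using net_grading by (simp add: net_grading_def)

lemma agrad_incl:
  "\<lbrakk>x \<le> y; t \<in> carrier (alg N x)\<rbrakk> \<Longrightarrow> agrad N y (incl N y x t) = incl N y x (agrad N x t)"
  using net_grading by (simp add: net_grading_def)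

lemmas alg_closed =
  complex_vector_space.add_closed[OF star_algebra.axioms(1)[OF alg_star_algebra]]
  complex_vector_space.scale_closed[OF star_algebra.axioms(1)[OF alg_star_algebra]]
  complex_vector_space.zero_closed[OF star_algebra.axioms(1)[OF alg_star_algebra]]
  star_algebra.mult_closed[OF alg_star_algebra] star_algebra.star_closed[OF alg_star_algebra]

lemma incl_closed: "\<lbrakk>x \<le> y; t \<in> carrier (alg N x)\<rbrakk> \<Longrightarrow> incl N y x t \<in> carrier (alg N y)"
  using incl_star_hom[of x y] by (auto simp: star_hom_def)

lemma agrad_closed: "t \<in> carrier (alg N x) \<Longrightarrow> agrad N x t \<in> carrier (alg N x)"
  using agrad_star_hom[of x] by (auto simp: star_hom_def)

lemma env_wf_Gen: "p \<in> paths w a \<Longrightarrow> env_wf N a (Gen p t) \<longleftrightarrow> t \<in> carrier (alg N w)"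
  using paths_source[of p w a] by simp

lemma env_class_eq: "env_eq N a x y \<Longrightarrow> env_class N a x = env_class N a y"
  unfolding env_class_def by (auto intro: env_eq.sym env_eq.trans)

lemma mem_env_class: "y \<in> env_class N a x \<longleftrightarrow> env_eq N a x y"
  by (simp add: env_class_def)

lemma env_class_self: "env_wf N a x \<Longrightarrow> x \<in> env_class N a x"
  by (simp add: mem_env_class env_eq.refl)

lemma env_algebra_carrier: "X \<in> carrier (env_algebra N a) \<longleftrightarrow> (\<exists>x. env_wf N a x \<and> X = env_class N a x)"
  by (auto simp: env_algebra_def)

lemma UN2_eq_const:
  assumes "x \<in> X" "y \<in> Y" "\<And>x y. \<lbrakk>x \<in> X; y \<in> Y\<rbrakk> \<Longrightarrow> f x y = c"
  shows "(\<Union>x\<in>X. \<Union>y\<in>Y. f x y) = c"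
  using assms by (intro UN_eq_const)

lemma env_algebra_add:
  "\<lbrakk>env_wf N a x; env_wf N a y\<rbrakk>
    \<Longrightarrow> vadd (env_algebra N a) (env_class N a x) (env_class N a y) = env_class N a (Add x y)"
  unfolding env_algebra_def
  by (simp, rule UN2_eq_const, blast intro: env_class_self, blast intro: env_class_self)
    (auto simp: mem_env_class intro!: env_class_eq env_eq.cong_Add intro: env_eq.sym)

lemma env_algebra_scale:
  "env_wf N a x \<Longrightarrow> vscale (env_algebra N a) c (env_class N a x) = env_class N a (Scale c x)"
  unfolding env_algebra_def
  by (simp, rule UN_eq_const, blast intro: env_class_self)
    (auto simp: mem_env_class intro!: env_class_eq env_eq.cong_Scale intro: env_eq.sym)

lemma env_algebra_mult:
  "\<lbrakk>env_wf N a x; env_wf N a y\<rbrakk>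
    \<Longrightarrow> amult (env_algebra N a) (env_class N a x) (env_class N a y) = env_class N a (Mult x y)"
  unfolding env_algebra_def
  by (simp, rule UN2_eq_const, blast intro: env_class_self, blast intro: env_class_self)
    (auto simp: mem_env_class intro!: env_class_eq env_eq.cong_Mult intro: env_eq.sym)

lemma env_algebra_star:
  "env_wf N a x \<Longrightarrow> astar (env_algebra N a) (env_class N a x) = env_class N a (Star x)"
  unfolding env_algebra_def
  by (simp, rule UN_eq_const, blast intro: env_class_self)
    (auto simp: mem_env_class intro!: env_class_eq env_eq.cong_Star intro: env_eq.sym)

section \<open>Substitution of generators: the loop action and the grading\<close>

lemma env_wf_on_generators:
  assumes "\<And>w p t. \<lbrakk>p \<in> paths w a; t \<in> carrier (alg N w)\<rbrakk> \<Longrightarrow> env_wf N a (f p t)"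
    and "env_wf N a x"
  shows "env_wf N a (on_generators f x)"
  using assms(2) by (induction x) (auto intro: assms(1))

text \<open>The universal property of the presentation on the level of terms:
  \<open>on_generators\<close> commutes with all term constructors, so a substitution need only
  respect the five relations between generators.\<close>

lemma env_eq_on_generators:
  assumes wf: "\<And>w p t. \<lbrakk>p \<in> paths w a; t \<in> carrier (alg N w)\<rbrakk> \<Longrightarrow> env_wf N a (f p t)"
    and "\<And>w p t t' c. \<lbrakk>p \<in> paths w a; t \<in> carrier (alg N w); t' \<in> carrier (alg N w)\<rbrakk>
      \<Longrightarrow> env_eq N a (Add (f p t) (Scale c (f p t'))) (f p (vadd (alg N w) t (vscale (alg N w) c t')))"
    and "\<And>w p t t'. \<lbrakk>p \<in> paths w a; t \<in> carrier (alg N w); t' \<in> carrier (alg N w)\<rbrakk>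
      \<Longrightarrow> env_eq N a (Mult (f p t) (f p t')) (f p (amult (alg N w) t t'))"
    and "\<And>w p t. \<lbrakk>p \<in> paths w a; t \<in> carrier (alg N w)\<rbrakk>
      \<Longrightarrow> env_eq N a (Star (f p t)) (f p (astar (alg N w) t))"
    and "\<And>w w' p t. \<lbrakk>w \<le> w'; p \<in> paths w' a; t \<in> carrier (alg N w)\<rbrakk>
      \<Longrightarrow> env_eq N a (f (p @ arrow_path w' w) t) (f p (incl N w' w t))"
    and "\<And>w p p' t. \<lbrakk>p \<in> paths w a; p' \<in> paths w a; homotopic p p'; t \<in> carrier (alg N w)\<rbrakk>
      \<Longrightarrow> env_eq N a (f p t) (f p' t)"
    and "env_eq N a x y"
  shows "env_eq N a (on_generators f x) (on_generators f y)"
proof -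
  note wf' = env_wf_on_generators[of f, OF wf]
  show ?thesis using assms(7)
  proof (induction rule: env_eq.induct)
    case (sym x y)
    show ?case by (rule env_eq.sym[OF sym.IH])
  next
    case (trans x y z)
    show ?case by (rule env_eq.trans[OF trans.IH])
  \<comment> \<open>The selected rules are reflexivity, the congruences and the star-algebra axioms.
    Symmetry and transitivity have their own cases above, and the generator relations are the
    assumptions.\<close>
  qed (simp_all add: assms(2-6) env_eq.intros(1,4-24) wf')
qed

lemma env_eq_on_generators_cong:
  assumes "\<And>w p t. \<lbrakk>p \<in> paths w a; t \<in> carrier (alg N w)\<rbrakk> \<Longrightarrow> env_eq N a (f p t) (g p t)"
    and "env_wf N a x"
  shows "env_eq N a (on_generators f x) (on_generators g x)"
  using assms(2)
  by (induction x) (auto intro: assms(1) env_eq.refl env_eq.cong_Add env_eq.cong_Scale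
      env_eq.cong_Mult env_eq.cong_Star)

text \<open>A loop is attached at the target end of p, whereas the inclusion relation changes p only
  at its source end; the two do not interfere. Homotopies are preserved by composition with
  q.\<close>

lemma env_eq_action:
  assumes q: "q \<in> paths a a" and "env_eq N a x y"
  shows "env_eq N a (on_generators (\<lambda>p t. Gen (q @ p) t) x) (on_generators (\<lambda>p t. Gen (q @ p) t) y)"
proof (rule env_eq_on_generators[OF _ _ _ _ _ _ assms(2)])
  note qp = paths_append[OF q]
  show "env_wf N a (Gen (q @ p) t)" if "p \<in> paths w a" "t \<in> carrier (alg N w)" for w p t
    using that qp env_wf_Gen by blast
  show "env_eq N a (Gen (q @ p @ arrow_path w' w) t) (Gen (q @ p) (incl N w' w t))"
    if "w \<le> w'" "p \<in> paths w' a" "t \<in> carrier (alg N w)" for w w' p t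
    using env_eq.gen_incl[of w w' "q @ p" a t N] that qp by simp
  show "env_eq N a (Gen (q @ p) t) (Gen (q @ p') t)"
    if "p \<in> paths w a" "p' \<in> paths w a" "homotopic p p'" "t \<in> carrier (alg N w)" for w p p' t
    using env_eq.gen_homotopic[OF qp[OF that(1)] qp[OF that(2)] _ that(4)]
      homotopic_append_right[OF that(3) q that(1)] .
qed (auto intro: env_eq.gen_linear env_eq.gen_mult env_eq.gen_star paths_append[OF q])

text \<open>The two choices of representative are treated separately: another loop changes each
  generator by a homotopy, and another term is covered by \<open>env_eq_action\<close>.\<close>

lemma env_action_class:
  assumes q: "q \<in> paths a a" and x: "env_wf N a x"
  shows "env_action N a (homotopy_class q) (env_class N a x)
    = env_class N a (on_generators (\<lambda>p t. Gen (q @ p) t) x)"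
proof -
  let ?g = "\<lambda>q. on_generators (\<lambda>p t. Gen (q @ p) t)"
  have eq: "env_class N a (?g q' x') = env_class N a (?g q x)"
    if q': "q' \<in> homotopy_class q" and x': "x' \<in> env_class N a x" for q' x'
  proof -
    have h: "homotopic q q'" and e: "env_eq N a x x'"
      using q' x' by (simp_all add: mem_homotopy_class mem_env_class)
    have q'p: "q' \<in> paths a a" using h homotopic_paths_iff q by blast
    have "env_eq N a (?g q x) (?g q' x)"
    proof (rule env_eq_on_generators_cong[OF _ x])
      fix w p t assume p: "p \<in> paths w a" and t: "t \<in> carrier (alg N w)"
      show "env_eq N a (Gen (q @ p) t) (Gen (q' @ p) t)"
        using env_eq.gen_homotopic[OF paths_append[OF q p] paths_append[OF q'p p] _ t]
          homotopic_append_left[OF h q p] by blast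
    qed
    then show ?thesis using env_eq_action[OF q'p e] env_class_eq by simp
  qed
  have "q \<in> homotopy_class q" using paths_is_path[OF q] by (simp add: mem_homotopy_class homotopic.refl)
  then show ?thesis unfolding env_action_def using env_class_self[OF x] eq by (intro UN_eq_const)
qed

lemma env_action_Gen:
  assumes "q \<in> paths a a" "p \<in> paths w a" "t \<in> carrier (alg N w)"
  shows "env_action N a (homotopy_class q) (env_class N a (Gen p t)) = env_class N a (Gen (q @ p) t)"
  using env_action_class[OF assms(1), of "Gen p t"] assms(2,3) by (simp add: env_wf_Gen paths_source)

lemma env_grading_class:
  assumes x: "env_wf N a x"
  shows "env_grading N a (env_class N a x)
    = env_class N a (on_generators (\<lambda>p t. Gen p (agrad N (path_source p) t)) x)"
proof -
  let ?f = "\<lambda>p t. Gen p (agrad N (path_source p) t)"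
  have *: "env_eq N a (on_generators ?f x) (on_generators ?f y)" if "env_eq N a x y" for y
  proof (rule env_eq_on_generators[OF _ _ _ _ _ _ that])
    \<comment> \<open>Removing the arrow moves the source from w to w', so the two sides use the
      gradings over different points. They agree because the grading is an automorphism of the whole
      net.\<close>
    show "env_eq N a (Gen (p @ arrow_path w' w) (agrad N (path_source (p @ arrow_path w' w)) t))
        (Gen p (agrad N (path_source p) (incl N w' w t)))"
      if "w \<le> w'" "p \<in> paths w' a" "t \<in> carrier (alg N w)" for w w' p t
      using env_eq.gen_incl[OF that(1,2) agrad_closed[OF that(3)]] that
        paths_source[OF paths_append[OF that(2) arrow_path_paths[OF that(1)]]]
      by (simp add: paths_source agrad_incl)
  qed (use agrad_star_hom in \<open>auto simp: env_wf_Gen agrad_closed paths_source star_hom_def alg_closed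
      intro: env_eq.gen_linear env_eq.gen_mult env_eq.gen_star env_eq.gen_homotopic
      simp del: env_wf.simps(1)\<close>)
  have "env_class N a (on_generators ?f y) = env_class N a (on_generators ?f x)"
    if "y \<in> env_class N a x" for y
    using env_class_eq[OF *[of y]] that by (simp add: mem_env_class)
  then show ?thesis unfolding env_grading_def by (rule UN_eq_const[OF env_class_self[OF x]])
qed

lemma env_grading_Gen:
  assumes "p \<in> paths w a" "t \<in> carrier (alg N w)"
  shows "env_grading N a (env_class N a (Gen p t)) = env_class N a (Gen p (agrad N w t))"
  using env_grading_class[of "Gen p t"] assms by (simp add: env_wf_Gen paths_source)

end

section \<open>Arrows of the two categories\<close>

text \<open>The part shared by the unitaries of a net, the action of loops and the arrows of both
  categories. The equation for D is between options and so includes the equality of domains.\<close>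

definition spectral_unitary ::
  "('h, 'm) hilb_scheme \<Rightarrow> ('h \<Rightarrow> 'h) \<Rightarrow> ('h \<rightharpoonup> 'h) \<Rightarrow> ('h, 'n) hilb_scheme \<Rightarrow> ('h \<Rightarrow> 'h) \<Rightarrow> ('h \<rightharpoonup> 'h)
    \<Rightarrow> ('h \<Rightarrow> 'h) \<Rightarrow> bool" where
  "spectral_unitary H \<Gamma> D H' \<Gamma>' D' V \<longleftrightarrow> V \<in> unitaries H H' \<and>
    (\<forall>v\<in>carrier H. \<Gamma>' (V v) = V (\<Gamma> v) \<and> D' (V v) = map_option V (D v))"

lemma spectral_unitaryD:
  assumes "spectral_unitary H \<Gamma> D H' \<Gamma>' D' V"
  shows "V \<in> unitaries H H'" "v \<in> carrier H \<Longrightarrow> V v \<in> carrier H'"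
    and "v \<in> carrier H \<Longrightarrow> \<Gamma>' (V v) = V (\<Gamma> v)"
    and "v \<in> carrier H \<Longrightarrow> D' (V v) = map_option V (D v)"
  using assms unitariesD(1)[of V H H'] by (auto simp: spectral_unitary_def)

lemma spectral_unitary_iff:
  assumes "graded_operator H \<Gamma> D" "graded_operator H' \<Gamma>' D'"
  shows "spectral_unitary H \<Gamma> D H' \<Gamma>' D' V \<longleftrightarrow> V \<in> unitaries H H' \<and>
    compose (carrier H) V \<Gamma> = compose (carrier H) \<Gamma>' V \<and> ad_unbounded H V D = D'"
proof (cases "V \<in> unitaries H H'")
  case True
  have "dom D' \<subseteq> carrier H'"
    using graded_operator.linear[OF assms(2)] by (simp add: linear_operator_def)
  then show ?thesis
    using ad_unbounded_eq_iff[OF assms[THEN graded_operator.axioms(1)] True, of D' D] True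
    by (auto simp: spectral_unitary_def compose_eq_iff)
qed (simp add: spectral_unitary_def)

context graded_operator
begin

lemma map_option_D: "(\<And>w. w \<in> carrier H \<Longrightarrow> f w = g w) \<Longrightarrow> map_option f (D v) = map_option g (D v)"
  using D_Some by (cases "D v") auto

lemma spectral_unitary_one: "spectral_unitary H \<Gamma> D H \<Gamma> D (op_one H)"
  using op_one_unitary[OF hilbert_space_axioms] map_option_D[of "op_one H" id] \<Gamma>D(1)
  by (simp add: spectral_unitary_def op_one_def option.map_id)

lemma spectral_unitary_compose:
  assumes V: "spectral_unitary H \<Gamma> D H' \<Gamma>' D' V" and W: "spectral_unitary H' \<Gamma>' D' H'' \<Gamma>'' D'' W"
  shows "spectral_unitary H \<Gamma> D H'' \<Gamma>'' D'' (compose (carrier H) W V)"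
proof -
  have "map_option W (map_option V (D v)) = map_option (compose (carrier H) W V) (D v)" for v
    using map_option_D[of "W \<circ> V" "compose (carrier H) W V" v]
    by (simp add: option.map_comp compose_def)
  then show ?thesis
    using unitaries_compose[OF spectral_unitaryD(1)[OF V] spectral_unitaryD(1)[OF W] hilbert_space_axioms]
      spectral_unitaryD(2-)[OF V] spectral_unitaryD(2-)[OF W] \<Gamma>D(1)
    by (simp add: spectral_unitary_def compose_eq)
qed

end

lemma spectral_unitary_inverse:
  assumes "graded_operator H \<Gamma> D" "graded_operator H' \<Gamma>' D'"
    and V: "spectral_unitary H \<Gamma> D H' \<Gamma>' D' V"
  shows "spectral_unitary H' \<Gamma>' D' H \<Gamma> D (unitary_inverse H V)"
proof -
  interpret H: graded_operator H \<Gamma> D by fact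
  interpret H': graded_operator H' \<Gamma>' D' by fact
  note hs = H.hilbert_space_axioms H'.hilbert_space_axioms and VD = spectral_unitaryD[OF V]
  let ?W = "unitary_inverse H V"
  have WV: "?W (V v) = v" if "v \<in> carrier H" for v using unitary_inverse_left[OF hs VD(1) that] .
  have "\<Gamma> (?W w) = ?W (\<Gamma>' w) \<and> D (?W w) = map_option ?W (D' w)" if "w \<in> carrier H'" for w
  proof -
    obtain v where v: "v \<in> carrier H" "w = V v" using unitariesD(5)[OF VD(1)] \<open>w \<in> carrier H'\<close> by blast
    have "map_option (?W \<circ> V) (D v) = map_option id (D v)" using WV by (intro H.map_option_D) simp
    then show ?thesis using v WV VD(3,4) H.\<Gamma>D(1) by (simp add: option.map_comp option.map_id)
  qed
  then show ?thesis using unitary_inverse_unitary[OF hs VD(1)] by (simp add: spectral_unitary_def)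
qed

lemma compose_unitary_inverse:
  assumes "hilbert_space H" "hilbert_space H'" "V \<in> unitaries H H'"
  shows "compose (carrier H) (unitary_inverse H V) V = op_one H"
    and "compose (carrier H') V (unitary_inverse H V) = op_one H'"
  using unitary_inverse_left[OF assms] unitary_inverse_right[OF assms(3)]
  by (auto simp: compose_def op_one_def fun_eq_iff)

lemma compose_op_one:
  "V \<in> unitaries H H' \<Longrightarrow> compose (carrier H) V (op_one H) = V"
  "V \<in> unitaries H H' \<Longrightarrow> compose (carrier H) (op_one H') V = V"
  using unitariesD(1,6)[of V H H'] by (auto simp: compose_def op_one_def fun_eq_iff extensional_def)

lemma selfadjoint_linear_operator: "selfadjoint H D \<Longrightarrow> linear_operator H D"
  by (simp add: selfadjoint_def)

section \<open>Nets of spectral triples and their category\<close>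

locale spectral_net = algebra_net a N for a :: "'k::order" and N :: "('k, 'a) alg_net" +
  fixes X :: "('k, 'a, 'h) net_triple"
  assumes net: "net_of_spectral_triples N X"
begin

abbreviation "SP \<equiv> nspace X"

lemmas net_facts = net[unfolded net_of_spectral_triples_def]
lemmas net_bundle = conjunct1[OF net_facts]
lemmas net_bundle_grading = conjunct1[OF conjunct2[OF net_facts]]
lemmas representation = conjunct1[OF conjunct2[OF conjunct2[OF net_facts]]]
lemmas operators = conjunct2[OF conjunct2[OF conjunct2[OF net_facts]]]

lemma graded: "graded_operator (SP x) (n\<Gamma> X x) (nD X x)"
proof (intro graded_operator.intro graded_operator_axioms.intro)
  show "hilbert_space (SP x)" using net_bundle unfolding hilbert_net_bundle_def by blast
  show "grading_unitary (SP x) (n\<Gamma> X x)"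
    using net_bundle_grading unfolding bundle_grading_def by blast
  show "linear_operator (SP x) (nD X x)" using operators selfadjoint_linear_operator by blast
qed

lemmas hs = graded_operator.axioms(1)[OF graded]

lemma grad: "grading_unitary (SP x) (n\<Gamma> X x)"
  using graded graded_operator.grading by blast

lemma U_unitary: "x \<le> y \<Longrightarrow> nU X y x \<in> unitaries (SP x) (SP y)"
  using net_bundle unfolding hilbert_net_bundle_def by blast

lemma U_U: "\<lbrakk>x \<le> y; y \<le> z; v \<in> carrier (SP x)\<rbrakk> \<Longrightarrow> nU X z y (nU X y x v) = nU X z x v"
  using net_bundle unfolding hilbert_net_bundle_def by (metis compose_eq)

lemma rep: "star_representation (alg N x) (SP x) (n\<pi> X x)"
  using representation by (simp add: net_representation_def graded_representation_def)

lemma rep_bounded: "t \<in> carrier (alg N x) \<Longrightarrow> n\<pi> X x t \<in> bounded_ops (SP x)"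
  using rep by (simp add: star_representation_def)

lemma rep_grading: "t \<in> carrier (alg N x) \<Longrightarrow> n\<pi> X x (agrad N x t) = ad (SP x) (n\<Gamma> X x) (n\<pi> X x t)"
  using representation by (simp add: net_representation_def graded_representation_def)

lemma rep_superderivation:
  "t \<in> carrier (alg N x) \<Longrightarrow> n\<pi> X x t \<in> superderivation_domain (SP x) (n\<Gamma> X x) (nD X x)"
  using operators by blast

lemma U_spectral:
  assumes "x \<le> y"
  shows "spectral_unitary (SP x) (n\<Gamma> X x) (nD X x) (SP y) (n\<Gamma> X y) (nD X y) (nU X y x)"
  unfolding spectral_unitary_iff[OF graded graded]
  using U_unitary[OF assms] net_bundle_grading operators assms by (simp add: bundle_grading_def)

lemma U_rep:
  assumes "x \<le> y" "t \<in> carrier (alg N x)" "v \<in> carrier (SP x)"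
  shows "n\<pi> X y (incl N y x t) (nU X y x v) = nU X y x (n\<pi> X x t v)"
proof -
  have "ad (SP x) (nU X y x) (n\<pi> X x t) = n\<pi> X y (incl N y x t)"
    using representation assms by (simp add: net_representation_def)
  then show ?thesis
    using ad_apply[OF hs hs U_unitary[OF assms(1)] assms(3), of "n\<pi> X x t"] by simp
qed

end

lemma (in algebra_net) spectral_netI: "net_of_spectral_triples N X \<Longrightarrow> spectral_net N X"
  by (simp add: spectral_net_def spectral_net_axioms_def algebra_net_axioms)

text \<open>All conditions by \<open>compose\<close>, \<open>ad\<close> and
  \<open>ad_unbounded\<close> become equations at vectors, the form in which composites, inverses
  and transports are verified below.\<close>

lemma (in algebra_net) net_triple_arrows_iff:
  assumes "net_of_spectral_triples N X" "net_of_spectral_triples N Y"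
  shows "V \<in> net_triple_arrows N X Y \<longleftrightarrow>
    (\<forall>x. spectral_unitary (nspace X x) (n\<Gamma> X x) (nD X x) (nspace Y x) (n\<Gamma> Y x) (nD Y x) (V x)) \<and>
    (\<forall>x y. x \<le> y \<longrightarrow> (\<forall>v\<in>carrier (nspace X x). V y (nU X y x v) = nU Y y x (V x v))) \<and>
    (\<forall>x. \<forall>t\<in>carrier (alg N x). \<forall>v\<in>carrier (nspace X x). n\<pi> Y x t (V x v) = V x (n\<pi> X x t v))"
proof -
  interpret X: spectral_net a N X using assms by (simp add: spectral_netI)
  interpret Y: spectral_net a N Y using assms by (simp add: spectral_netI)
  have "(ad (nspace X x) (V x) (n\<pi> X x t) = n\<pi> Y x t) \<longleftrightarrow>
      (\<forall>v\<in>carrier (nspace X x). n\<pi> Y x t (V x v) = V x (n\<pi> X x t v))"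
    if "V x \<in> unitaries (nspace X x) (nspace Y x)" "t \<in> carrier (alg N x)" for x t
    using ad_eq_iff[OF X.hs Y.hs that(1)] bounded_opsD(4)[OF Y.rep_bounded[OF that(2)]] by simp
  then show ?thesis
    unfolding net_triple_arrows_def mem_Collect_eq spectral_unitary_iff[OF X.graded Y.graded]
      compose_eq_iff by (intro iffI; simp)
qed

context algebra_net
begin

lemma net_triple_arrows_one:
  assumes "net_of_spectral_triples N X"
  shows "(\<lambda>x. op_one (nspace X x)) \<in> net_triple_arrows N X X"
proof -
  interpret X: spectral_net a N X using assms by (simp add: spectral_netI)
  have "nU X y x v \<in> carrier (nspace X y)" if "x \<le> y" "v \<in> carrier (nspace X x)" for x y v
    using unitariesD(1)[OF X.U_unitary] that by blast
  moreover have "n\<pi> X x t v \<in> carrier (nspace X x)"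
    if "t \<in> carrier (alg N x)" "v \<in> carrier (nspace X x)" for x t v
    using bounded_opsD(1)[OF X.rep_bounded] that by blast
  ultimately show ?thesis
    unfolding net_triple_arrows_iff[OF assms assms]
    using graded_operator.spectral_unitary_one[OF X.graded] by (simp add: op_one_def)
qed

lemma net_triple_arrows_compose:
  assumes X: "net_of_spectral_triples N X" and Y: "net_of_spectral_triples N Y"
    and Z: "net_of_spectral_triples N Z"
    and V: "V \<in> net_triple_arrows N X Y" and W: "W \<in> net_triple_arrows N Y Z"
  shows "(\<lambda>x. compose (carrier (nspace X x)) (W x) (V x)) \<in> net_triple_arrows N X Z"
proof -
  interpret X: spectral_net a N X using X by (simp add: spectral_netI)
  note V' = V[unfolded net_triple_arrows_iff[OF X Y]] and W' = W[unfolded net_triple_arrows_iff[OF Y Z]]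
  have Vs: "spectral_unitary (nspace X x) (n\<Gamma> X x) (nD X x) (nspace Y x) (n\<Gamma> Y x) (nD Y x) (V x)" for x
    using V' by blast
  have Ws: "spectral_unitary (nspace Y x) (n\<Gamma> Y x) (nD Y x) (nspace Z x) (n\<Gamma> Z x) (nD Z x) (W x)" for x
    using W' by blast
  have [simp]: "V x v \<in> carrier (nspace Y x)" if "v \<in> carrier (nspace X x)" for x v
    using spectral_unitaryD(2)[OF Vs that] .
  have [simp]: "nU X y x v \<in> carrier (nspace X y)" if "x \<le> y" "v \<in> carrier (nspace X x)" for x y v
    using unitariesD(1)[OF X.U_unitary] that by blast
  have [simp]: "n\<pi> X x t v \<in> carrier (nspace X x)"
    if "t \<in> carrier (alg N x)" "v \<in> carrier (nspace X x)" for x t v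
    using bounded_opsD(1)[OF X.rep_bounded] that by blast
  show ?thesis
    unfolding net_triple_arrows_iff[OF X Z]
  proof (intro conjI allI impI ballI)
    show "spectral_unitary (nspace X x) (n\<Gamma> X x) (nD X x) (nspace Z x) (n\<Gamma> Z x) (nD Z x)
        (compose (carrier (nspace X x)) (W x) (V x))" for x
      using graded_operator.spectral_unitary_compose[OF X.graded Vs Ws] .
  qed (use V' W' in \<open>simp_all add: compose_eq\<close>)
qed

lemma net_triple_arrows_inverse:
  assumes X: "net_of_spectral_triples N X" and Y: "net_of_spectral_triples N Y"
    and V: "V \<in> net_triple_arrows N X Y"
  shows "(\<lambda>x. unitary_inverse (nspace X x) (V x)) \<in> net_triple_arrows N Y X"
proof -
  interpret X: spectral_net a N X using X by (simp add: spectral_netI)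
  interpret Y: spectral_net a N Y using Y by (simp add: spectral_netI)
  note V' = V[unfolded net_triple_arrows_iff[OF X Y]]
  have Vu: "V x \<in> unitaries (nspace X x) (nspace Y x)" for x using V' spectral_unitaryD(1) by blast
  let ?W = "\<lambda>x. unitary_inverse (nspace X x) (V x)"
  have WV: "?W x (V x v) = v" if "v \<in> carrier (nspace X x)" for x v
    using unitary_inverse_left[OF X.hs Y.hs Vu that] .
  have surj: "\<exists>v\<in>carrier (nspace X x). w = V x v" if "w \<in> carrier (nspace Y x)" for x w
    using unitariesD(5)[OF Vu] that by blast
  show ?thesis
    unfolding net_triple_arrows_iff[OF Y X]
  proof (intro conjI allI impI ballI)
    show "spectral_unitary (nspace Y x) (n\<Gamma> Y x) (nD Y x) (nspace X x) (n\<Gamma> X x) (nD X x) (?W x)" for x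
      using spectral_unitary_inverse[OF X.graded Y.graded] V' by blast
    show "?W y (nU Y y x w) = nU X y x (?W x w)" if xy: "x \<le> y" and w: "w \<in> carrier (nspace Y x)" for x y w
    proof -
      obtain v where v: "v \<in> carrier (nspace X x)" "w = V x v" using surj[OF w] by blast
      then have "nU Y y x w = V y (nU X y x v)" using V' xy by simp
      then show ?thesis using v WV unitariesD(1)[OF X.U_unitary[OF xy]] by simp
    qed
    show "n\<pi> X x t (?W x w) = ?W x (n\<pi> Y x t w)"
      if t: "t \<in> carrier (alg N x)" and w: "w \<in> carrier (nspace Y x)" for x t w
    proof -
      obtain v where v: "v \<in> carrier (nspace X x)" "w = V x v" using surj[OF w] by blast
      then have "n\<pi> Y x t w = V x (n\<pi> X x t v)" using V' t by simp
      then show ?thesis using v WV bounded_opsD(1)[OF X.rep_bounded[OF t]] by simp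
    qed
  qed
qed

lemma category_ncg_nets: "category (ncg_nets N :: (('k, 'a, 'h) net_triple, _) cat_data)"
proof
  fix W X Y Z :: "('k, 'a, 'h) net_triple" and f g h
  let ?C = "ncg_nets N :: (('k, 'a, 'h) net_triple, _) cat_data"
  show "X \<in> Obj ?C \<Longrightarrow> Idt ?C X \<in> Hom ?C X X"
    using net_triple_arrows_one by (simp add: ncg_nets_def)
  show "X \<in> Obj ?C \<Longrightarrow> Y \<in> Obj ?C \<Longrightarrow> Z \<in> Obj ?C \<Longrightarrow> f \<in> Hom ?C X Y \<Longrightarrow> g \<in> Hom ?C Y Z
      \<Longrightarrow> Comp ?C X Y Z g f \<in> Hom ?C X Z"
    using net_triple_arrows_compose by (simp add: ncg_nets_def)
  have u: "f x \<in> unitaries (nspace X x) (nspace Y x)" if "f \<in> Hom ?C X Y" for f X Y x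
    using that by (simp add: ncg_nets_def net_triple_arrows_def)
  show "Comp ?C X Y Y (Idt ?C Y) f = f" "Comp ?C X X Y f (Idt ?C X) = f" if "f \<in> Hom ?C X Y"
    using compose_op_one[OF u[OF that]] by (simp_all add: ncg_nets_def)
  assume f: "f \<in> Hom ?C W X" and "g \<in> Hom ?C X Y" "h \<in> Hom ?C Y Z"
  show "Comp ?C W Y Z h (Comp ?C W X Y g f) = Comp ?C W X Z (Comp ?C X Y Z h g) f"
    using unitariesD(1)[OF u[OF f]] by (auto simp: ncg_nets_def compose_def fun_eq_iff)
qed

text \<open>The category is a groupoid, since arrows are inverted fibre by fibre. For the unit of
  the equivalence it thus suffices to give arrows and a naturality square.\<close>

lemma net_isomorphism:
  assumes X: "net_of_spectral_triples N X" and Y: "net_of_spectral_triples N Y"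
    and V: "V \<in> net_triple_arrows N X Y"
  shows "isomorphism (ncg_nets N) X Y V"
proof -
  interpret X: spectral_net a N X using X by (simp add: spectral_netI)
  interpret Y: spectral_net a N Y using Y by (simp add: spectral_netI)
  have Vu: "V x \<in> unitaries (nspace X x) (nspace Y x)" for x
    using V by (simp add: net_triple_arrows_def)
  show ?thesis
    unfolding isomorphism_def ncg_nets_def
    using V compose_unitary_inverse[OF X.hs Y.hs Vu]
    by (auto intro!: bexI[OF _ net_triple_arrows_inverse[OF assms]])
qed

end

section \<open>Equivariant spectral triples and their category\<close>

locale equivariant_triple = algebra_net a N for a :: "'k::order" and N :: "('k, 'a) alg_net" +
  fixes X :: "('k po_path set, ('k, 'a) env_term set, 'h) eq_triple"
  assumes equivariant: "equivariant_spectral_triple (fundamental_group a) (env_algebra N a)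
    (env_grading N a) (env_action N a) X"
begin

lemma graded: "graded_operator (espace X) (e\<Gamma> X) (eD X)"
  using equivariant by (auto simp: graded_operator_def graded_operator_axioms_def
      equivariant_spectral_triple_def selfadjoint_def)

lemmas hs = graded_operator.axioms(1)[OF graded]

lemma grad: "grading_unitary (espace X) (e\<Gamma> X)"
  using graded graded_operator.grading by blast

lemma u_unitary: "g \<in> carrier (fundamental_group a) \<Longrightarrow> eu X g \<in> unitaries (espace X) (espace X)"
  using equivariant by (auto simp: equivariant_spectral_triple_def hom_def unitary_group_def)

lemma u_mult:
  "\<lbrakk>g \<in> carrier (fundamental_group a); h \<in> carrier (fundamental_group a); v \<in> carrier (espace X)\<rbrakk>
    \<Longrightarrow> eu X (g \<otimes>\<^bsub>fundamental_group a\<^esub> h) v = eu X g (eu X h v)"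
  using equivariant by (simp add: equivariant_spectral_triple_def hom_def unitary_group_def compose_eq)

lemma u_spectral:
  assumes "g \<in> carrier (fundamental_group a)"
  shows "spectral_unitary (espace X) (e\<Gamma> X) (eD X) (espace X) (e\<Gamma> X) (eD X) (eu X g)"
proof -
  have "dom (eD X) \<subseteq> carrier (espace X)"
    using graded_operator.linear[OF graded] by (simp add: linear_operator_def)
  then show ?thesis
    using equivariant assms u_unitary
    by (simp add: equivariant_spectral_triple_def spectral_unitary_def compose_eq_iff
        op_left_eq_op_right_iff)
qed

lemma rep: "star_representation (env_algebra N a) (espace X) (e\<pi> X)"
  using equivariant by (simp add: equivariant_spectral_triple_def graded_representation_def)

lemma rep_bounded: "t \<in> carrier (env_algebra N a) \<Longrightarrow> e\<pi> X t \<in> bounded_ops (espace X)"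
  using rep by (simp add: star_representation_def)

lemma rep_grading:
  "t \<in> carrier (env_algebra N a) \<Longrightarrow> e\<pi> X (env_grading N a t) = ad (espace X) (e\<Gamma> X) (e\<pi> X t)"
  using equivariant by (simp add: equivariant_spectral_triple_def graded_representation_def)

lemma rep_action:
  "\<lbrakk>g \<in> carrier (fundamental_group a); t \<in> carrier (env_algebra N a); v \<in> carrier (espace X)\<rbrakk>
    \<Longrightarrow> e\<pi> X (env_action N a g t) (eu X g v) = eu X g (e\<pi> X t v)"
  using equivariant ad_apply[OF hs hs u_unitary] by (simp add: equivariant_spectral_triple_def)

lemma rep_superderivation:
  "t \<in> carrier (env_algebra N a) \<Longrightarrow> e\<pi> X t \<in> superderivation_domain (espace X) (e\<Gamma> X) (eD X)"
  using equivariant by (auto simp: equivariant_spectral_triple_def)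

end

context algebra_net
begin

abbreviation (input) "est \<equiv> equivariant_spectral_triple (fundamental_group a) (env_algebra N a)
    (env_grading N a) (env_action N a)"

abbreviation (input) "eqv_arrows \<equiv> equivariant_arrows (fundamental_group a) (env_algebra N a)"

abbreviation (input) "ncg_eqv \<equiv> ncg_equivariant (fundamental_group a) (env_algebra N a)
    (env_grading N a) (env_action N a)"

lemma equivariant_tripleI: "est X \<Longrightarrow> equivariant_triple a N X"
  by (simp add: equivariant_triple_def equivariant_triple_axioms_def algebra_net_axioms)

lemma equivariant_arrows_iff:
  assumes "est X" "est Y"
  shows "V \<in> eqv_arrows X Y \<longleftrightarrow>
    spectral_unitary (espace X) (e\<Gamma> X) (eD X) (espace Y) (e\<Gamma> Y) (eD Y) V \<and>
    (\<forall>g\<in>carrier (fundamental_group a). \<forall>v\<in>carrier (espace X). V (eu X g v) = eu Y g (V v)) \<and>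
    (\<forall>t\<in>carrier (env_algebra N a). \<forall>v\<in>carrier (espace X). e\<pi> Y t (V v) = V (e\<pi> X t v))"
proof -
  interpret X: equivariant_triple a N X using assms by (simp add: equivariant_tripleI)
  interpret Y: equivariant_triple a N Y using assms by (simp add: equivariant_tripleI)
  have "(ad (espace X) V (e\<pi> X t) = e\<pi> Y t) \<longleftrightarrow>
      (\<forall>v\<in>carrier (espace X). e\<pi> Y t (V v) = V (e\<pi> X t v))"
    if "V \<in> unitaries (espace X) (espace Y)" "t \<in> carrier (env_algebra N a)" for t
    using ad_eq_iff[OF X.hs Y.hs that(1)] bounded_opsD(4)[OF Y.rep_bounded[OF that(2)]] by simp
  then show ?thesis
    unfolding equivariant_arrows_def mem_Collect_eq spectral_unitary_iff[OF X.graded Y.graded]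
      compose_eq_iff by blast
qed

lemma equivariant_arrows_one:
  assumes "est X"
  shows "op_one (espace X) \<in> eqv_arrows X X"
proof -
  interpret X: equivariant_triple a N X using assms by (simp add: equivariant_tripleI)
  show ?thesis
    unfolding equivariant_arrows_iff[OF assms assms]
    using graded_operator.spectral_unitary_one[OF X.graded] unitariesD(1)[OF X.u_unitary]
      bounded_opsD(1)[OF X.rep_bounded] by (simp add: op_one_def)
qed

lemma equivariant_arrows_compose:
  assumes X: "est X" and Y: "est Y" and Z: "est Z" and V: "V \<in> eqv_arrows X Y" and W: "W \<in> eqv_arrows Y Z"
  shows "compose (carrier (espace X)) W V \<in> eqv_arrows X Z"
proof -
  interpret X: equivariant_triple a N X using X by (simp add: equivariant_tripleI)
  note V' = V[unfolded equivariant_arrows_iff[OF X Y]] and W' = W[unfolded equivariant_arrows_iff[OF Y Z]]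
  have "V v \<in> carrier (espace Y)" if "v \<in> carrier (espace X)" for v
    using spectral_unitaryD(2)[OF conjunct1[OF V'] that] .
  then show ?thesis
    unfolding equivariant_arrows_iff[OF X Z]
    using V' W' graded_operator.spectral_unitary_compose[OF X.graded conjunct1[OF V'] conjunct1[OF W']]
      unitariesD(1)[OF X.u_unitary] bounded_opsD(1)[OF X.rep_bounded] by (simp add: compose_eq)
qed

lemma equivariant_arrows_inverse:
  assumes X: "est X" and Y: "est Y" and V: "V \<in> eqv_arrows X Y"
  shows "unitary_inverse (espace X) V \<in> eqv_arrows Y X"
proof -
  interpret X: equivariant_triple a N X using X by (simp add: equivariant_tripleI)
  interpret Y: equivariant_triple a N Y using Y by (simp add: equivariant_tripleI)
  note V' = V[unfolded equivariant_arrows_iff[OF X Y]]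
  have Vu: "V \<in> unitaries (espace X) (espace Y)" using V' spectral_unitaryD(1) by blast
  let ?W = "unitary_inverse (espace X) V"
  have WV: "?W (V v) = v" if "v \<in> carrier (espace X)" for v
    using unitary_inverse_left[OF X.hs Y.hs Vu that] .
  have surj: "\<exists>v\<in>carrier (espace X). w = V v" if "w \<in> carrier (espace Y)" for w
    using unitariesD(5)[OF Vu] that by blast
  show ?thesis
    unfolding equivariant_arrows_iff[OF Y X]
  proof (intro conjI ballI)
    show "spectral_unitary (espace Y) (e\<Gamma> Y) (eD Y) (espace X) (e\<Gamma> X) (eD X) ?W"
      using spectral_unitary_inverse[OF X.graded Y.graded] V' by blast
    show "?W (eu Y g w) = eu X g (?W w)"
      if g: "g \<in> carrier (fundamental_group a)" and w: "w \<in> carrier (espace Y)" for g w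
    proof -
      obtain v where v: "v \<in> carrier (espace X)" "w = V v" using surj[OF w] by blast
      then have "eu Y g w = V (eu X g v)" using V' g by simp
      then show ?thesis using v WV unitariesD(1)[OF X.u_unitary[OF g]] by simp
    qed
    show "e\<pi> X t (?W w) = ?W (e\<pi> Y t w)"
      if t: "t \<in> carrier (env_algebra N a)" and w: "w \<in> carrier (espace Y)" for t w
    proof -
      obtain v where v: "v \<in> carrier (espace X)" "w = V v" using surj[OF w] by blast
      then have "e\<pi> Y t w = V (e\<pi> X t v)" using V' t by simp
      then show ?thesis using v WV bounded_opsD(1)[OF X.rep_bounded[OF t]] by simp
    qed
  qed
qed

lemma category_ncg_equivariant:
  "category (ncg_eqv :: (('k po_path set, ('k, 'a) env_term set, 'h) eq_triple, _) cat_data)"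
proof
  fix W X Y Z :: "('k po_path set, ('k, 'a) env_term set, 'h) eq_triple" and f g h
  let ?C = "ncg_eqv :: (('k po_path set, ('k, 'a) env_term set, 'h) eq_triple, _) cat_data"
  show "X \<in> Obj ?C \<Longrightarrow> Idt ?C X \<in> Hom ?C X X"
    using equivariant_arrows_one by (simp add: ncg_equivariant_def)
  show "X \<in> Obj ?C \<Longrightarrow> Y \<in> Obj ?C \<Longrightarrow> Z \<in> Obj ?C \<Longrightarrow> f \<in> Hom ?C X Y \<Longrightarrow> g \<in> Hom ?C Y Z
      \<Longrightarrow> Comp ?C X Y Z g f \<in> Hom ?C X Z"
    using equivariant_arrows_compose by (simp add: ncg_equivariant_def)
  have u: "f \<in> unitaries (espace X) (espace Y)" if "f \<in> Hom ?C X Y" for f X Y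
    using that by (simp add: ncg_equivariant_def equivariant_arrows_def)
  show "Comp ?C X Y Y (Idt ?C Y) f = f" "Comp ?C X X Y f (Idt ?C X) = f" if "f \<in> Hom ?C X Y"
    using compose_op_one[OF u[OF that]] by (simp_all add: ncg_equivariant_def)
  assume f: "f \<in> Hom ?C W X" and "g \<in> Hom ?C X Y" "h \<in> Hom ?C Y Z"
  show "Comp ?C W Y Z h (Comp ?C W X Y g f) = Comp ?C W X Z (Comp ?C X Y Z h g) f"
    using unitariesD(1)[OF u[OF f]] by (auto simp: ncg_equivariant_def compose_def fun_eq_iff)
qed

lemma equivariant_isomorphism:
  assumes X: "est X" and Y: "est Y" and V: "V \<in> eqv_arrows X Y"
  shows "isomorphism ncg_eqv X Y V"
proof -
  interpret X: equivariant_triple a N X using X by (simp add: equivariant_tripleI)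
  interpret Y: equivariant_triple a N Y using Y by (simp add: equivariant_tripleI)
  have Vu: "V \<in> unitaries (espace X) (espace Y)" using V by (simp add: equivariant_arrows_def)
  show ?thesis
    unfolding isomorphism_def ncg_equivariant_def
    using V equivariant_arrows_inverse[OF assms] compose_unitary_inverse[OF X.hs Y.hs Vu] by auto
qed

end

section \<open>Parallel transport and the fibre over the base point\<close>

definition simplex_transport :: "('k, 'a, 'h) net_triple \<Rightarrow> 'k po_simplex \<Rightarrow> 'h \<Rightarrow> 'h" where
  "simplex_transport X b = compose (carrier (nspace X (face1 b)))
    (unitary_inverse (nspace X (face0 b)) (nU X (support b) (face0 b))) (nU X (support b) (face1 b))"

text \<open>The empty list is not a path; the value \<open>id\<close> makes a single simplex yield
  \<open>simplex_transport\<close>. The restriction by \<open>compose\<close> to the fibre over the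
  source keeps transports extensional.\<close>

primrec transport :: "('k, 'a, 'h) net_triple \<Rightarrow> 'k po_path \<Rightarrow> 'h \<Rightarrow> 'h" where
  "transport X [] = id"
| "transport X (b # p) =
    compose (carrier (nspace X (path_source (b # p)))) (simplex_transport X b) (transport X p)"

context spectral_net
begin

abbreviation spectral :: "'k \<Rightarrow> 'k \<Rightarrow> ('h \<Rightarrow> 'h) \<Rightarrow> bool" where
  "spectral x y \<equiv> spectral_unitary (SP x) (n\<Gamma> X x) (nD X x) (SP y) (n\<Gamma> X y) (nD X y)"

lemma U_closed: "\<lbrakk>x \<le> y; v \<in> carrier (SP x)\<rbrakk> \<Longrightarrow> nU X y x v \<in> carrier (SP y)"
  using unitariesD(1)[OF U_unitary] .

lemma U_inj: "\<lbrakk>x \<le> y; v \<in> carrier (SP x); w \<in> carrier (SP x); nU X y x v = nU X y x w\<rbrakk> \<Longrightarrow> v = w"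
  using unitaries_inj_on[OF hs hs U_unitary] by (blast dest: inj_onD)

text \<open>The cocycle identity makes U_xx idempotent, and an injective idempotent is the
  identity.\<close>

lemma U_refl: "v \<in> carrier (SP x) \<Longrightarrow> nU X x x v = v"
  using U_U[of x x x v] U_inj[of x x "nU X x x v" v] U_closed[of x x v] by simp

lemma simplex_transport_spectral:
  assumes "is_po_simplex b"
  shows "spectral (face1 b) (face0 b) (simplex_transport X b)"
proof -
  have le: "face0 b \<le> support b" "face1 b \<le> support b" using assms by (auto simp: is_po_simplex_def)
  have "spectral (support b) (face0 b) (unitary_inverse (SP (face0 b)) (nU X (support b) (face0 b)))"
    using spectral_unitary_inverse[OF graded graded U_spectral[OF le(1)]] .
  then show ?thesis unfolding simplex_transport_def
    using graded_operator.spectral_unitary_compose[OF graded U_spectral[OF le(2)]] by blast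
qed

lemma simplex_transport_closed:
  "\<lbrakk>is_po_simplex b; v \<in> carrier (SP (face1 b))\<rbrakk> \<Longrightarrow> simplex_transport X b v \<in> carrier (SP (face0 b))"
  using spectral_unitaryD(2)[OF simplex_transport_spectral] .

text \<open>The cocycle identity replaces the support by any c above it. After mapping to the fibre
  over c, transport along b no longer depends on b but only on its faces.\<close>

lemma U_simplex_transport:
  assumes b: "is_po_simplex b" and c: "support b \<le> c" and v: "v \<in> carrier (SP (face1 b))"
  shows "nU X c (face0 b) (simplex_transport X b v) = nU X c (face1 b) v"
proof -
  have le: "face0 b \<le> support b" "face1 b \<le> support b" using b by (auto simp: is_po_simplex_def)
  have "nU X (support b) (face0 b) (simplex_transport X b v) = nU X (support b) (face1 b) v"
    using unitary_inverse_right[OF U_unitary[OF le(1)] U_closed[OF le(2) v]] v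
    by (simp add: simplex_transport_def compose_eq)
  then show ?thesis
    using U_U[OF le(1) c simplex_transport_closed[OF b v]] U_U[OF le(2) c v] by simp
qed

lemma transport_single:
  assumes "is_po_simplex b"
  shows "transport X [b] = simplex_transport X b"
  using unitariesD(6)[OF spectral_unitaryD(1)[OF simplex_transport_spectral[OF assms]]]
  by (auto simp: path_source_def compose_def extensional_def fun_eq_iff)

lemma transport_spectral: "p \<in> paths x y \<Longrightarrow> spectral x y (transport X p)"
proof (induction rule: paths_induct)
  case (singleton b)
  then show ?case using simplex_transport_spectral transport_single by metis
next
  case (Cons b p x)
  have "path_source (b # p) = x"
    using Cons.hyps paths_not_Nil[OF Cons.hyps(2)] paths_source by (auto simp: path_source_def)
  then show ?case
    using graded_operator.spectral_unitary_compose[OF graded Cons.IH simplex_transport_spectral[OF Cons.hyps(1)]]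
    by simp
qed

lemma transport_unitary: "p \<in> paths x y \<Longrightarrow> transport X p \<in> unitaries (SP x) (SP y)"
  using spectral_unitaryD(1)[OF transport_spectral] .

lemma transport_closed: "\<lbrakk>p \<in> paths x y; v \<in> carrier (SP x)\<rbrakk> \<Longrightarrow> transport X p v \<in> carrier (SP y)"
  using spectral_unitaryD(2)[OF transport_spectral] .

lemma transport_Cons:
  assumes "p \<in> paths x y" "v \<in> carrier (SP x)"
  shows "transport X (b # p) v = simplex_transport X b (transport X p v)"
proof -
  have "path_source (b # p) = x"
    using paths_not_Nil[OF assms(1)] paths_source[OF assms(1)] by (auto simp: path_source_def)
  then show ?thesis using assms(2) by (simp add: compose_eq)
qed

lemma transport_append:
  assumes "p \<in> paths y z" and q: "q \<in> paths x y" and v: "v \<in> carrier (SP x)"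
  shows "transport X (p @ q) v = transport X p (transport X q v)"
  using assms(1) q
proof (induction rule: paths_induct)
  case (singleton b)
  then show ?case using transport_Cons[OF _ v] transport_single by simp
next
  case (Cons b p y)
  then show ?case
    using transport_Cons[OF paths_append[OF Cons.hyps(2) Cons.prems] v, of b]
      transport_Cons[OF Cons.hyps(2) transport_closed[OF Cons.prems v], of b] by simp
qed

lemma transport_eqI:
  assumes "p \<in> paths x y" "q \<in> paths x y"
    and "\<And>v. v \<in> carrier (SP x) \<Longrightarrow> transport X p v = transport X q v"
  shows "transport X p = transport X q"
  using unitariesD(6)[OF transport_unitary] assms by (metis extensionalityI)

text \<open>For an elementary homotopy both sides are compared in the fibre over the common upper
  bound c, where each becomes U from \<open>face1 b\<close> to c. Injectivity of U from
  \<open>face0 b\<close> to c brings the equality back; composition is handled by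
  \<open>transport_append\<close>.\<close>

lemma transport_homotopic: "homotopic p q \<Longrightarrow> transport X p = transport X q"
proof (induction rule: homotopic.induct)
  case (elementary b b\<^sub>1 b\<^sub>2 c)
  have b2: "[b\<^sub>2] \<in> paths (face1 b\<^sub>2) (face0 b)" and b1: "[b\<^sub>1] \<in> paths (face1 b) (face1 b\<^sub>2)"
    and b: "[b] \<in> paths (face1 b) (face0 b)"
    using elementary by (simp_all add: paths_singleton)
  have "transport X ([b\<^sub>2] @ [b\<^sub>1]) = transport X [b]"
  proof (rule transport_eqI[OF paths_append[OF b2 b1] b])
    fix v assume v: "v \<in> carrier (SP (face1 b))"
    have w: "simplex_transport X b\<^sub>1 v \<in> carrier (SP (face1 b\<^sub>2))"
      using simplex_transport_closed[of b\<^sub>1 v] elementary v by simp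
    have le: "face0 b \<le> c" using elementary by (auto simp: is_po_simplex_def intro: order_trans)
    have "nU X c (face0 b) (simplex_transport X b\<^sub>2 (simplex_transport X b\<^sub>1 v))
        = nU X c (face1 b\<^sub>2) (simplex_transport X b\<^sub>1 v)"
      using U_simplex_transport[of b\<^sub>2 c "simplex_transport X b\<^sub>1 v"] w elementary by simp
    also have "\<dots> = nU X c (face1 b) v"
      using U_simplex_transport[of b\<^sub>1 c v] v elementary by simp
    also have "\<dots> = nU X c (face0 b) (simplex_transport X b v)"
      using U_simplex_transport[of b c v] v elementary by simp
    finally have "simplex_transport X b\<^sub>2 (simplex_transport X b\<^sub>1 v) = simplex_transport X b v"
      using U_inj[OF le] simplex_transport_closed[of b\<^sub>2, OF _ w] simplex_transport_closed[of b v]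
        elementary v by simp
    then show "transport X ([b\<^sub>2] @ [b\<^sub>1]) v = transport X [b] v"
      unfolding transport_append[OF b2 b1 v] using elementary by (simp only: transport_single)
  qed
  then show ?case by simp
next
  case (composition p p' q q')
  have q: "q \<in> paths (path_source q) (path_target q)"
    and p: "p \<in> paths (path_target q) (path_target p)"
    using homotopic_paths composition by (auto simp: paths_def)
  have q': "q' \<in> paths (path_source q) (path_target q)"
    and p': "p' \<in> paths (path_target q) (path_target p)"
    using homotopic_paths_iff composition p q by blast+
  show ?case
    by (rule transport_eqI[OF paths_append[OF p q] paths_append[OF p' q']])
      (simp add: transport_append[OF p q] transport_append[OF p' q'] composition)
qed auto

text \<open>The target of the arrow is its own support, so the descent from the support is the
  inverse of U_yy, the identity.\<close>

lemma transport_arrow_path: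
  assumes "x \<le> y" "v \<in> carrier (SP x)"
  shows "transport X (arrow_path y x) v = nU X y x v"
proof -
  have b: "is_po_simplex (Simplex y y x)" using assms by (simp add: is_po_simplex_def)
  then have "simplex_transport X (Simplex y y x) v \<in> carrier (SP y)"
    using simplex_transport_closed[of "Simplex y y x" v] assms by simp
  then show ?thesis
    using U_simplex_transport[OF b, of y v] assms transport_single[OF b]
    by (simp add: arrow_path_def U_refl)
qed

end

text \<open>Stars are pushed to the generators by the flag, so that operators are never
  adjoined; \<^emph>\<open>interp N X a True x\<close> is the adjoint of \<^emph>\<open>interp N X a False x\<close>.\<close>

primrec interp :: "('k::order, 'a) alg_net \<Rightarrow> ('k, 'a, 'h) net_triple \<Rightarrow> 'k \<Rightarrow> bool \<Rightarrow> ('k, 'a) env_term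
    \<Rightarrow> 'h \<Rightarrow> 'h" where
  "interp N X a s (Gen p t) = ad (nspace X (path_source p)) (transport X p)
    (n\<pi> X (path_source p) (if s then astar (alg N (path_source p)) t else t))"
| "interp N X a s Zero = (\<lambda>v\<in>carrier (nspace X a). vzero (nspace X a))"
| "interp N X a s (Add x y) =
    (\<lambda>v\<in>carrier (nspace X a). vadd (nspace X a) (interp N X a s x v) (interp N X a s y v))"
| "interp N X a s (Scale c x) =
    (\<lambda>v\<in>carrier (nspace X a). vscale (nspace X a) (if s then cnj c else c) (interp N X a s x v))"
| "interp N X a s (Mult x y) =
    (if s then compose (carrier (nspace X a)) (interp N X a s y) (interp N X a s x)
     else compose (carrier (nspace X a)) (interp N X a s x) (interp N X a s y))"
| "interp N X a s (Star x) = interp N X a (\<not> s) x"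

section \<open>Evaluation of formal terms as operators on the fibre over a\<close>

context spectral_net
begin

abbreviation "E \<equiv> interp N X a"
abbreviation "H \<equiv> nspace X a"

sublocale H: graded_operator H "n\<Gamma> X a" "nD X a"
  by (rule graded)

lemma interp_Gen:
  assumes "p \<in> paths w a" "v \<in> carrier (SP w)"
  shows "E s (Gen p t) (transport X p v)
    = transport X p (n\<pi> X w (if s then astar (alg N w) t else t) v)"
  using ad_apply[OF hs hs transport_unitary[OF assms(1)] assms(2)] paths_source[OF assms(1)] by simp

lemma interp_superderivation:
  "env_wf N a x \<Longrightarrow> E s x \<in> superderivation_domain H (n\<Gamma> X a) (nD X a)"
proof (induction x arbitrary: s)
  case (Gen p t)
  then have p: "p \<in> paths (path_source p) a" and t: "t \<in> carrier (alg N (path_source p))" by simp_all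
  note V = transport_spectral[OF p]
  have "(if s then astar (alg N (path_source p)) t else t) \<in> carrier (alg N (path_source p))"
    using t alg_closed(5) by simp
  then show ?case
    using superderivation_domain_ad[OF graded graded spectral_unitaryD(1)[OF V] _ _ rep_superderivation]
      spectral_unitaryD(3,4)[OF V] by simp
qed (auto intro: H.superderivation_domain_zero H.superderivation_domain_add
    H.superderivation_domain_scale H.superderivation_domain_compose)

lemma interp_bounded: "env_wf N a x \<Longrightarrow> E s x \<in> bounded_ops H"
  using interp_superderivation H.superderivation_domain_iff by blast

lemmas interp_closed = bounded_opsD(1)[OF interp_bounded]
lemmas interp_extensional = bounded_opsD(4)[OF interp_bounded]

lemma interp_undefined: "\<lbrakk>env_wf N a x; v \<notin> carrier H\<rbrakk> \<Longrightarrow> E s x v = undefined"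
  by (rule extensional_arb[OF interp_extensional])

lemma interp_eqI:
  assumes "env_wf N a x" "env_wf N a y" "\<And>v. v \<in> carrier H \<Longrightarrow> E s x v = E s y v"
  shows "E s x = E s y"
  using extensionalityI[OF interp_extensional interp_extensional] assms by blast

lemma interp_adjoint:
  assumes "env_wf N a x" "v \<in> carrier H" "w \<in> carrier H"
  shows "hinner H (E True x v) w = hinner H v (E False x w)"
  using assms
proof (induction x arbitrary: v w)
  case (Gen p t)
  then have p: "p \<in> paths (path_source p) a" and t: "t \<in> carrier (alg N (path_source p))" by simp_all
  let ?o = "path_source p" and ?T = "transport X p"
  note T = transport_unitary[OF p]
  obtain v' w' where v': "v' \<in> carrier (SP ?o)" "v = ?T v'" and w': "w' \<in> carrier (SP ?o)" "w = ?T w'"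
    using unitariesD(5)[OF T] Gen.prems by blast
  have "hinner (SP ?o) (n\<pi> X ?o (astar (alg N ?o) t) v') w' = hinner (SP ?o) v' (n\<pi> X ?o t w')"
    using rep[of ?o] t v' w' by (simp add: star_representation_def)
  then show ?case
    using unitariesD(4)[OF T] v' w' interp_Gen[OF p v'(1), of True t] interp_Gen[OF p w'(1), of False t]
      bounded_opsD(1)[OF rep_bounded[OF t]] bounded_opsD(1)[OF rep_bounded[OF alg_closed(5)[OF t]]]
    by (simp del: interp.simps)
next
  case Zero
  then show ?case by (simp add: H.inner_zero_left H.inner_zero_right)
next
  \<comment> \<open>Evaluating \<open>Star x\<close> exchanges the flags, so the claim is the
    induction hypothesis with the two vectors exchanged, read through conjugate symmetry.\<close>
  case (Star x)
  have "hinner H (E False x v) w = cnj (hinner H w (E False x v))"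
    using Star.prems interp_closed by (intro H.inner_cnj) auto
  also have "\<dots> = cnj (hinner H (E True x w) v)" using Star by simp
  also have "\<dots> = hinner H v (E True x w)"
    using Star.prems interp_closed by (intro H.inner_cnj[symmetric]) auto
  finally show ?case by simp
qed (auto simp: interp_closed H.inner_add H.inner_add_left H.inner_scale H.inner_scale_left compose_eq)

lemma rep_add:
  "\<lbrakk>t \<in> carrier (alg N x); t' \<in> carrier (alg N x); v \<in> carrier (SP x)\<rbrakk>
    \<Longrightarrow> n\<pi> X x (vadd (alg N x) t t') v = vadd (SP x) (n\<pi> X x t v) (n\<pi> X x t' v)"
  and rep_scale: "\<lbrakk>t \<in> carrier (alg N x); v \<in> carrier (SP x)\<rbrakk>
    \<Longrightarrow> n\<pi> X x (vscale (alg N x) c t) v = vscale (SP x) c (n\<pi> X x t v)"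
  and rep_mult: "\<lbrakk>t \<in> carrier (alg N x); t' \<in> carrier (alg N x); v \<in> carrier (SP x)\<rbrakk>
    \<Longrightarrow> n\<pi> X x (amult (alg N x) t t') v = n\<pi> X x t (n\<pi> X x t' v)"
  using rep[of x] by (simp_all add: star_representation_def compose_eq)

text \<open>This makes evaluation a function on A. The star-algebra axioms hold in the algebra of
  operators; the relations between generators use the representation property, U-equivariance and
  homotopy invariance. Both values of the flag are proved together, since the congruence for
  \<open>Star\<close> switches between them.\<close>

lemma interp_sound: "env_eq N a x y \<Longrightarrow> E s x = E s y"
proof (induction arbitrary: s rule: env_eq.induct)
  case (gen_linear p w t t' c)
  note A = star_algebra.star_add[OF alg_star_algebra] star_algebra.star_scale[OF alg_star_algebra]
  note T = unitariesD[OF transport_unitary[OF gen_linear(1)]]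
  let ?s = "\<lambda>t. if s then astar (alg N w) t else t"
  have wf: "env_wf N a (Gen p t)" "env_wf N a (Gen p t')"
    "env_wf N a (Gen p (vadd (alg N w) t (vscale (alg N w) c t')))"
    using gen_linear by (simp_all add: env_wf_Gen alg_closed del: env_wf.simps(1))
  show ?case
  proof (rule interp_eqI)
    fix u assume "u \<in> carrier H"
    then obtain v where v: "v \<in> carrier (SP w)" "u = transport X p v" using T(5) by blast
    have m: "?s t \<in> carrier (alg N w)" "?s t' \<in> carrier (alg N w)"
      using gen_linear alg_closed(5) by auto
    \<comment> \<open>With the flag set, antilinearity of the star accounts for the conjugate scalar
      in the clause of \<open>interp\<close> for \<open>Scale\<close>.\<close>
    have "?s (vadd (alg N w) t (vscale (alg N w) c t'))
        = vadd (alg N w) (?s t) (vscale (alg N w) (if s then cnj c else c) (?s t'))"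
      using gen_linear alg_closed by (simp add: A)
    then show "E s (Add (Gen p t) (Scale c (Gen p t'))) u
        = E s (Gen p (vadd (alg N w) t (vscale (alg N w) c t'))) u"
      using v m alg_closed bounded_opsD(1)[OF rep_bounded[OF m(1)]] bounded_opsD(1)[OF rep_bounded[OF m(2)]]
        complex_vector_space.scale_closed[OF hilbert_space.axioms(1)[OF hs[of w]]] T(1-3)
      by (simp add: interp_Gen[OF gen_linear(1)] rep_add rep_scale del: interp.simps(1))
  qed (use wf in simp_all)
next
  case (gen_mult p w t t')
  note T = unitariesD[OF transport_unitary[OF gen_mult(1)]]
  have wf: "env_wf N a (Gen p t)" "env_wf N a (Gen p t')" "env_wf N a (Gen p (amult (alg N w) t t'))"
    using gen_mult by (simp_all add: env_wf_Gen alg_closed del: env_wf.simps(1))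
  show ?case
  proof (rule interp_eqI)
    fix u assume "u \<in> carrier H"
    then obtain v where v: "v \<in> carrier (SP w)" "u = transport X p v" using T(5) by blast
    note t = gen_mult(2,3) alg_closed(5)[OF gen_mult(2)] alg_closed(5)[OF gen_mult(3)]
    \<comment> \<open>With the flag set, the star reverses t t', which matches the reversed order of
      factors in the clause of \<open>interp\<close> for \<open>Mult\<close>.\<close>
    show "E s (Mult (Gen p t) (Gen p t')) u = E s (Gen p (amult (alg N w) t t')) u"
      using v T(1) t t[THEN rep_bounded, THEN bounded_opsD(1)]
        star_algebra.star_mult[OF alg_star_algebra[of w]]
      by (cases s) (simp_all add: interp_Gen[OF gen_mult(1)] rep_mult compose_eq del: interp.simps(1))
  qed (use wf in simp_all)
next
  case (gen_star p w t)
  then show ?case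
    using star_algebra.star_star[OF alg_star_algebra[of w]] by (simp add: paths_source)
next
  case (gen_incl w w' p t)
  have pa: "p @ arrow_path w' w \<in> paths w a" using paths_append arrow_path_paths gen_incl by blast
  note T = unitariesD[OF transport_unitary[OF pa]]
  have star: "astar (alg N w') (incl N w' w t) = incl N w' w (astar (alg N w) t)"
    using incl_star_hom[OF gen_incl(1)] gen_incl(3) by (simp add: star_hom_def)
  let ?s = "if s then astar (alg N w) t else t"
  have m: "?s \<in> carrier (alg N w)" using gen_incl alg_closed(5) by simp
  show ?case
  proof (rule interp_eqI)
    fix u assume "u \<in> carrier H"
    then obtain v where v: "v \<in> carrier (SP w)" "u = transport X (p @ arrow_path w' w) v"
      using T(5) by blast
    have Uv: "nU X w' w v \<in> carrier (SP w')" using U_closed gen_incl(1) v(1) by blast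
    have tr: "transport X (p @ arrow_path w' w) v = transport X p (nU X w' w v)"
      if "v \<in> carrier (SP w)" for v
      using transport_append[OF gen_incl(2) arrow_path_paths[OF gen_incl(1)] that]
        transport_arrow_path[OF gen_incl(1) that] by simp
    \<comment> \<open>By \<open>tr\<close> the arrow contributes U from w to w'. Moving it past
      \<pi>(t) turns t into its image under the inclusion, which is the relation to be
      shown.\<close>
    have "E s (Gen (p @ arrow_path w' w) t) u = transport X p (nU X w' w (n\<pi> X w ?s v))"
      using interp_Gen[OF pa v(1)] v(2) tr bounded_opsD(1)[OF rep_bounded[OF m] v(1)]
      by (simp del: interp.simps)
    also have "\<dots> = transport X p (n\<pi> X w' (incl N w' w ?s) (nU X w' w v))"
      using U_rep[OF gen_incl(1) m v(1)] by simp
    also have "\<dots> = E s (Gen p (incl N w' w t)) u"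
      using interp_Gen[OF gen_incl(2) Uv] star v tr by (simp del: interp.simps)
    finally show "E s (Gen (p @ arrow_path w' w) t) u = E s (Gen p (incl N w' w t)) u" .
  qed (use pa gen_incl incl_closed in \<open>simp_all add: env_wf_Gen del: env_wf.simps(1)\<close>)
next
  case (gen_homotopic p w p' t)
  then show ?case using transport_homotopic by (simp add: paths_source)
qed (auto simp: fun_eq_iff compose_def interp_closed H.add_closed H.scale_closed H.zero_closed
    H.add_assoc H.add_commute H.add_left_commute H.zero_add interp_undefined H.add_zero H.add_neg H.scale_add_right H.scale_add_left H.scale_scale
    H.scale_one bounded_opsD(2,3)[OF interp_bounded] mult.commute)

end

text \<open>Evaluation is natural in the net, in the loop acting on the generators and in the grading;
  all three are instances of the following.\<close>

lemma (in algebra_net) interp_intertwines: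
  assumes "net_of_spectral_triples N X"
    and V: "V \<in> unitaries (nspace X a) (nspace Y a)"
    and gen: "\<And>p w t s v. \<lbrakk>p \<in> paths w a; t \<in> carrier (alg N w); v \<in> carrier (nspace X a)\<rbrakk>
      \<Longrightarrow> interp N Y a s (f p t) (V v) = V (interp N X a s (Gen p t) v)"
    and zero: "V (vzero (nspace X a)) = vzero (nspace Y a)"
    and "env_wf N a x" "v \<in> carrier (nspace X a)"
  shows "interp N Y a s (on_generators f x) (V v) = V (interp N X a s x v)"
proof -
  interpret spectral_net a N X using assms(1) by (simp add: spectral_netI)
  show ?thesis using assms(5,6)
  proof (induction x arbitrary: s v)
    case (Gen p t)
    then show ?case using gen[of p "path_source p" t v s] by (simp del: interp.simps)
  qed (use unitariesD(1-3)[OF V] zero in \<open>auto simp: compose_eq interp_closed\<close>)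
qed

section \<open>The equivariant triple on the fibre over a\<close>

lemma unitaries_zero:
  assumes "complex_vector_space H" "complex_vector_space H'" and V: "V \<in> unitaries H H'"
  shows "V (vzero H) = vzero H'"
proof -
  interpret H: complex_vector_space H by fact
  interpret H': complex_vector_space H' by fact
  have "vadd H' (V (vzero H)) (V (vzero H)) = vadd H' (V (vzero H)) (vzero H')"
    using unitariesD(1,2)[OF V, of "vzero H"] H.zero_closed H.add_zero H'.add_zero by metis
  then show ?thesis
    using H'.add_left_cancel unitariesD(1)[OF V] H.zero_closed H'.zero_closed by metis
qed

text \<open>Representatives of classes are picked by \<open>SOME\<close>; \<open>fibre_rep\<close>
  and \<open>fibre_u\<close> show that every representative gives the same operator.\<close>

definition fibre_triple :: "('k::order, 'a) alg_net \<Rightarrow> 'k \<Rightarrow> ('k, 'a, 'h) net_triple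
    \<Rightarrow> ('k po_path set, ('k, 'a) env_term set, 'h) eq_triple" where
  "fibre_triple N a X = \<lparr>espace = nspace X a, e\<Gamma> = n\<Gamma> X a, eD = nD X a,
    e\<pi> = (\<lambda>C. interp N X a False (SOME x. x \<in> C)),
    eu = (\<lambda>g. transport X (SOME p. p \<in> g))\<rparr>"

context spectral_net
begin

abbreviation "F \<equiv> fibre_triple N a X"

lemma fibre_simps [simp]:
  "espace F = H" "e\<Gamma> F = n\<Gamma> X a" "eD F = nD X a"
  by (simp_all add: fibre_triple_def)

lemma fibre_rep:
  assumes "env_wf N a x"
  shows "e\<pi> F (env_class N a x) = E False x"
proof -
  have "(SOME y. y \<in> env_class N a x) \<in> env_class N a x"
    using env_class_self[OF assms] by (rule someI)
  then have "env_eq N a x (SOME y. y \<in> env_class N a x)" unfolding mem_env_class .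
  then show ?thesis using interp_sound by (simp add: fibre_triple_def)
qed

lemma fibre_u:
  assumes "p \<in> paths a a"
  shows "eu F (homotopy_class p) = transport X p"
proof -
  have "p \<in> homotopy_class p"
    using paths_is_path[OF assms] by (simp add: mem_homotopy_class homotopic.refl)
  then have "(SOME q. q \<in> homotopy_class p) \<in> homotopy_class p" by (rule someI)
  then have "homotopic p (SOME q. q \<in> homotopy_class p)" unfolding mem_homotopy_class .
  then show ?thesis using transport_homotopic by (simp add: fibre_triple_def)
qed

lemma transport_unitaries_zero: "p \<in> paths a a \<Longrightarrow> transport X p (vzero H) = vzero H"
  using unitaries_zero[OF _ _ transport_unitary] H.complex_vector_space_axioms by blast

text \<open>On a generator this is multiplicativity of transport: conjugating by q what was
  transported along p gives what is transported along q * p. It becomes the equivariance of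
  \<pi>.\<close>

lemma interp_action:
  assumes q: "q \<in> paths a a" and x: "env_wf N a x" and v: "v \<in> carrier H"
  shows "E s (on_generators (\<lambda>p t. Gen (q @ p) t) x) (transport X q v) = transport X q (E s x v)"
proof (rule interp_intertwines[OF net transport_unitary[OF q] _ transport_unitaries_zero[OF q] x v])
  fix p w t s v
  assume p: "p \<in> paths w a" and t: "t \<in> carrier (alg N w)" and v: "v \<in> carrier H"
  note T = unitariesD[OF transport_unitary[OF p]]
  obtain v' where v': "v' \<in> carrier (SP w)" "v = transport X p v'" using T(5) v by blast
  let ?t = "if s then astar (alg N w) t else t"
  have m: "?t \<in> carrier (alg N w)" using t alg_closed(5) by simp
  have "n\<pi> X w ?t v' \<in> carrier (SP w)" using bounded_opsD(1)[OF rep_bounded[OF m] v'(1)] .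
  then show "E s (Gen (q @ p) t) (transport X q v) = transport X q (E s (Gen p t) v)"
    using interp_Gen[OF paths_append[OF q p] v'(1)] interp_Gen[OF p v'(1)] v'
      transport_append[OF q p] by (simp del: interp.simps)
qed

text \<open>Transport commutes with the gradings of the fibres, so the claim on a generator reduces
  to the graded representation over the source of p. The automorphism also commutes with the star,
  which covers the case of a set flag.\<close>

lemma interp_grading:
  assumes x: "env_wf N a x" and v: "v \<in> carrier H"
  shows "E s (on_generators (\<lambda>p t. Gen p (agrad N (path_source p) t)) x) (n\<Gamma> X a v)
    = n\<Gamma> X a (E s x v)"
proof (rule interp_intertwines[OF net H.Gamma_unitary _
      unitaries_zero[OF H.complex_vector_space_axioms H.complex_vector_space_axioms H.Gamma_unitary] x v])
  fix p w t s v
  assume p: "p \<in> paths w a" and t: "t \<in> carrier (alg N w)" and v: "v \<in> carrier H"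
  note T = unitariesD[OF transport_unitary[OF p]]
  obtain v' where v': "v' \<in> carrier (SP w)" "v = transport X p v'" using T(5) v by blast
  let ?s = "\<lambda>t. if s then astar (alg N w) t else t"
  have m: "?s t \<in> carrier (alg N w)" using t alg_closed(5) by simp
  have \<Gamma>: "n\<Gamma> X w \<in> unitaries (SP w) (SP w)" using grad[of w] by (simp add: grading_unitary_def)
  have "?s (agrad N w t) = agrad N w (?s t)"
    using agrad_star_hom[of w] t by (simp add: star_hom_def)
  then have "n\<pi> X w (?s (agrad N w t)) (n\<Gamma> X w v') = n\<Gamma> X w (n\<pi> X w (?s t) v')"
    using rep_grading[OF m] ad_apply[OF hs hs \<Gamma> v'(1)] by simp
  moreover have "n\<pi> X w (?s t) v' \<in> carrier (SP w)" using bounded_opsD(1)[OF rep_bounded[OF m] v'(1)] .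
  ultimately show "E s (Gen p (agrad N (path_source p) t)) (n\<Gamma> X a v) = n\<Gamma> X a (E s (Gen p t) v)"
    using interp_Gen[OF p unitariesD(1)[OF \<Gamma> v'(1)]] interp_Gen[OF p v'(1)] v'
      spectral_unitaryD(3)[OF transport_spectral[OF p]] paths_source[OF p] by (simp del: interp.simps)
qed

lemma fibre_hom: "eu F \<in> hom (fundamental_group a) (unitary_group H)"
proof (rule homI)
  show "eu F g \<in> carrier (unitary_group H)" if "g \<in> carrier (fundamental_group a)" for g
    using that transport_unitary by (auto simp: fundamental_group_carrier fibre_u unitary_group_def)
  fix g h assume "g \<in> carrier (fundamental_group a)" "h \<in> carrier (fundamental_group a)"
  then obtain p q where pq: "p \<in> paths a a" "q \<in> paths a a" "g = homotopy_class p" "h = homotopy_class q"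
    by (auto simp: fundamental_group_carrier)
  have "transport X (p @ q) = compose (carrier H) (transport X p) (transport X q)"
  proof (rule extensionalityI)
    show "transport X (p @ q) \<in> extensional (carrier H)"
      using unitariesD(6)[OF transport_unitary[OF paths_append[OF pq(1,2)]]] .
  qed (use transport_append[OF pq(1,2)] in \<open>simp_all add: compose_eq\<close>)
  then show "eu F (g \<otimes>\<^bsub>fundamental_group a\<^esub> h) = eu F g \<otimes>\<^bsub>unitary_group H\<^esub> eu F h"
    using pq paths_append[OF pq(1,2)]
    by (simp add: fundamental_group_mult fibre_u unitary_group_def)
qed

lemma fibre_star_representation: "star_representation (env_algebra N a) H (e\<pi> F)"
  unfolding star_representation_def
proof (intro conjI ballI allI)
  fix C assume "C \<in> carrier (env_algebra N a)"
  then obtain x where x: "env_wf N a x" "C = env_class N a x" by (auto simp: env_algebra_carrier)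
  show "e\<pi> F C \<in> bounded_ops H" using x interp_bounded by (simp add: fibre_rep)
  show "e\<pi> F (vscale (env_algebra N a) c C) v = vscale H c (e\<pi> F C v)" if "v \<in> carrier H" for c v
    using x that by (simp add: env_algebra_scale fibre_rep)
  show "hinner H (e\<pi> F (astar (env_algebra N a) C) v) w = hinner H v (e\<pi> F C w)"
    if "v \<in> carrier H" "w \<in> carrier H" for v w
    using x that interp_adjoint[OF x(1) that] by (simp add: env_algebra_star fibre_rep)
  fix C' assume "C' \<in> carrier (env_algebra N a)"
  then obtain x' where x': "env_wf N a x'" "C' = env_class N a x'" by (auto simp: env_algebra_carrier)
  show "e\<pi> F (vadd (env_algebra N a) C C') v = vadd H (e\<pi> F C v) (e\<pi> F C' v)" if "v \<in> carrier H" for v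
    using x x' that by (simp add: env_algebra_add fibre_rep)
  show "e\<pi> F (amult (env_algebra N a) C C') = compose (carrier H) (e\<pi> F C) (e\<pi> F C')"
    using x x' by (simp add: env_algebra_mult fibre_rep)
qed

lemma env_wf_action: "\<lbrakk>q \<in> paths a a; env_wf N a x\<rbrakk> \<Longrightarrow> env_wf N a (on_generators (\<lambda>p t. Gen (q @ p) t) x)"
  by (rule env_wf_on_generators) (simp_all add: env_wf_Gen[OF paths_append] del: env_wf.simps(1))

lemma env_wf_grading:
  "env_wf N a x \<Longrightarrow> env_wf N a (on_generators (\<lambda>p t. Gen p (agrad N (path_source p) t)) x)"
  by (rule env_wf_on_generators) (auto simp: env_wf_Gen paths_source agrad_closed simp del: env_wf.simps(1))

lemma fibre_equivariant: "est F"
  unfolding equivariant_spectral_triple_def fibre_simps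
proof (intro conjI ballI)
  show "hilbert_space H" by (rule hs)
  show "grading_unitary H (n\<Gamma> X a)" by (rule grad)
  show "eu F \<in> hom (fundamental_group a) (unitary_group H)" by (rule fibre_hom)
  show "selfadjoint H (nD X a)" "odd_operator H (n\<Gamma> X a) (nD X a)" "theta_summable H (nD X a)"
    using operators by blast+
  have dom: "dom (nD X a) \<subseteq> carrier H" using H.linear by (simp add: linear_operator_def)
  fix g assume "g \<in> carrier (fundamental_group a)"
  then obtain p where p: "p \<in> paths a a" "g = homotopy_class p" by (auto simp: fundamental_group_carrier)
  note T = spectral_unitaryD[OF transport_spectral[OF p(1)]]
  show "compose (carrier H) (eu F g) (n\<Gamma> X a) = compose (carrier H) (n\<Gamma> X a) (eu F g)"
    using p T(3) by (simp add: fibre_u compose_eq_iff)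
  show "op_left (eu F g) (nD X a) = op_right H (nD X a) (eu F g)"
    using p T(4) dom by (simp add: fibre_u op_left_eq_op_right_iff)
  fix C assume "C \<in> carrier (env_algebra N a)"
  then obtain x where x: "env_wf N a x" "C = env_class N a x" by (auto simp: env_algebra_carrier)
  have "ad H (transport X p) (E False x) = E False (on_generators (\<lambda>p' t. Gen (p @ p') t) x)"
    using ad_eq_iff[OF hs hs T(1) interp_extensional[OF env_wf_action[OF p(1) x(1)]]]
      interp_action[OF p(1) x(1)] by simp
  then show "e\<pi> F (env_action N a g C) = ad H (eu F g) (e\<pi> F C)"
    using p x env_wf_action[OF p(1) x(1)] by (simp add: env_action_class fibre_rep fibre_u)
next
  have "e\<pi> F (env_grading N a C) = ad H (n\<Gamma> X a) (e\<pi> F C)" if C: "C \<in> carrier (env_algebra N a)" for C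
  proof -
    obtain x where x: "env_wf N a x" "C = env_class N a x" using C by (auto simp: env_algebra_carrier)
    have "ad H (n\<Gamma> X a) (E False x) = E False (on_generators (\<lambda>p t. Gen p (agrad N (path_source p) t)) x)"
      using ad_eq_iff[OF hs hs H.Gamma_unitary interp_extensional[OF env_wf_grading[OF x(1)]]]
        interp_grading[OF x(1)] by simp
    then show ?thesis using x env_wf_grading[OF x(1)] by (simp add: env_grading_class fibre_rep)
  qed
  then show "graded_representation (env_algebra N a) (env_grading N a) H (n\<Gamma> X a) (e\<pi> F)"
    using fibre_star_representation by (simp add: graded_representation_def)
  show "e\<pi> F ` carrier (env_algebra N a) \<subseteq> superderivation_domain H (n\<Gamma> X a) (nD X a)"
    using interp_superderivation by (auto simp: env_algebra_carrier fibre_rep)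
qed

end

section \<open>Naturality in the net: the fibre functor on arrows\<close>

context algebra_net
begin

text \<open>For one simplex both sides are pushed into the fibre over its support, where commutation
  with U applies, and compared by injectivity. The result gives equivariance of V over a for loops,
  and naturality of the unit for the frame paths.\<close>

lemma transport_natural:
  assumes X: "net_of_spectral_triples N X" and Y: "net_of_spectral_triples N Y"
    and V: "V \<in> net_triple_arrows N X Y" and "p \<in> paths x y" "v \<in> carrier (nspace X x)"
  shows "V y (transport X p v) = transport Y p (V x v)"
proof -
  interpret X: spectral_net a N X using X by (simp add: spectral_netI)
  interpret Y: spectral_net a N Y using Y by (simp add: spectral_netI)
  note V' = V[unfolded net_triple_arrows_iff[OF X Y]]
  have Vc: "V x v \<in> carrier (nspace Y x)" if "v \<in> carrier (nspace X x)" for x v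
    using spectral_unitaryD(2)[OF conjunct1[OF V', rule_format] that] .
  have VU: "V y (nU X y x v) = nU Y y x (V x v)" if "x \<le> y" "v \<in> carrier (nspace X x)" for x y v
    using V' that by blast
  have single: "V (face0 b) (simplex_transport X b v) = simplex_transport Y b (V (face1 b) v)"
    if b: "is_po_simplex b" and v: "v \<in> carrier (nspace X (face1 b))" for b v
  proof -
    have le: "face0 b \<le> support b" "face1 b \<le> support b" using b by (auto simp: is_po_simplex_def)
    note Xc = X.simplex_transport_closed[OF b v]
    have "nU Y (support b) (face0 b) (V (face0 b) (simplex_transport X b v))
        = V (support b) (nU X (support b) (face1 b) v)"
      using VU[OF le(1) Xc] X.U_simplex_transport[OF b order_refl v] by simp
    also have "\<dots> = nU Y (support b) (face0 b) (simplex_transport Y b (V (face1 b) v))"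
      using VU[OF le(2) v] Y.U_simplex_transport[OF b order_refl Vc[OF v]] by simp
    finally show ?thesis
      using Y.U_inj[OF le(1) Vc[OF Xc] Y.simplex_transport_closed[OF b Vc[OF v]]] by simp
  qed
  show ?thesis using assms(4,5)
  proof (induction rule: paths_induct)
    case (singleton b)
    then show ?case using single X.transport_single Y.transport_single by simp
  next
    case (Cons b p x)
    then show ?case
      using single[OF Cons.hyps(1) X.transport_closed[OF Cons.hyps(2) Cons.prems]]
        X.transport_Cons[OF Cons.hyps(2) Cons.prems] Y.transport_Cons[OF Cons.hyps(2) Vc[OF Cons.prems]]
      by (simp del: transport.simps)
  qed
qed

lemma on_generators_Gen [simp]: "on_generators Gen x = x"
  by (induction x) auto

lemma interp_natural:
  assumes X: "net_of_spectral_triples N X" and Y: "net_of_spectral_triples N Y"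
    and V: "V \<in> net_triple_arrows N X Y" and x: "env_wf N a x" and v: "v \<in> carrier (nspace X a)"
  shows "interp N Y a s x (V a v) = V a (interp N X a s x v)"
proof -
  interpret X: spectral_net a N X using X by (simp add: spectral_netI)
  interpret Y: spectral_net a N Y using Y by (simp add: spectral_netI)
  note V' = V[unfolded net_triple_arrows_iff[OF X Y]]
  have Vc: "V x v \<in> carrier (nspace Y x)" if "v \<in> carrier (nspace X x)" for x v
    using spectral_unitaryD(2)[OF conjunct1[OF V', rule_format] that] .
  have Va: "V a \<in> unitaries (nspace X a) (nspace Y a)" using V by (simp add: net_triple_arrows_def)
  \<comment> \<open>The trivial substitution \<open>Gen\<close> brings the claim into the shape of
    \<open>interp_intertwines\<close>.\<close>
  have "interp N Y a s (on_generators Gen x) (V a v) = V a (interp N X a s x v)"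
  proof (rule interp_intertwines[OF X Va _
        unitaries_zero[OF X.H.complex_vector_space_axioms Y.H.complex_vector_space_axioms Va] x v])
    fix p w t s v
    assume p: "p \<in> paths w a" and t: "t \<in> carrier (alg N w)" and v: "v \<in> carrier (nspace X a)"
    obtain v' where v': "v' \<in> carrier (nspace X w)" "v = transport X p v'"
      using unitariesD(5)[OF X.transport_unitary[OF p]] v by blast
    let ?t = "if s then astar (alg N w) t else t"
    have m: "?t \<in> carrier (alg N w)" using t alg_closed(5) by simp
    have "n\<pi> Y w ?t (V w v') = V w (n\<pi> X w ?t v')" using V' m v' by blast
    then show "interp N Y a s (Gen p t) (V a v) = V a (interp N X a s (Gen p t) v)"
      using X.interp_Gen[OF p v'(1)] Y.interp_Gen[OF p Vc[OF v'(1)]] v'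
        transport_natural[OF X Y V p] bounded_opsD(1)[OF X.rep_bounded[OF m] v'(1)]
      by (simp del: interp.simps)
  qed
  then show ?thesis by simp
qed

lemma fibre_arrow:
  assumes X: "net_of_spectral_triples N X" and Y: "net_of_spectral_triples N Y"
    and V: "V \<in> net_triple_arrows N X Y"
  shows "V a \<in> eqv_arrows (fibre_triple N a X) (fibre_triple N a Y)"
proof -
  interpret X: spectral_net a N X using X by (simp add: spectral_netI)
  interpret Y: spectral_net a N Y using Y by (simp add: spectral_netI)
  have "spectral_unitary (nspace X a) (n\<Gamma> X a) (nD X a) (nspace Y a) (n\<Gamma> Y a) (nD Y a) (V a)"
    using V[unfolded net_triple_arrows_iff[OF X Y]] by blast
  then show ?thesis
    unfolding equivariant_arrows_iff[OF X.fibre_equivariant Y.fibre_equivariant]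
    using transport_natural[OF X Y V] interp_natural[OF X Y V]
    by (auto simp: fundamental_group_carrier env_algebra_carrier X.fibre_u Y.fibre_u
        X.fibre_rep Y.fibre_rep)
qed

end

section \<open>The net induced by an equivariant spectral triple\<close>

context algebra_net
begin

lemma env_wf_frame: "t \<in> carrier (alg N x) \<Longrightarrow> env_wf N a (Gen (frame a x) t)"
  by (simp add: env_wf_Gen[OF frame_paths] del: env_wf.simps(1))

text \<open>The presentation has one linearity relation, with a scalar on the second summand;
  additivity is the case of scalar 1.\<close>

lemma env_eq_gen_add:
  assumes "p \<in> paths w a" "t \<in> carrier (alg N w)" "t' \<in> carrier (alg N w)"
  shows "env_eq N a (Add (Gen p t) (Gen p t')) (Gen p (vadd (alg N w) t t'))"
proof -
  have wf: "env_wf N a (Gen p t)" "env_wf N a (Gen p t')"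
    using assms by (simp_all add: env_wf_Gen del: env_wf.simps(1))
  have "env_eq N a (Add (Gen p t) (Gen p t')) (Add (Gen p t) (Scale 1 (Gen p t')))"
    by (rule env_eq.cong_Add[OF env_eq.refl[OF wf(1)] env_eq.sym[OF env_eq.scale_one[OF wf(2)]]])
  then show ?thesis
    using env_eq.trans[OF _ env_eq.gen_linear[OF assms, of 1]] assms(3)
      complex_vector_space.scale_one[OF star_algebra.axioms(1)[OF alg_star_algebra[of w]]] by simp
qed

text \<open>With t = t' = 0 and scalar -1, the left side of the linearity relation is
  \<open>Zero\<close> by the axiom of negatives and the right side is the generator itself.\<close>

lemma env_eq_gen_zero:
  assumes "p \<in> paths w a"
  shows "env_eq N a (Gen p (vzero (alg N w))) Zero"
proof -
  let ?z = "vzero (alg N w)"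
  have z: "?z \<in> carrier (alg N w)" by (rule alg_closed)
  then have wf: "env_wf N a (Gen p ?z)" using assms by (simp add: env_wf_Gen del: env_wf.simps(1))
  have "env_eq N a (Add (Gen p ?z) (Scale (- 1) (Gen p ?z))) (Gen p ?z)"
    using env_eq.gen_linear[OF assms z z, of "- 1"]
      complex_vector_space.add_neg[OF star_algebra.axioms(1)[OF alg_star_algebra[of w]] z] by simp
  then show ?thesis using env_eq.trans[OF env_eq.sym env_eq.add_neg[OF wf]] by blast
qed

text \<open>The linearity relation with first entry 0, whose generator has just been identified with
  \<open>Zero\<close>.\<close>

lemma env_eq_gen_scale:
  assumes p: "p \<in> paths w a" and t: "t \<in> carrier (alg N w)"
  shows "env_eq N a (Scale c (Gen p t)) (Gen p (vscale (alg N w) c t))"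
proof -
  let ?z = "vzero (alg N w)" and ?x = "Scale c (Gen p t)"
  have z: "?z \<in> carrier (alg N w)" by (rule alg_closed)
  have x: "env_wf N a ?x" using p t by (simp add: env_wf_Gen del: env_wf.simps(1))
  have "env_eq N a (Add (Gen p ?z) ?x) (Add Zero ?x)"
    using env_eq.cong_Add[OF env_eq_gen_zero[OF p] env_eq.refl[OF x]] .
  then have "env_eq N a (Add (Gen p ?z) ?x) ?x"
    using env_eq.trans[OF _ env_eq.trans[OF env_eq.add_commute env_eq.add_zero[OF x]]] x by simp
  moreover have "env_eq N a (Add (Gen p ?z) ?x) (Gen p (vscale (alg N w) c t))"
    using env_eq.gen_linear[OF p z t, of c] alg_closed(2)[OF t]
      complex_vector_space.zero_add[OF star_algebra.axioms(1)[OF alg_star_algebra[of w]]] by simp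
  ultimately show ?thesis using env_eq.trans[OF env_eq.sym] by blast
qed

end

definition induced_net :: "('k::order, 'a) alg_net \<Rightarrow> 'k
    \<Rightarrow> ('k po_path set, ('k, 'a) env_term set, 'h) eq_triple \<Rightarrow> ('k, 'a, 'h) net_triple" where
  "induced_net N a X = \<lparr>nspace = (\<lambda>x. espace X),
    nU = (\<lambda>y x. eu X (homotopy_class (frame_loop a (arrow_path y x)))),
    n\<Gamma> = (\<lambda>x. e\<Gamma> X), nD = (\<lambda>x. eD X),
    n\<pi> = (\<lambda>x t. e\<pi> X (env_class N a (Gen (frame a x) t)))\<rparr>"

section \<open>The induced net is a net of spectral triples\<close>

context equivariant_triple
begin

abbreviation "H \<equiv> espace X"

sublocale H: graded_operator H "e\<Gamma> X" "eD X"
  by (rule graded)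

abbreviation "u p \<equiv> eu X (homotopy_class p)"
abbreviation "\<pi> x \<equiv> e\<pi> X (env_class N a x)"
abbreviation "G \<equiv> induced_net N a X"

lemma induced_simps [simp]:
  "nspace G x = H" "n\<Gamma> G x = e\<Gamma> X" "nD G x = eD X"
  "nU G y x = u (frame_loop a (arrow_path y x))" "n\<pi> G x t = \<pi> (Gen (frame a x) t)"
  by (simp_all add: induced_net_def)

lemma class_carrier: "p \<in> paths a a \<Longrightarrow> homotopy_class p \<in> carrier (fundamental_group a)"
  by (auto simp: fundamental_group_carrier)

lemma u_closed: "\<lbrakk>p \<in> paths a a; v \<in> carrier H\<rbrakk> \<Longrightarrow> u p v \<in> carrier H"
  using unitariesD(1)[OF u_unitary[OF class_carrier]] .

lemma u_append:
  "\<lbrakk>p \<in> paths a a; q \<in> paths a a; v \<in> carrier H\<rbrakk> \<Longrightarrow> u (p @ q) v = u p (u q v)"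
  using u_mult[OF class_carrier class_carrier] by (simp add: fundamental_group_mult)

lemma u_frame_loop_append:
  assumes "p \<in> paths y z" "q \<in> paths x y" "v \<in> carrier H"
  shows "u (frame_loop a (p @ q)) v = u (frame_loop a p) (u (frame_loop a q) v)"
  using u_append[OF frame_loop_paths[OF assms(1)] frame_loop_paths[OF assms(2)] assms(3)]
    homotopy_class_eqI[OF frame_loop_append[OF assms(1,2)]] by simp

lemma env_class_carrier: "env_wf N a x \<Longrightarrow> env_class N a x \<in> carrier (env_algebra N a)"
  by (auto simp: env_algebra_carrier)

lemma \<pi>_add: "\<lbrakk>env_wf N a x; env_wf N a y; v \<in> carrier H\<rbrakk> \<Longrightarrow> \<pi> (Add x y) v = vadd H (\<pi> x v) (\<pi> y v)"
  and \<pi>_scale: "\<lbrakk>env_wf N a x; v \<in> carrier H\<rbrakk> \<Longrightarrow> \<pi> (Scale c x) v = vscale H c (\<pi> x v)"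
  and \<pi>_mult: "\<lbrakk>env_wf N a x; env_wf N a y\<rbrakk> \<Longrightarrow> \<pi> (Mult x y) = compose (carrier H) (\<pi> x) (\<pi> y)"
  and \<pi>_star: "\<lbrakk>env_wf N a x; v \<in> carrier H; w \<in> carrier H\<rbrakk>
    \<Longrightarrow> hinner H (\<pi> (Star x) v) w = hinner H v (\<pi> x w)"
  using rep unfolding star_representation_def
  by (metis env_class_carrier env_algebra_add env_algebra_scale env_algebra_mult env_algebra_star)+

lemma \<pi>_bounded: "env_wf N a x \<Longrightarrow> \<pi> x \<in> bounded_ops H"
  using rep_bounded[OF env_class_carrier] .

lemma \<pi>_cong: "env_eq N a x y \<Longrightarrow> \<pi> x = \<pi> y"
  by (simp add: env_class_eq)

text \<open>Stated for any z with z + z = z so as to serve both \<open>Zero\<close> and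
  \<open>Star Zero\<close>; the presentation has no rule that equates these two directly.\<close>

lemma \<pi>_zero:
  assumes "env_wf N a z" "env_eq N a (Add z z) z" "v \<in> carrier H"
  shows "\<pi> z v = vzero H"
proof -
  have "\<pi> z v \<in> carrier H" using bounded_opsD(1)[OF \<pi>_bounded[OF assms(1)] assms(3)] .
  moreover have "vadd H (\<pi> z v) (\<pi> z v) = vadd H (\<pi> z v) (vzero H)"
    using \<pi>_add[OF assms(1,1,3)] \<pi>_cong[OF assms(2)] calculation by (simp add: H.add_zero)
  ultimately show ?thesis using H.add_left_cancel H.zero_closed by blast
qed

lemma u_\<pi>_Gen:
  assumes q: "q \<in> paths a a" and p: "p \<in> paths w a" and t: "t \<in> carrier (alg N w)" and v: "v \<in> carrier H"
  shows "\<pi> (Gen (q @ p) t) (u q v) = u q (\<pi> (Gen p t) v)"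
proof -
  have "env_wf N a (Gen p t)" using p t by (simp add: env_wf_Gen del: env_wf.simps(1))
  then show ?thesis
    using rep_action[OF class_carrier[OF q] env_class_carrier v, of "Gen p t"]
    by (simp add: env_action_Gen[OF q p t])
qed

text \<open>The operators \<Gamma> and D are constant and U is built from u, which commutes with
  both. What remains is algebra: homotopies of arrows give the cocycle identity, and relations
  between generators on frame paths give the representations.\<close>

lemma induced_net_triple: "net_of_spectral_triples N G"
proof -
  note wf = env_wf_frame
  have U: "u (frame_loop a (arrow_path y x)) \<in> unitaries H H" if "x \<le> y" for x y
    using u_unitary[OF class_carrier[OF frame_loop_paths[OF arrow_path_paths[OF that]]]] .
  have Us: "spectral_unitary H (e\<Gamma> X) (eD X) H (e\<Gamma> X) (eD X) (u (frame_loop a (arrow_path y x)))"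
    if "x \<le> y" for x y
    using u_spectral[OF class_carrier[OF frame_loop_paths[OF arrow_path_paths[OF that]]]] .
  have U_U: "u (frame_loop a (arrow_path z x)) =
      compose (carrier H) (u (frame_loop a (arrow_path z y))) (u (frame_loop a (arrow_path y x)))"
    if xy: "x \<le> y" and yz: "y \<le> z" for x y z
  proof (rule extensionalityI)
    show "u (frame_loop a (arrow_path z x)) \<in> extensional (carrier H)"
      using unitariesD(6)[OF U[OF order_trans[OF xy yz]]] .
    fix v assume v: "v \<in> carrier H"
    show "u (frame_loop a (arrow_path z x)) v =
      compose (carrier H) (u (frame_loop a (arrow_path z y))) (u (frame_loop a (arrow_path y x))) v"
      using u_frame_loop_append[OF arrow_path_paths[OF yz] arrow_path_paths[OF xy] v] v
        homotopy_class_eqI[OF frame_loop_homotopic[OF homotopic_arrow_arrow[OF xy yz]]]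
      by (simp add: compose_eq)
  qed simp
  have star: "star_representation (alg N x) H (\<lambda>t. \<pi> (Gen (frame a x) t))" for x
    unfolding star_representation_def
  proof (intro conjI ballI allI)
    fix t assume t: "t \<in> carrier (alg N x)"
    show "\<pi> (Gen (frame a x) t) \<in> bounded_ops H" using \<pi>_bounded[OF wf[OF t]] .
    show "\<pi> (Gen (frame a x) (vscale (alg N x) c t)) v = vscale H c (\<pi> (Gen (frame a x) t) v)"
      if "v \<in> carrier H" for c v
      using \<pi>_cong[OF env_eq_gen_scale[OF frame_paths t]] \<pi>_scale[OF wf[OF t] that] by metis
    show "hinner H (\<pi> (Gen (frame a x) (astar (alg N x) t)) v) w = hinner H v (\<pi> (Gen (frame a x) t) w)"
      if "v \<in> carrier H" "w \<in> carrier H" for v w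
      using \<pi>_cong[OF env_eq.gen_star[OF frame_paths t]] \<pi>_star[OF wf[OF t] that] by metis
    fix t' assume t': "t' \<in> carrier (alg N x)"
    show "\<pi> (Gen (frame a x) (vadd (alg N x) t t')) v
        = vadd H (\<pi> (Gen (frame a x) t) v) (\<pi> (Gen (frame a x) t') v)" if "v \<in> carrier H" for v
      using \<pi>_cong[OF env_eq_gen_add[OF frame_paths t t']] \<pi>_add[OF wf[OF t] wf[OF t'] that] by metis
    show "\<pi> (Gen (frame a x) (amult (alg N x) t t'))
        = compose (carrier H) (\<pi> (Gen (frame a x) t)) (\<pi> (Gen (frame a x) t'))"
      using \<pi>_cong[OF env_eq.gen_mult[OF frame_paths t t']] \<pi>_mult[OF wf[OF t] wf[OF t']] by metis
  qed
  have grad\<pi>: "\<pi> (Gen (frame a x) (agrad N x t)) = ad H (e\<Gamma> X) (\<pi> (Gen (frame a x) t))"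
    if t: "t \<in> carrier (alg N x)" for x t
    using rep_grading[OF env_class_carrier[OF wf[OF t]]] by (simp add: env_grading_Gen[OF frame_paths t])
  have U\<pi>: "ad H (u (frame_loop a (arrow_path y x))) (\<pi> (Gen (frame a x) t))
      = \<pi> (Gen (frame a y) (incl N y x t))" if xy: "x \<le> y" and t: "t \<in> carrier (alg N x)" for x y t
  proof -
    note L = frame_loop_paths[OF arrow_path_paths[OF xy]]
    \<comment> \<open>The loop translates (\<open>frame a x\<close>, t) to a generator whose path is
      homotopic to the arrow followed by \<open>frame a y\<close>; the inclusion relation then
      absorbs the arrow.\<close>
    have "env_eq N a (Gen (frame_loop a (arrow_path y x) @ frame a x) t) (Gen (frame a y @ arrow_path y x) t)"
      using env_eq.gen_homotopic[OF paths_append[OF L frame_paths]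
          paths_append[OF frame_paths arrow_path_paths[OF xy]] _ t]
        frame_loop_frame[OF arrow_path_paths[OF xy]] by blast
    then have "\<pi> (Gen (frame_loop a (arrow_path y x) @ frame a x) t) = \<pi> (Gen (frame a y) (incl N y x t))"
      using \<pi>_cong[OF env_eq.trans[OF _ env_eq.gen_incl[OF xy frame_paths t]]] by blast
    then show ?thesis
      using ad_eq_iff[OF hs hs U[OF xy] bounded_opsD(4)[OF \<pi>_bounded[OF wf[OF incl_closed[OF xy t]]]]]
        u_\<pi>_Gen[OF L frame_paths t] by simp
  qed
  show ?thesis
    unfolding net_of_spectral_triples_def
  proof (intro conjI allI impI)
    show "hilbert_net_bundle (nspace G) (nU G)"
      unfolding hilbert_net_bundle_def induced_simps using hs U U_U by blast
    show "bundle_grading (nspace G) (nU G) (n\<Gamma> G)"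
      unfolding bundle_grading_def induced_simps compose_eq_iff
      using grad spectral_unitaryD(3)[OF Us] by blast
    show "net_representation N (nspace G) (nU G) (n\<Gamma> G) (n\<pi> G)"
      unfolding net_representation_def graded_representation_def induced_simps
      using star grad\<pi> U\<pi> by (simp add: induced_net_def)
    show "selfadjoint (nspace G x) (nD G x)" "odd_operator (nspace G x) (n\<Gamma> G x) (nD G x)"
      "theta_summable (nspace G x) (nD G x)" for x
      using equivariant by (simp_all add: equivariant_spectral_triple_def)
    show "n\<pi> G x ` carrier (alg N x) \<subseteq> superderivation_domain (nspace G x) (n\<Gamma> G x) (nD G x)" for x
      using rep_superderivation[OF env_class_carrier[OF wf]] by auto
    show "ad_unbounded (nspace G x) (nU G y x) (nD G x) = nD G y" if "x \<le> y" for x y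
      using Us[OF that] unfolding spectral_unitary_iff[OF graded graded] by simp
  qed
qed

sublocale G: spectral_net a N G
  by (rule spectral_net.intro) (auto intro: algebra_net_axioms spectral_net_axioms.intro induced_net_triple)

text \<open>Both vectors have the same image in the fibre over the support: one by the defining
  property of transport, the other by \<open>homotopic_arrow_simplex\<close>. The map into that
  fibre is injective.\<close>

lemma induced_simplex_transport:
  assumes b: "is_po_simplex b" and v: "v \<in> carrier H"
  shows "simplex_transport G b v = u (frame_loop a [b]) v"
proof -
  have le: "face0 b \<le> support b" "face1 b \<le> support b" using b by (auto simp: is_po_simplex_def)
  have bp: "[b] \<in> paths (face1 b) (face0 b)" using b by (simp add: paths_singleton)
  have "u (frame_loop a (arrow_path (support b) (face0 b))) (u (frame_loop a [b]) v)
      = u (frame_loop a (arrow_path (support b) (face1 b))) v"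
    using u_frame_loop_append[OF arrow_path_paths[OF le(1)] bp v]
      homotopy_class_eqI[OF frame_loop_homotopic[OF homotopic_arrow_simplex[OF b]]] by simp
  then show ?thesis
    using G.U_simplex_transport[OF b order_refl, of v] v
      G.U_inj[OF le(1), of "simplex_transport G b v" "u (frame_loop a [b]) v"]
      G.simplex_transport_closed[OF b, of v] u_closed[OF frame_loop_paths[OF bp]]
    by simp
qed

lemma induced_transport:
  assumes "p \<in> paths x y" "v \<in> carrier H"
  shows "transport G p v = u (frame_loop a p) v"
  using assms
proof (induction rule: paths_induct)
  case (singleton b)
  then show ?case by (simp only: G.transport_single induced_simplex_transport)
next
  case (Cons b p x)
  have bp: "[b] \<in> paths (face1 b) (face0 b)" using Cons.hyps by (simp add: paths_singleton)
  show ?case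
    using G.transport_Cons[OF Cons.hyps(2), of v b] Cons u_closed[OF frame_loop_paths[OF Cons.hyps(2)]]
      u_frame_loop_append[OF bp Cons.hyps(2) Cons.prems] induced_simplex_transport
    by (simp del: transport.simps)
qed

text \<open>Evaluation in the induced net returns the given \<pi>, so no information on A is lost by
  keeping only generators on frame paths. With the flag set the value is that of the formal
  star.\<close>

lemma induced_interp:
  assumes "env_wf N a x" "v \<in> carrier H"
  shows "interp N G a s x v = \<pi> (if s then Star x else x) v"
  using assms
proof (induction x arbitrary: s v)
  case (Gen p t)
  let ?w = "path_source p"
  have p: "p \<in> paths ?w a" and t: "t \<in> carrier (alg N ?w)" using Gen by simp_all
  let ?t = "if s then astar (alg N ?w) t else t"
  have m: "?t \<in> carrier (alg N ?w)" using t alg_closed(5) by simp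
  note L = frame_loop_paths[OF p]
  obtain v' where v': "v' \<in> carrier H" "v = transport G p v'"
    using unitariesD(5)[OF G.transport_unitary[OF p]] Gen.prems by auto
  have m': "\<pi> (Gen (frame a ?w) ?t) v' \<in> carrier H"
    using bounded_opsD(1)[OF G.rep_bounded[OF m], of v'] v'(1) by simp
  have "interp N G a s (Gen p t) v = u (frame_loop a p) (\<pi> (Gen (frame a ?w) ?t) v')"
    using G.interp_Gen[OF p, of v' s t] v' induced_transport[OF p m']
    by (simp del: interp.simps)
  \<comment> \<open>Equivariance of \<pi> turns conjugation by the loop into translation of the
    generator.\<close>
  also have "\<dots> = \<pi> (Gen (frame_loop a p @ frame a ?w) ?t) v"
    using u_\<pi>_Gen[OF L frame_paths m v'(1)] v' induced_transport[OF p] by simp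
  \<comment> \<open>As p ends at the base point, the loop after the frame is homotopic to p.\<close>
  also have "\<dots> = \<pi> (Gen p ?t) v"
    using \<pi>_cong[OF env_eq.gen_homotopic[OF paths_append[OF L frame_paths] p frame_loop_frame_base[OF p] m]]
    by simp
  also have "\<dots> = \<pi> (if s then Star (Gen p t) else Gen p t) v"
    using \<pi>_cong[OF env_eq.gen_star[OF p t]] by simp
  finally show ?case .
next
  case Zero
  \<comment> \<open>Additivity of the star, read backwards, and Zero + Zero = Zero supply the
    hypothesis of \<open>\<pi>_zero\<close> for \<open>Star Zero\<close>.\<close>
  have "env_eq N a (Add (Star Zero) (Star Zero)) (Star Zero)"
    using env_eq.trans[OF env_eq.sym[OF env_eq.star_add] env_eq.cong_Star[OF env_eq.add_zero], of N a Zero]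
    by simp
  then show ?case using \<pi>_zero[of Zero v] \<pi>_zero[of "Star Zero" v] env_eq.add_zero[of N a Zero] Zero by simp
next
  case (Add x y)
  then show ?case
    using \<pi>_cong[OF env_eq.star_add, of x y] \<pi>_add[of x y v] \<pi>_add[of "Star x" "Star y" v] by simp
next
  case (Scale c x)
  then show ?case
    using \<pi>_cong[OF env_eq.star_scale, of x c] \<pi>_scale[of x v c] \<pi>_scale[of "Star x" v "cnj c"] by simp
next
  case (Mult x y)
  have "\<pi> x v \<in> carrier H" "\<pi> y v \<in> carrier H" "\<pi> (Star x) v \<in> carrier H" "\<pi> (Star y) v \<in> carrier H"
    using Mult.prems bounded_opsD(1)[OF \<pi>_bounded] by simp_all
  then show ?case
    using Mult \<pi>_cong[OF env_eq.star_mult, of x y] \<pi>_mult[of x y] \<pi>_mult[of "Star y" "Star x"]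
    by (simp add: compose_eq)
next
  case (Star x)
  then show ?case using \<pi>_cong[OF env_eq.star_star, of x] by simp
qed

text \<open>The fibre over a of the induced net has the same space, grading and D, so only u and
  \<pi> have to be compared: \<open>frame_loop_loop\<close> settles the first and
  \<open>induced_interp\<close> the second.\<close>

lemma induced_fibre_arrow: "op_one H \<in> eqv_arrows (fibre_triple N a G) X"
proof -
  have "eu X g v = eu (fibre_triple N a G) g v"
    if g: "g \<in> carrier (fundamental_group a)" and v: "v \<in> carrier H" for g v
  proof -
    obtain p where p: "p \<in> paths a a" "g = homotopy_class p" using g by (auto simp: fundamental_group_carrier)
    then show ?thesis
      using G.fibre_u[OF p(1)] induced_transport[OF p(1) v] homotopy_class_eqI[OF frame_loop_loop[OF p(1)]]
      by simp
  qed
  moreover have "e\<pi> X C v = e\<pi> (fibre_triple N a G) C v"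
    if C: "C \<in> carrier (env_algebra N a)" and v: "v \<in> carrier H" for C v
  proof -
    obtain x where x: "env_wf N a x" "C = env_class N a x" using C by (auto simp: env_algebra_carrier)
    then show ?thesis using G.fibre_rep[OF x(1)] induced_interp[OF x(1) v, of False] by simp
  qed
  ultimately show ?thesis
    unfolding equivariant_arrows_iff[OF G.fibre_equivariant equivariant]
    using H.spectral_unitary_one unitariesD(1)[OF u_unitary] bounded_opsD(1)[OF rep_bounded]
    by (simp add: op_one_def)
qed

end

section \<open>Arrows between induced nets and the unit\<close>

context algebra_net
begin

lemma induced_net_arrow:
  assumes X: "est X" and Y: "est Y" and V: "V \<in> eqv_arrows X Y"
  shows "(\<lambda>x. V) \<in> net_triple_arrows N (induced_net N a X) (induced_net N a Y)"
proof -
  interpret X: equivariant_triple a N X using X by (simp add: equivariant_tripleI)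
  interpret Y: equivariant_triple a N Y using Y by (simp add: equivariant_tripleI)
  note V' = V[unfolded equivariant_arrows_iff[OF X Y]]
  have "env_class N a (Gen (frame a x) t) \<in> carrier (env_algebra N a)" if "t \<in> carrier (alg N x)" for x t
    using X.env_class_carrier[OF env_wf_frame[OF that]] .
  then show ?thesis
    unfolding net_triple_arrows_iff[OF X.induced_net_triple Y.induced_net_triple]
    using V' X.class_carrier[OF frame_loop_paths[OF arrow_path_paths]] by simp
qed

text \<open>Compatibility with U is the homotopy \<open>frame_loop_frame\<close> pushed through
  transport. Compatibility with \<pi> is the evaluation of a generator on a frame path.\<close>

lemma frame_transport_arrow:
  assumes X: "net_of_spectral_triples N X"
  shows "(\<lambda>x. transport X (frame a x)) \<in> net_triple_arrows N X (induced_net N a (fibre_triple N a X))"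
proof -
  interpret X: spectral_net a N X using X by (simp add: spectral_netI)
  interpret F: equivariant_triple a N "fibre_triple N a X"
    using X.fibre_equivariant by (simp add: equivariant_tripleI)
  have U: "transport X (frame a y) (nU X y x v)
      = eu (fibre_triple N a X) (homotopy_class (frame_loop a (arrow_path y x))) (transport X (frame a x) v)"
    if xy: "x \<le> y" and v: "v \<in> carrier (nspace X x)" for x y v
  proof -
    note A = arrow_path_paths[OF xy]
    have "transport X (frame_loop a (arrow_path y x) @ frame a x) v = transport X (frame a y @ arrow_path y x) v"
      using X.transport_homotopic[OF frame_loop_frame[OF A]] by simp
    then show ?thesis
      using X.transport_append[OF frame_loop_paths[OF A] frame_paths v]
        X.transport_append[OF frame_paths A v] X.transport_arrow_path[OF xy v]
        X.fibre_u[OF frame_loop_paths[OF A]] by simp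
  qed
  have \<pi>: "e\<pi> (fibre_triple N a X) (env_class N a (Gen (frame a x) t)) (transport X (frame a x) v)
      = transport X (frame a x) (n\<pi> X x t v)"
    if t: "t \<in> carrier (alg N x)" and v: "v \<in> carrier (nspace X x)" for x t v
  proof -
    show ?thesis
      using X.fibre_rep[OF env_wf_frame[OF t]] X.interp_Gen[OF frame_paths v, of False t]
      by (simp del: interp.simps)
  qed
  show ?thesis
    unfolding net_triple_arrows_iff[OF X F.induced_net_triple]
    using X.transport_spectral[OF frame_paths] U \<pi> by simp
qed

end

section \<open>The equivalence of categories\<close>

theorem theorem4p4:
  fixes N :: "('k::order, 'a) alg_net" and a :: 'k
  assumes "pathwise_connected TYPE('k)"
    and "star_algebra_net N"
    and "net_grading N"
  shows "equivalent_categories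
    (ncg_nets N :: (('k, 'a, 'h) net_triple, 'k \<Rightarrow> 'h \<Rightarrow> 'h) cat_data)
    (ncg_equivariant (fundamental_group a) (env_algebra N a) (env_grading N a) (env_action N a)
      :: (('k po_path set, ('k, 'a) env_term set, 'h) eq_triple, 'h \<Rightarrow> 'h) cat_data)"
proof -
  interpret algebra_net a N
    using assms by (simp add: algebra_net_def algebra_net_axioms_def connected_poset_def)
  let ?C = "ncg_nets N :: (('k, 'a, 'h) net_triple, 'k \<Rightarrow> 'h \<Rightarrow> 'h) cat_data"
  let ?D = "ncg_eqv :: (('k po_path set, ('k, 'a) env_term set, 'h) eq_triple, 'h \<Rightarrow> 'h) cat_data"
  let ?F0 = "fibre_triple N a :: ('k, 'a, 'h) net_triple \<Rightarrow> _"
  let ?F1 = "\<lambda>(X :: ('k, 'a, 'h) net_triple) (Y :: ('k, 'a, 'h) net_triple) (V :: 'k \<Rightarrow> 'h \<Rightarrow> 'h). V a"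
  let ?G0 = "induced_net N a :: _ \<Rightarrow> ('k, 'a, 'h) net_triple"
  let ?G1 = "\<lambda>(X :: ('k po_path set, ('k, 'a) env_term set, 'h) eq_triple)
      (Y :: ('k po_path set, ('k, 'a) env_term set, 'h) eq_triple) (V :: 'h \<Rightarrow> 'h) (x :: 'k). V"
  let ?\<eta> = "\<lambda>X x. transport X (frame a x)"
  let ?\<epsilon> = "\<lambda>X. op_one (espace X)"
  have F: "est (?F0 X)" if "net_of_spectral_triples N X" for X :: "('k, 'a, 'h) net_triple"
    using spectral_net.fibre_equivariant[OF spectral_netI[OF that]] .
  have G: "net_of_spectral_triples N (?G0 X)" if "est X"
    for X :: "('k po_path set, ('k, 'a) env_term set, 'h) eq_triple"
    using equivariant_triple.induced_net_triple[OF equivariant_tripleI[OF that]] .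
  have sp [simp]: "espace (?F0 X) = nspace X a" for X by (simp add: fibre_triple_def)
  have sp' [simp]: "nspace (?G0 X) x = espace X" for X x by (simp add: induced_net_def)
  \<comment> \<open>Taking the component at a respects identities and composites by their
    definitions, as does the constant family below; only membership in the hom sets has
    content.\<close>
  have "is_functor ?C ?D ?F0 ?F1"
    unfolding is_functor_def using F
    by (simp add: ncg_nets_def ncg_equivariant_def fibre_arrow)
  moreover have "is_functor ?D ?C ?G0 ?G1"
    unfolding is_functor_def using G
    by (simp add: ncg_nets_def ncg_equivariant_def induced_net_arrow)
  moreover have "natural_isomorphism ?C ?C (\<lambda>X. X) (\<lambda>X Y f. f)
      (\<lambda>X. ?G0 (?F0 X)) (\<lambda>X Y f. ?G1 (?F0 X) (?F0 Y) (?F1 X Y f)) ?\<eta>"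
    unfolding natural_isomorphism_def
  proof (intro conjI ballI)
    fix X assume "X \<in> Obj ?C"
    then have X: "net_of_spectral_triples N X" by (simp add: ncg_nets_def)
    show "isomorphism ?C X (?G0 (?F0 X)) (?\<eta> X)"
      using net_isomorphism[OF X G[OF F[OF X]] frame_transport_arrow[OF X]] .
    fix Y f assume "Y \<in> Obj ?C" "f \<in> Hom ?C X Y"
    then have "net_of_spectral_triples N Y" "f \<in> net_triple_arrows N X Y" by (simp_all add: ncg_nets_def)
    then show "Comp ?C X Y (?G0 (?F0 Y)) (?\<eta> Y) f
        = Comp ?C X (?G0 (?F0 X)) (?G0 (?F0 Y)) (\<lambda>x. f a) (?\<eta> X)"
      \<comment> \<open>The square at x is naturality of transport along \<open>frame a x\<close>.
        Extensionality is used only in the point of the poset, so that \<open>compose_eq_iff\<close>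
        can deal with the fibres.\<close>
      using transport_natural[OF X _ _ frame_paths]
      by (simp add: ncg_nets_def compose_eq_iff fun_eq_iff[where 'a = 'k])
  qed
  moreover have "natural_isomorphism ?D ?D
      (\<lambda>X. ?F0 (?G0 X)) (\<lambda>X Y f. ?F1 (?G0 X) (?G0 Y) (?G1 X Y f)) (\<lambda>X. X) (\<lambda>X Y f. f) ?\<epsilon>"
    unfolding natural_isomorphism_def
  proof (intro conjI ballI)
    fix X assume "X \<in> Obj ?D"
    then have X: "est X" by (simp add: ncg_equivariant_def)
    show "isomorphism ?D (?F0 (?G0 X)) X (?\<epsilon> X)"
      using equivariant_isomorphism[OF F[OF G[OF X]] X
          equivariant_triple.induced_fibre_arrow[OF equivariant_tripleI[OF X]]] .
    fix Y f assume "Y \<in> Obj ?D" "f \<in> Hom ?D X Y"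
    then have "f \<in> unitaries (espace X) (espace Y)"
      by (simp add: ncg_equivariant_def equivariant_arrows_def)
    \<comment> \<open>The counit is an identity map on both sides, so the square reduces to the unit
      laws.\<close>
    then show "Comp ?D (?F0 (?G0 X)) (?F0 (?G0 Y)) Y (?\<epsilon> Y) f = Comp ?D (?F0 (?G0 X)) X Y f (?\<epsilon> X)"
      by (simp add: ncg_equivariant_def compose_op_one)
  qed
  ultimately show ?thesis
    unfolding equivalent_categories_def
    using category_ncg_nets category_ncg_equivariant by blast
qed

end
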